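(* Let $(A,B)$ be a pair of Newton polygons in $\mathbb{Z}^2$. Then a system supported at $(A,B)$ cannot have a root of multiplicity $3$ if and only if $\mathrm{MV}(A,B)\le 2$; that is, if a system supported at $(A,B)$ can have at least $3$ roots, then some system supported at $(A,B)$ has a root of multiplicity $3$.
   Context: A Newton polygon is here identified with its set of lattice points, i.e. a finite set $A=\mathbb{Z}^2\cap \mathrm{conv}(A)$. For a finite $A\subset\mathbb{Z}^2$, $\mathbb{C}^A$ is the space of Laurent polynomials $\sum_{a\in A}c_az^a$ in two variables with $c_a\in\mathbb{C}$, where $z^a=z_1^{a_1}z_2^{a_2}$ and $z_1,z_2\in\mathbb{C}^*$. A system supported at $(A,B)$ is a system $f=g=0$ with $f\in\mathbb{C}^A$, $g\in\mathbb{C}^B$. A root of multiplicity $m$ is an isolated solution $p\in(\mathbb{C}^* )^2$ of the system whose local intersection multiplicity $\dim_{\mathbb{C}}\mathcal{O}_p/(f,g)$ equals $m$, where $\mathcal{O}_p$ is the local ring of $(\mathbb{C}^* )^2$ at $p$. $\mathrm{MV}(A,B)=\mathrm{Area}(P+Q)-\mathrm{Area}(P)-\mathrm{Area}(Q)$ is the mixed volume of $P=\mathrm{conv}(A)$ and $Q=\mathrm{conv}(B)$, where $P+Q$ is the Minkowski sum (so that a generic system supported at $(A,B)$ has $\mathrm{MV}(A,B)$ roots in $(\mathbb{C}^* )^2$).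
   Formalization: Newton polygons are required to be two-dimensional (points and segments excluded); for the segments A={(0,0),(1,0)}, B={(0,0),(1,3)} one has MV(A,B)=3 but every root is simple, so the claim fails there. *)

theory Defs
  imports
    "HOL-Analysis.Analysis"
    "HOL-Library.Poly_Mapping"
    "HOL-Computational_Algebra.Polynomial_Factorial"
    "HOL-Algebra.Embedded_Algebras"
    "HOL-Algebra.QuotRing"
begin

definition real_point :: "int \<times> int \<Rightarrow> real \<times> real"
  where "real_point a = (real_of_int (fst a), real_of_int (snd a))"

definition conv :: "(int \<times> int) set \<Rightarrow> (real \<times> real) set"
  where "conv A = convex hull (real_point ` A)"

(* Polygons are two-dimensional: points and segments are excluded.  For the segments
   A = {(0,0), (1,0)} and B = {(0,0), (1,3)} the mixed volume is 3, but all roots of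
   systems supported at (A, B) are simple. *)
definition newton_polygon :: "(int \<times> int) set \<Rightarrow> bool"
  where "newton_polygon A \<longleftrightarrow>
    finite A \<and> A = {a. real_point a \<in> conv A} \<and> interior (conv A) \<noteq> {}"

definition area :: "(real \<times> real) set \<Rightarrow> real"
  where "area P = measure lebesgue P"

(* The sum of the two hulls is the Minkowski sum from Set_Algebras. *)
definition MV :: "(int \<times> int) set \<Rightarrow> (int \<times> int) set \<Rightarrow> real"
  where "MV A B = area (conv A + conv B) - area (conv A) - area (conv B)"

(* The group algebra of the lattice: the exponent a stands for the monomial z^a. *)
type_synonym laurent = "(int \<times> int) \<Rightarrow>\<^sub>0 complex"

definition laurent_space :: "(int \<times> int) set \<Rightarrow> laurent set"
  where "laurent_space A = {f. Poly_Mapping.keys f \<subseteq> A}"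

definition laurent_eval :: "laurent \<Rightarrow> complex \<times> complex \<Rightarrow> complex"
  where "laurent_eval f p =
    (\<Sum>a\<in>Poly_Mapping.keys f. Poly_Mapping.lookup f a * fst p powi fst a * snd p powi snd a)"

definition torus :: "(complex \<times> complex) set"
  where "torus = {p. fst p \<noteq> 0 \<and> snd p \<noteq> 0}"

definition solutions :: "laurent \<Rightarrow> laurent \<Rightarrow> (complex \<times> complex) set"
  where "solutions f g = {p \<in> torus. laurent_eval f p = 0 \<and> laurent_eval g p = 0}"

(* The rational function field of the torus, C(z1, z2): z1 is the inner polynomial
   variable and z2 the outer one. *)
type_synonym ratfun = "complex poly poly fract"

definition const_fun :: "complex \<Rightarrow> ratfun"
  where "const_fun c = to_fract [:[:c:]:]"

definition z1 :: ratfun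
  where "z1 = to_fract [:[:0, 1:]:]"

definition z2 :: ratfun
  where "z2 = to_fract [:0, 1:]"

definition laurent_fun :: "laurent \<Rightarrow> ratfun"
  where "laurent_fun f =
    (\<Sum>a\<in>Poly_Mapping.keys f. const_fun (Poly_Mapping.lookup f a) * z1 powi fst a * z2 powi snd a)"

definition poly2 :: "complex poly poly \<Rightarrow> complex \<times> complex \<Rightarrow> complex"
  where "poly2 q p = poly (poly q [:snd p:]) (fst p)"

(* The rational functions regular at p.  For p in the torus, polynomial and Laurent
   polynomial fractions give the same ring, since z1 and z2 do not vanish at p. *)
definition local_ring :: "complex \<times> complex \<Rightarrow> ratfun ring"
  where "local_ring p =
    \<lparr>carrier = {to_fract a / to_fract b | a b. poly2 b p \<noteq> 0},
     monoid.mult = (*), one = 1, zero = 0, add = (+)\<rparr>"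

definition system_ideal :: "complex \<times> complex \<Rightarrow> laurent \<Rightarrow> laurent \<Rightarrow> ratfun set"
  where "system_ideal p f g = genideal (local_ring p) {laurent_fun f, laurent_fun g}"

definition quotient_ring :: "complex \<times> complex \<Rightarrow> laurent \<Rightarrow> laurent \<Rightarrow> ratfun set ring"
  where "quotient_ring p f g = local_ring p Quot system_ideal p f g"

(* The copy of the complex numbers inside the quotient. *)
definition quotient_constants :: "complex \<times> complex \<Rightarrow> laurent \<Rightarrow> laurent \<Rightarrow> ratfun set set"
  where "quotient_constants p f g =
    range (\<lambda>c. system_ideal p f g +>\<^bsub>local_ring p\<^esub> const_fun c)"

(* The intersection multiplicity is a relation, so an infinite-dimensional quotient
   has no multiplicity. *)
definition intersection_multiplicity ::
    "complex \<times> complex \<Rightarrow> laurent \<Rightarrow> laurent \<Rightarrow> nat \<Rightarrow> bool"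
  where "intersection_multiplicity p f g m \<longleftrightarrow>
    ring.dimension (quotient_ring p f g) m
      (quotient_constants p f g) (carrier (quotient_ring p f g))"

definition roots :: "laurent \<Rightarrow> laurent \<Rightarrow> (complex \<times> complex) set"
  where "roots f g = {p. p isolated_in solutions f g}"

definition root_of_multiplicity ::
    "laurent \<Rightarrow> laurent \<Rightarrow> complex \<times> complex \<Rightarrow> nat \<Rightarrow> bool"
  where "root_of_multiplicity f g p m \<longleftrightarrow>
    p \<in> roots f g \<and> intersection_multiplicity p f g m"

definition can_have_root_of_multiplicity ::
    "(int \<times> int) set \<Rightarrow> (int \<times> int) set \<Rightarrow> nat \<Rightarrow> bool"
  where "can_have_root_of_multiplicity A B m \<longleftrightarrow>
    (\<exists>f\<in>laurent_space A. \<exists>g\<in>laurent_space B. \<exists>p. root_of_multiplicity f g p m)"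

definition can_have_at_least_roots ::
    "(int \<times> int) set \<Rightarrow> (int \<times> int) set \<Rightarrow> nat \<Rightarrow> bool"
  where "can_have_at_least_roots A B n \<longleftrightarrow>
    (\<exists>f\<in>laurent_space A. \<exists>g\<in>laurent_space B. \<exists>S\<subseteq>roots f g. finite S \<and> card S = n)"

end

theory Submission
  imports Defs "HOL-Complex_Analysis.Great_Picard" "HOL-Computational_Algebra.Fundamental_Theorem_Algebra"
begin

text \<open>
Let \<open>T = {a, a + u, a + v}\<close> be a unimodular triangle in \<open>A\<close>. In its frame, a polynomial with support \<open>T\<close>
is a line, and \<open>B\<close> has a size: the size of the smallest multiple of the unit triangle that contains a
translate of it. That size is the mixed volume of \<open>T\<close> and \<open>B\<close>. The proof separates pairs in which
some triangle of one polygon sees the other polygon with size at least three from pairs in which none does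
(\<open>narrow\<close>), and each side of the equivalence is decided by this alternative.

Suppose that some size is at least three. Monotonicity of the mixed area makes the mixed volume at least
three (\<open>MV_ge_spread\<close>); monotonicity and the lower bound for the unit triangle come from moving pieces of
shells of convex bodies by translations (\<open>measure_shell_le_sum_shell\<close>, \<open>mixed_area_corner_ge\<close>).
A triple root is obtained from a line and a curve that touch at the unit point to order exactly three
(\<open>contact_gives_dimension_three\<close>). Restricted to the line through that point of slope \<open>s\<close>, a monomial of \<open>B\<close>
becomes \<open>(1 + t)^m (1 + s t)^n\<close>, so one needs a combination of such powers of order three in \<open>t\<close>.
If \<open>B\<close> contains a unimodular triangle that already has size at least three, a trinomial works. When this
triangle and \<open>T\<close> have no edge direction in common, the slope must be a simple root of a cubic, and a
discriminant computation shows that the cubic is never the cube of a linear polynomial (\<open>no_triple_root\<close>);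
with a common direction the equation becomes quadratic. If \<open>B\<close> contains no such triangle, then either four
columns of \<open>B\<close> are occupied, up to a symmetry of \<open>T\<close>, and a Vandermonde combination with slope zero works, or \<open>B\<close> contains a point configuration inscribed in a triangle of size three and the identity
of \<open>triple_contact_inscribed\<close> with slope \<open>-1\<close> applies (\<open>triple_contact_of_wide\<close>).

Suppose that both polygons are narrow with respect to each other. If one of them is a unimodular triangle,
the other lies in the double triangle of its frame. Otherwise the two are translates of one parallelogram of
area one or of one triangle of area one with an edge of length two (\<open>twins\<close>). In each case the mixed volume
is at most two. Moreover the equations can be solved by hand: either they reduce to \<open>V = a(U)\<close> and
\<open>h(U) = 0\<close> with \<open>h\<close> nonzero of degree at most two, which allows at most two roots and multiplicity at most two,
or their solutions lie on curves of solutions and are not isolated (\<open>small_system_roots\<close>).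
So such a pair admits neither a triple root nor three roots.
\<close>

section \<open>Unimodular coordinates on the lattice\<close>

definition det2 :: "int \<times> int \<Rightarrow> int \<times> int \<Rightarrow> int"
  where "det2 u v = fst u * snd v - snd u * fst v"

definition lattice_map :: "int \<times> int \<Rightarrow> int \<times> int \<Rightarrow> int \<times> int \<Rightarrow> int \<times> int \<Rightarrow> int \<times> int"
  where "lattice_map a u v p =
    (fst a + fst p * fst u + snd p * fst v, snd a + fst p * snd u + snd p * snd v)"

text \<open>Cramer's rule without a division: the determinant is its own inverse when it is a sign.\<close>

definition coord :: "int \<times> int \<Rightarrow> int \<times> int \<Rightarrow> int \<times> int \<Rightarrow> int \<times> int"
  where "coord u v a = (det2 u v * det2 a v, det2 u v * det2 u a)"

lemma det2_square:
  assumes "\<bar>det2 u v\<bar> = 1" shows "det2 u v * (det2 u v * x) = x"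
proof -
  have "det2 u v = 1 \<or> det2 u v = - 1" using assms by linarith
  then show ?thesis by auto
qed

lemma lattice_map_coord:
  assumes "\<bar>det2 u v\<bar> = 1"
  shows "lattice_map 0 u v (coord u v a) = a"
proof -
  let ?D = "det2 u v"
  have e: "det2 a v * fst u + det2 u a * fst v = ?D * fst a"
    "det2 a v * snd u + det2 u a * snd v = ?D * snd a"
    by (simp_all add: det2_def algebra_simps)
  have "lattice_map 0 u v (coord u v a) = (?D * (det2 a v * fst u + det2 u a * fst v),
      ?D * (det2 a v * snd u + det2 u a * snd v))"
    by (simp add: lattice_map_def coord_def distrib_left mult.assoc)
  then show ?thesis unfolding e det2_square[OF assms] by simp
qed

lemma coord_lattice_map:
  assumes "\<bar>det2 u v\<bar> = 1"
  shows "coord u v (lattice_map 0 u v c) = c"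
proof -
  have e: "det2 (lattice_map 0 u v c) v = det2 u v * fst c" "det2 u (lattice_map 0 u v c) = det2 u v * snd c"
    by (simp_all add: det2_def lattice_map_def algebra_simps)
  show ?thesis unfolding coord_def e det2_square[OF assms] by simp
qed

lemma coord_add: "coord u v (a + b) = coord u v a + coord u v b"
  by (simp add: coord_def det2_def algebra_simps)

lemma coord_0: "coord u v 0 = 0"
  by (simp add: coord_def det2_def prod_eq_iff)

lemma coord_basis:
  assumes "\<bar>det2 u v\<bar> = 1" shows "coord u v u = (1, 0)" "coord u v v = (0, 1)"
  using coord_lattice_map[OF assms, of "(1, 0)"] coord_lattice_map[OF assms, of "(0, 1)"]
  by (simp_all add: lattice_map_def)

lemma lattice_map_translate: "lattice_map a u v c = a + lattice_map 0 u v c"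
  by (simp add: lattice_map_def prod_eq_iff)

section \<open>Shells of convex bodies\<close>

text \<open>The displacement from the nearest point of the body, so a vector of the normal cone there; it vanishes on the
  body.\<close>

definition outward :: "'a::euclidean_space set \<Rightarrow> 'a \<Rightarrow> 'a"
  where "outward P x = x - closest_point P x"

text \<open>Points are sorted by the vertex at which their outward normal is largest, so outside the body these cells are
  the thickened normal fan of \<open>B\<close>; ties put a point into several cells.\<close>

definition leading :: "'a::euclidean_space set \<Rightarrow> 'a set \<Rightarrow> 'a \<Rightarrow> 'a set"
  where "leading P B b = {x. \<forall>b'\<in>B. outward P x \<bullet> b' \<le> outward P x \<bullet> b}"

lemma compact_set_plus:
  fixes S T :: "'a::real_normed_vector set"
  assumes "compact S" "compact T"
  shows "compact (S + T)"
proof -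
  have "S + T = (\<Union>x\<in>S. \<Union>y\<in>T. {x + y})" by (auto simp: set_plus_def)
  then show ?thesis using compact_sums'[OF assms] by simp
qed

lemma inner_le_on_hull:
  fixes n :: "'a::euclidean_space"
  assumes "\<forall>b'\<in>B. n \<bullet> b' \<le> k" "c \<in> convex hull B"
  shows "n \<bullet> c \<le> k"
proof -
  have "convex hull B \<subseteq> {c. n \<bullet> c \<le> k}"
    by (rule hull_minimal) (use assms in \<open>auto simp: convex_halfspace_le\<close>)
  then show ?thesis using assms by auto
qed

text \<open>The variational inequality characterises the nearest point, because two candidates would have nonpositive
  squared distance.\<close>

lemma outward_eqI:
  fixes P :: "'a::euclidean_space set"
  assumes P: "convex P" "closed P" "q \<in> P" and le: "\<And>p. p \<in> P \<Longrightarrow> (x - q) \<bullet> (p - q) \<le> 0"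
  shows "closest_point P x = q" "outward P x = x - q"
proof -
  let ?c = "closest_point P x"
  have c: "?c \<in> P" using closest_point_in_set[of P x] P by auto
  have "(x - ?c) \<bullet> (q - ?c) \<le> 0" using closest_point_dot[OF P] .
  moreover have "(x - q) \<bullet> (?c - q) \<le> 0" using le[OF c] .
  ultimately have "(?c - q) \<bullet> (?c - q) \<le> 0"
    by (simp add: inner_diff_left inner_diff_right inner_commute algebra_simps)
  then have "?c - q = 0" by (metis inner_eq_zero_iff inner_ge_zero antisym)
  then show "?c = q" by simp
  then show "outward P x = x - q" by (simp add: outward_def)
qed

lemma continuous_outward:
  assumes "convex P" "closed P" "P \<noteq> {}"
  shows "continuous_on UNIV (outward P)"
  unfolding outward_def by (intro continuous_intros continuous_on_closest_point assms)

lemma closed_leading: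
  assumes "convex P" "closed P" "P \<noteq> {}"
  shows "closed (leading P B b)"
proof -
  have "leading P B b = (\<Inter>b'\<in>B. {x. outward P x \<bullet> b' \<le> outward P x \<bullet> b})"
    by (auto simp: leading_def)
  moreover have "closed {x. outward P x \<bullet> b' \<le> outward P x \<bullet> b}" for b'
    by (intro closed_Collect_le continuous_intros continuous_outward assms)
  ultimately show ?thesis by auto
qed

text \<open>If \<open>b\<close> is extreme for the normal at \<open>x\<close>, then translation by \<open>b\<close>
  carries the supporting line of \<open>P\<close> at the nearest point to a supporting line of
  \<open>P + conv B\<close>. Thus translation by \<open>b\<close> preserves outward vectors on the cell of
  \<open>b\<close>.\<close>

lemma outward_translate:
  fixes P :: "'a::euclidean_space set"
  assumes P: "convex P" "closed P" "P \<noteq> {}" and bB: "b \<in> B" and x: "x \<in> leading P B b"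
    and y: "y \<in> P + convex hull B"
  shows "outward P x \<bullet> (y - (closest_point P x + b)) \<le> 0"
proof -
  obtain p c where pc: "p \<in> P" "c \<in> convex hull B" "y = p + c"
    using y by (auto simp: set_plus_def)
  have "outward P x \<bullet> (p - closest_point P x) \<le> 0"
    unfolding outward_def using closest_point_dot[OF P(1,2) pc(1)] .
  moreover have "outward P x \<bullet> c \<le> outward P x \<bullet> b"
    by (rule inner_le_on_hull[OF _ pc(2)]) (use x in \<open>auto simp: leading_def\<close>)
  ultimately show ?thesis by (simp add: pc(3) inner_diff_right inner_add_right)
qed

lemma measure_disjoint_translates:
  fixes E :: "'b \<Rightarrow> 'a::euclidean_space set"
  assumes "finite I" "\<And>i. i \<in> I \<Longrightarrow> E i \<in> lmeasurable" "disjoint_family_on E I"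
  shows "measure lebesgue (\<Union>i\<in>I. E i) = (\<Sum>i\<in>I. measure lebesgue ((+) (t i) ` E i))"
proof -
  have "emeasure lebesgue (E i) \<noteq> \<infinity>" if "i \<in> I" for i
    using fmeasurableD2[OF assms(2)[OF that]] unfolding infinity_ennreal_def .
  then have "measure lebesgue (\<Union>i\<in>I. E i) = (\<Sum>i\<in>I. measure lebesgue (E i))"
    using assms by (intro measure_finite_Union) (auto dest: fmeasurableD)
  then show ?thesis by (simp add: measure_translation)
qed

text \<open>The shell \<open>P' - P\<close> embeds piecewise by translation into the shell of the sums: each point moves
  by a vertex of \<open>B\<close> that is extreme for its outward normal. The image avoids
  \<open>P + conv B\<close> because the outward vector is preserved, and the map is injective because normals
  of a convex body are monotone. This inequality of volumes is exactly monotonicity of the mixed area in its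
  first argument.\<close>

proposition measure_shell_le_sum_shell:
  fixes P P' B :: "'a::euclidean_space set"
  assumes P: "compact P" "convex P" "P \<noteq> {}" and P': "compact P'" and B: "finite B" "B \<noteq> {}"
  shows "measure lebesgue (P' - P) \<le>
    measure lebesgue ((P' + convex hull B) - (P + convex hull B))"
proof -
  have cl: "closed P" using P(1) by (rule compact_imp_closed)
  obtain idx :: "'a \<Rightarrow> nat" where idx: "inj_on idx B"
    using finite_imp_inj_to_nat_seg[OF B(1)] by blast
  (* Ties between extreme vertices are broken by an arbitrary enumeration of B, so the pieces are disjoint. *)
  define E where "E b = (P' - P) \<inter> (leading P B b - (\<Union>b'\<in>{b'\<in>B. idx b' < idx b}. leading P B b'))" for b
  let ?W = "(P' + convex hull B) - (P + convex hull B)"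
  have meas: "E b \<in> lmeasurable" for b
  proof -
    have "leading P B b - (\<Union>b'\<in>{b'\<in>B. idx b' < idx b}. leading P B b') \<in> sets lebesgue"
      using closed_leading[OF P(2) cl P(3)] B(1)
      by (intro sets.Diff sets.finite_UN) auto
    moreover have "P' - P \<in> lmeasurable"
      using P P' by (intro fmeasurable.Diff lmeasurable_compact)
    ultimately show ?thesis unfolding E_def by (rule fmeasurable_Int_fmeasurable[rotated])
  qed
  have disj: "disjoint_family_on E B"
    unfolding disjoint_family_on_def
  proof (intro ballI impI)
    fix b b' assume "b \<in> B" "b' \<in> B" "b \<noteq> b'"
    then have "idx b < idx b' \<or> idx b' < idx b" using idx by (metis inj_onD nat_neq_iff)
    then show "E b \<inter> E b' = {}" using \<open>b \<in> B\<close> \<open>b' \<in> B\<close> unfolding E_def by blast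
  qed
  have cover: "P' - P = (\<Union>b\<in>B. E b)"
  proof
    show "P' - P \<subseteq> (\<Union>b\<in>B. E b)"
    proof
      fix x assume x: "x \<in> P' - P"
      have "\<exists>b\<in>B. \<forall>b'\<in>B. outward P x \<bullet> b' \<le> outward P x \<bullet> b"
      proof -
        have "Max ((\<lambda>b. outward P x \<bullet> b) ` B) \<in> (\<lambda>b. outward P x \<bullet> b) ` B" using B by (intro Max_in) auto
        then obtain b where "b \<in> B" "Max ((\<lambda>b. outward P x \<bullet> b) ` B) = outward P x \<bullet> b" by auto
        then show ?thesis using B by (metis Max_ge finite_imageI imageI)
      qed
      then have ex: "\<exists>b. b \<in> B \<and> x \<in> leading P B b" by (auto simp: leading_def)
      define b where "b = arg_min idx (\<lambda>b. b \<in> B \<and> x \<in> leading P B b)"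
      have b: "b \<in> B" "x \<in> leading P B b"
        using arg_min_natI[of "\<lambda>b. b \<in> B \<and> x \<in> leading P B b"] ex unfolding b_def by blast+
      have "x \<notin> leading P B b'" if "b' \<in> B" "idx b' < idx b" for b'
        using arg_min_nat_le[of "\<lambda>b. b \<in> B \<and> x \<in> leading P B b" b' idx] that unfolding b_def by auto
      then show "x \<in> (\<Union>b\<in>B. E b)" using b x unfolding E_def by blast
    qed
  qed (auto simp: E_def)
  have inW: "(+) b ` E b \<subseteq> ?W" if b: "b \<in> B" for b
  proof
    fix y assume "y \<in> (+) b ` E b"
    then obtain x where x: "x \<in> E b" "y = b + x" by auto
    then have xl: "x \<in> leading P B b" "x \<in> P'" "x \<notin> P" by (auto simp: E_def)
    have "y \<notin> P + convex hull B"
    proof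
      assume "y \<in> P + convex hull B"
      from outward_translate[OF P(2) cl P(3) b xl(1) this]
      have "outward P x \<bullet> outward P x \<le> 0" by (simp add: x(2) outward_def algebra_simps)
      then have "outward P x = 0" by (metis inner_eq_zero_iff inner_ge_zero antisym)
      then have "x = closest_point P x" by (simp add: outward_def)
      then show False using closest_point_in_set[OF cl P(3), of x] xl(3) by simp
    qed
    moreover have "y \<in> P' + convex hull B"
      unfolding x(2) add.commute[of b] by (intro set_plus_intro xl(2) hull_inc b)
    ultimately show "y \<in> ?W" by blast
  qed
  have disj2: "disjoint_family_on (\<lambda>b. (+) b ` E b) B"
    unfolding disjoint_family_on_def
  proof (intro ballI impI, rule ccontr)
    fix b b' assume bb: "b \<in> B" "b' \<in> B" "b \<noteq> b'" and "(+) b ` E b \<inter> (+) b' ` E b' \<noteq> {}"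
    then obtain x x' where x: "x \<in> E b" "x' \<in> E b'" and eq: "b + x = b' + x'" by auto
    let ?n = "outward P x" and ?n' = "outward P x'"
    let ?q = "closest_point P x + b" and ?q' = "closest_point P x' + b'"
    have mem: "?q \<in> P + convex hull B" "?q' \<in> P + convex hull B"
      using bb hull_inc[of b B] hull_inc[of b' B] closest_point_in_set[OF cl P(3)] by (auto intro!: set_plus_intro)
    have le: "?n \<bullet> (?q' - ?q) \<le> 0" "?n' \<bullet> (?q - ?q') \<le> 0"
      using outward_translate[OF P(2) cl P(3) bb(1) _ mem(2)] outward_translate[OF P(2) cl P(3) bb(2) _ mem(1)] x
      by (auto simp: E_def)
    (* The two translated points agree, so the difference of the normals is opposite to that of the nearest
       points of the sum. *)
    have d: "?n - ?n' = ?q' - ?q" using eq by (simp add: outward_def algebra_simps)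
    have "(?n - ?n') \<bullet> (?n - ?n') = ?n \<bullet> (?q' - ?q) - ?n' \<bullet> (?q' - ?q)"
      unfolding d[symmetric] by (simp only: inner_diff_left)
    also have "?n' \<bullet> (?q' - ?q) = - (?n' \<bullet> (?q - ?q'))" by (simp only: inner_diff_right)
    finally have "(?n - ?n') \<bullet> (?n - ?n') \<le> 0" using le by linarith
    then have "?n - ?n' = 0" by (metis inner_eq_zero_iff inner_ge_zero antisym)
    then have "?n = ?n'" by simp
    then have "x \<in> leading P B b'" "x' \<in> leading P B b" using x by (auto simp: E_def leading_def)
    moreover have "idx b < idx b' \<or> idx b' < idx b" using idx bb by (metis inj_onD nat_neq_iff)
    ultimately show False using x bb by (auto simp: E_def)
  qed
  have meas2: "(+) b ` E b \<in> lmeasurable" for b using meas by (rule measurable_translation)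
  have "measure lebesgue (P' - P) = (\<Sum>b\<in>B. measure lebesgue ((+) b ` E b))"
    unfolding cover using measure_disjoint_translates[OF B(1) meas disj, of "\<lambda>b. b"] by simp
  also have "\<dots> = measure lebesgue (\<Union>b\<in>B. (+) b ` E b)"
    using measure_disjoint_translates[OF B(1) meas2 disj2, of "\<lambda>b. 0"] by (simp add: image_image)
  also have "\<dots> \<le> measure lebesgue ?W"
  proof (rule measure_mono_fmeasurable)
    have "compact (P' + convex hull B)" "compact (P + convex hull B)"
      using P P' finite_imp_compact_convex_hull[OF B(1)] by (auto intro: compact_set_plus)
    then show "?W \<in> lmeasurable" by (intro fmeasurable.Diff lmeasurable_compact)
    show "(\<Union>b\<in>B. (+) b ` E b) \<in> sets lebesgue" using meas2 B(1) by (intro sets.finite_UN) (auto dest: fmeasurableD)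
  qed (use inW in auto)
  finally show ?thesis .
qed

section \<open>Plane area under linear maps\<close>

definition vec_pair :: "real ^ 2 \<Rightarrow> real \<times> real"
  where "vec_pair v = (v $ 1, v $ 2)"

definition lin_map :: "real \<Rightarrow> real \<Rightarrow> real \<Rightarrow> real \<Rightarrow> real \<times> real \<Rightarrow> real \<times> real"
  where "lin_map a b c d p = (a * fst p + b * snd p, c * fst p + d * snd p)"

lemma lin_map_linear: "linear (lin_map a b c d)"
  by (rule linearI) (auto simp: lin_map_def algebra_simps)

text \<open>The change of variables theorem for determinants lives on coordinate vectors; this identification transports
  it to pairs.\<close>

lemma lborel_pair: "(lborel :: (real \<times> real) measure) = distr lborel borel vec_pair"
proof (rule lborel_eqI)
  have cont: "continuous_on UNIV vec_pair" unfolding vec_pair_def by (intro continuous_intros)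
  have meas: "vec_pair \<in> borel_measurable lborel"
    using borel_measurable_continuous_onI[OF cont] by simp
  fix l u :: "real \<times> real" assume le: "\<And>b. b \<in> Basis \<Longrightarrow> l \<bullet> b \<le> u \<bullet> b"
  define l' u' :: "real ^ 2" where "l' = (\<chi> i. if i = 1 then fst l else snd l)"
    and "u' = (\<chi> i. if i = 1 then fst u else snd u)"
  have le': "fst l \<le> fst u" "snd l \<le> snd u"
    using le[of "(1, 0)"] le[of "(0, 1)"] by (auto simp: Basis_prod_def inner_prod_def)
  have "vec_pair -` box l u = box l' u'"
    unfolding l'_def u'_def
    by (auto simp: vec_pair_def mem_box_cart forall_2 mem_box Basis_prod_def inner_prod_def)
  then have "emeasure (distr lborel borel vec_pair) (box l u) = emeasure lborel (box l' u')"
    using meas by (simp add: emeasure_distr)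
  also have "\<dots> = (\<Prod>b\<in>Basis. (u' - l') \<bullet> b)"
    by (rule emeasure_lborel_box)
       (use le' in \<open>auto simp: l'_def u'_def Basis_vec_def inner_axis\<close>)
  also have "(\<Prod>b\<in>Basis. (u' - l') \<bullet> b) = (fst u - fst l) * (snd u - snd l)"
    by (simp add: Basis_vec_def l'_def u'_def UNIV_2 inner_axis axis_eq_axis prod.insert image_insert)
  also have "\<dots> = (\<Prod>b\<in>Basis. (u - l) \<bullet> b)"
    by (simp add: Basis_prod_def inner_prod_def)
  finally show "emeasure (distr lborel borel vec_pair) (box l u) = ennreal (\<Prod>b\<in>Basis. (u - l) \<bullet> b)" .
qed simp

lemma measure_pair:
  assumes "compact S"
  shows "measure lebesgue S = measure lebesgue (vec_pair -` S)"
    and "compact (vec_pair -` S)"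
proof -
  have cont: "continuous_on UNIV vec_pair" unfolding vec_pair_def by (intro continuous_intros)
  have meas: "vec_pair \<in> borel_measurable lborel"
    using borel_measurable_continuous_onI[OF cont] by simp
  define pv :: "real \<times> real \<Rightarrow> real ^ 2" where "pv p = (\<chi> i. if i = 1 then fst p else snd p)" for p
  have "vec_pair -` S = pv ` S"
  proof
    show "pv ` S \<subseteq> vec_pair -` S" by (auto simp: pv_def vec_pair_def)
    show "vec_pair -` S \<subseteq> pv ` S"
    proof
      fix v assume "v \<in> vec_pair -` S"
      then have "vec_pair v \<in> S" "v = pv (vec_pair v)"
        by (auto simp: pv_def vec_pair_def vec_eq_iff forall_2)
      then show "v \<in> pv ` S" by blast
    qed
  qed
  moreover have "continuous_on S pv"
    unfolding pv_def
  proof (rule continuous_on_vec_lambda)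
    fix i :: 2
    show "continuous_on S (\<lambda>p. if i = 1 then fst p else snd p)"
      by (cases "i = 1") (auto intro!: continuous_intros)
  qed
  ultimately show c: "compact (vec_pair -` S)"
    using assms compact_continuous_image by metis
  have b: "S \<in> sets borel" "vec_pair -` S \<in> sets borel"
    using assms c by (auto intro: borel_compact)
  have "measure lebesgue S = measure lborel S" using b by (intro measure_completion) auto
  also have "\<dots> = measure lborel (vec_pair -` S)"
    by (subst lborel_pair, subst measure_distr[OF _ b(1)]) (use meas in auto)
  also have "\<dots> = measure lebesgue (vec_pair -` S)" using b by (intro measure_completion[symmetric]) auto
  finally show "measure lebesgue S = measure lebesgue (vec_pair -` S)" .
qed

lemma measure_lin_map:
  assumes "compact S" "a * d - b * c \<noteq> 0"
  shows "measure lebesgue (lin_map a b c d ` S) = \<bar>a * d - b * c\<bar> * measure lebesgue S"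
proof -
  define L :: "real ^ 2 \<Rightarrow> real ^ 2"
    where "L v = (\<chi> i. if i = 1 then a * v $ 1 + b * v $ 2 else c * v $ 1 + d * v $ 2)" for v
  have lin: "linear L"
    by (rule linearI) (auto simp: L_def vec_eq_iff algebra_simps)
  have "det (matrix L) = a * d - b * c"
    by (simp add: det_2 matrix_def L_def axis_def)
  moreover have "vec_pair -` (lin_map a b c d ` S) = L ` (vec_pair -` S)"
  proof
    show "L ` (vec_pair -` S) \<subseteq> vec_pair -` (lin_map a b c d ` S)"
    proof
      fix w assume "w \<in> L ` (vec_pair -` S)"
      then obtain v where v: "vec_pair v \<in> S" "w = L v" by (metis imageE vimageE)
      then have "vec_pair w = lin_map a b c d (vec_pair v)"
        by (simp add: L_def vec_pair_def lin_map_def)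
      then show "w \<in> vec_pair -` (lin_map a b c d ` S)" using v by auto
    qed
    show "vec_pair -` (lin_map a b c d ` S) \<subseteq> L ` (vec_pair -` S)"
    proof
      fix v assume "v \<in> vec_pair -` (lin_map a b c d ` S)"
      then obtain p where p: "p \<in> S" "vec_pair v = lin_map a b c d p" by auto
      define w :: "real ^ 2" where "w = (\<chi> i. if i = 1 then fst p else snd p)"
      have "vec_pair w = p" by (simp add: w_def vec_pair_def)
      moreover have "v = L w" using p(2) by (simp add: w_def vec_pair_def L_def lin_map_def vec_eq_iff forall_2)
      ultimately show "v \<in> L ` (vec_pair -` S)" using p(1) by auto
    qed
  qed
  moreover have "compact (lin_map a b c d ` S)"
    using assms(1) linear_continuous_on[OF lin_map_linear[unfolded linear_conv_bounded_linear]]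
    by (intro compact_continuous_image) auto
  ultimately show ?thesis
    using measure_pair[OF assms(1)] measure_pair(1)[of "lin_map a b c d ` S"]
      measure_linear_image[OF lin, of "vec_pair -` S"] by (simp add: lmeasurable_compact)
qed

section \<open>Mixed area\<close>

definition mixed_area :: "(real \<times> real) set \<Rightarrow> (real \<times> real) set \<Rightarrow> real"
  where "mixed_area P Q = area (P + Q) - area P - area Q"

lemma mixed_area_commute: "mixed_area P Q = mixed_area Q P"
  by (simp add: mixed_area_def add.commute)

lemma compact_lebesgue_sets: "compact (S :: 'a::euclidean_space set) \<Longrightarrow> S \<in> sets lebesgue"
  by (simp add: lmeasurable_compact fmeasurableD)

text \<open>Expand both sides of the shell inequality; the four areas that occur are those of the two mixed areas.\<close>

lemma mixed_area_mono:
  assumes P: "compact P" "convex P" "P \<noteq> {}" and P': "compact P'" "P \<subseteq> P'" and B: "finite B" "B \<noteq> {}"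
  shows "mixed_area P (convex hull B) \<le> mixed_area P' (convex hull B)"
proof -
  let ?H = "convex hull B"
  have H: "compact ?H" using B by (simp add: finite_imp_compact_convex_hull)
  have sub: "P + ?H \<subseteq> P' + ?H" using P'(2) by (intro set_plus_mono2) auto
  have "measure lebesgue (P' - P) = measure lebesgue P' - measure lebesgue P"
    using P P' by (intro measurable_measure_Diff) (auto intro: lmeasurable_compact compact_lebesgue_sets)
  moreover have "measure lebesgue ((P' + ?H) - (P + ?H)) = measure lebesgue (P' + ?H) - measure lebesgue (P + ?H)"
    using P P' H sub
    by (intro measurable_measure_Diff) (auto intro: lmeasurable_compact compact_lebesgue_sets compact_set_plus)
  ultimately show ?thesis
    using measure_shell_le_sum_shell[OF P P'(1) B] by (simp add: mixed_area_def area_def)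
qed

text \<open>The reverse of the shell embedding: a set whose points all come from \<open>E\<close> by translating along a
  strictly extreme vertex is no larger than \<open>E\<close>, because strictness makes the pieces of
  \<open>E\<close> disjoint.\<close>

lemma measure_le_translated_pieces:
  fixes P E Z B :: "'a::euclidean_space set"
  assumes P: "convex P" "closed P" "P \<noteq> {}" and B: "finite B"
    and E: "E \<in> lmeasurable" and Z: "Z \<in> sets lebesgue"
    and cover: "\<And>z. z \<in> Z \<Longrightarrow> \<exists>b\<in>B. z - b \<in> E \<and>
      (\<forall>b'\<in>B - {b}. outward P (z - b) \<bullet> b' < outward P (z - b) \<bullet> b)"
  shows "measure lebesgue Z \<le> measure lebesgue E"
proof -
  define G where "G b = E \<inter> {x. \<forall>b'\<in>B - {b}. outward P x \<bullet> b' < outward P x \<bullet> b}" for b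
  have meas: "G b \<in> lmeasurable" for b
  proof -
    have "{x. \<forall>b'\<in>B - {b}. outward P x \<bullet> b' < outward P x \<bullet> b} =
        - (\<Union>b'\<in>B - {b}. {x. outward P x \<bullet> b \<le> outward P x \<bullet> b'})"
      by (force simp: not_le[symmetric])
    moreover have "closed {x. outward P x \<bullet> b \<le> outward P x \<bullet> b'}" for b'
      by (intro closed_Collect_le continuous_intros continuous_outward P)
    then have "closed (\<Union>b'\<in>B - {b}. {x. outward P x \<bullet> b \<le> outward P x \<bullet> b'})"
      using B by (intro closed_UN) auto
    ultimately have "open {x. \<forall>b'\<in>B - {b}. outward P x \<bullet> b' < outward P x \<bullet> b}" by (simp add: open_closed)
    then have "{x. \<forall>b'\<in>B - {b}. outward P x \<bullet> b' < outward P x \<bullet> b} \<in> sets lebesgue"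
      by (intro sets_completionI_sets) simp
    then show ?thesis unfolding G_def using E by (rule fmeasurable_Int_fmeasurable[rotated])
  qed
  have disj: "disjoint_family_on G B"
    unfolding disjoint_family_on_def
  proof (intro ballI impI, rule ccontr)
    fix b b' assume bb: "b \<in> B" "b' \<in> B" "b \<noteq> b'" and "G b \<inter> G b' \<noteq> {}"
    then obtain x where "x \<in> G b" "x \<in> G b'" by blast
    then have "outward P x \<bullet> b' < outward P x \<bullet> b" "outward P x \<bullet> b < outward P x \<bullet> b'"
      using bb by (auto simp: G_def)
    then show False by simp
  qed
  have meas2: "(+) b ` G b \<in> lmeasurable" for b using meas by (rule measurable_translation)
  have U: "(\<Union>b\<in>B. (+) b ` G b) \<in> lmeasurable" using B meas2 by (intro fmeasurable.finite_UN) auto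
  have "Z \<subseteq> (\<Union>b\<in>B. (+) b ` G b)"
  proof
    fix z assume "z \<in> Z"
    then obtain b where "b \<in> B" "z - b \<in> G b" using cover unfolding G_def by blast
    then show "z \<in> (\<Union>b\<in>B. (+) b ` G b)" by (intro UN_I image_eqI[of _ _ "z - b"]) auto
  qed
  then have "measure lebesgue Z \<le> measure lebesgue (\<Union>b\<in>B. (+) b ` G b)"
    using U Z by (intro measure_mono_fmeasurable)
  also have "\<dots> \<le> (\<Sum>b\<in>B. measure lebesgue ((+) b ` G b))"
    using B meas2 by (intro measure_UNION_le) (auto dest: fmeasurableD)
  also have "\<dots> = measure lebesgue (\<Union>b\<in>B. G b)"
    using measure_disjoint_translates[OF B meas disj, of "\<lambda>b. b"] by simp
  also have "\<dots> \<le> measure lebesgue E"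
    using B meas E by (intro measure_mono_fmeasurable sets.finite_UN) (auto simp: G_def dest: fmeasurableD)
  finally show ?thesis .
qed

text \<open>The right triangle with legs \<open>c\<close>; the unit triangle is its value at \<open>1\<close>.\<close>

definition corner :: "real \<Rightarrow> (real \<times> real) set"
  where "corner c = {p. 0 \<le> fst p \<and> 0 \<le> snd p \<and> fst p + snd p \<le> c}"

definition unit_corners :: "(real \<times> real) set"
  where "unit_corners = {(0, 0), (1, 0), (0, 1)}"

lemma corner_hull:
  assumes "c \<ge> 0" shows "corner c = convex hull {(0, 0), (c, 0), (0, c)}"
proof
  show "corner c \<subseteq> convex hull {(0, 0), (c, 0), (0, c)}"
  proof
    fix p assume p: "p \<in> corner c"
    show "p \<in> convex hull {(0, 0), (c, 0), (0, c)}"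
    proof (cases "c = 0")
      case True
      then have "p = (0, 0)" using p by (cases p) (auto simp: corner_def)
      then show ?thesis by (simp add: hull_inc)
    next
      case False
      then have "c > 0" using assms by simp
      then have "p = (1 - fst p / c - snd p / c) *\<^sub>R (0, 0) + (fst p / c) *\<^sub>R (c, 0) + (snd p / c) *\<^sub>R (0, c)"
        using False by (cases p) simp
      moreover have "0 \<le> 1 - fst p / c - snd p / c" "0 \<le> fst p / c" "0 \<le> snd p / c"
        using p \<open>c > 0\<close> by (auto simp: corner_def add_divide_distrib[symmetric] diff_diff_eq)
      ultimately show ?thesis
        unfolding convex_hull_3
        by (intro CollectI exI[of _ "1 - fst p / c - snd p / c"] exI[of _ "fst p / c"] exI[of _ "snd p / c"]) simp
    qed
  qed
  have "corner c = {p. (1, 0) \<bullet> p \<ge> 0} \<inter> {p. (0, 1) \<bullet> p \<ge> 0} \<inter> {p. (1, 1) \<bullet> p \<le> c}"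
    by (auto simp: corner_def inner_prod_def)
  then have "convex (corner c)" by (simp add: convex_Int convex_halfspace_le convex_halfspace_ge)
  then show "convex hull {(0, 0), (c, 0), (0, c)} \<subseteq> corner c"
    by (intro hull_minimal) (use assms in \<open>auto simp: corner_def\<close>)
qed

text \<open>The unit triangle is the standard simplex, and area scales quadratically.\<close>

lemma area_corner:
  assumes "c \<ge> 0" shows "area (corner c) = c\<^sup>2 / 2"
proof -
  have std: "insert 0 Basis = ({(0, 0), (1, 0), (0, 1)} :: (real \<times> real) set)"
    by (auto simp: Basis_prod_def zero_prod_def)
  have hb: "compact (convex hull {(0, 0), (1, 0), (0, 1)} :: (real \<times> real) set)"
    by (intro finite_imp_compact_convex_hull) auto
  have one: "measure lebesgue (convex hull {(0, 0), (1, 0), (0, 1)} :: (real \<times> real) set) = 1 / 2"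
    using content_std_simplex[where 'a = "real \<times> real"] hb unfolding std
    by (simp add: measure_completion borel_compact fact_numeral)
  have "corner c = (\<lambda>x. c *\<^sub>R x + 0) ` (convex hull {(0, 0), (1, 0), (0, 1)})"
    using convex_hull_scaling[of c "{(0, 0), (1, 0), (0, 1)} :: (real \<times> real) set"] assms
    by (simp add: corner_hull)
  then show ?thesis
    using measure_lebesgue_affine[of c 0 "convex hull {(0, 0), (1, 0), (0, 1)} :: (real \<times> real) set"] one
    by (simp add: area_def power2_eq_square)
qed

section \<open>Mixed area with the unit triangle\<close>

lemma hull_unit_corners: "convex hull unit_corners = corner 1"
  unfolding unit_corners_def by (rule corner_hull[symmetric]) simp

text \<open>Here \<open>(n1, n2)\<close> is the outward normal at a point \<open>z\<close> of the triangle of size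
  \<open>c + 1\<close> off the Minkowski sum. The three points \<open>(0, y1)\<close>, \<open>(x2, 0)\<close>,
  \<open>(x3, c - x3)\<close> of the polygon rule out the outward normals of the three edges of the unit
  triangle. So one vertex of it is strictly extreme, and \<open>z\<close> minus that vertex stays in the
  triangle of size \<open>c\<close>.\<close>

lemma leading_corner_unique:
  fixes n1 n2 z1 z2 c x2 x3 y1 :: real
  assumes z: "0 \<le> z1" "0 \<le> z2" "z1 + z2 \<le> c + 1"
    and q: "0 \<le> y1" "y1 \<le> c" "0 \<le> x2" "x2 \<le> c" "0 \<le> x3" "x3 \<le> c"
    and s1: "n2 * y1 + max 0 (max n1 n2) < n1 * z1 + n2 * z2"
    and s2: "n1 * x2 + max 0 (max n1 n2) < n1 * z1 + n2 * z2"
    and s3: "n1 * x3 + n2 * (c - x3) + max 0 (max n1 n2) < n1 * z1 + n2 * z2"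
  shows "(n1 < 0 \<and> n2 < 0 \<and> z1 + z2 \<le> c) \<or> (n1 > 0 \<and> n1 > n2 \<and> z1 \<ge> 1) \<or> (n2 > 0 \<and> n2 > n1 \<and> z2 \<ge> 1)"
proof -
  have n1: False if "n1 = 0" "n2 \<le> 0"
    using s2 that z mult_nonpos_nonneg[of n2 z2] by simp
  have n2: False if "n2 = 0" "n1 \<le> 0"
    using s1 that z mult_nonpos_nonneg[of n1 z1] by simp
  have n12: False if "n1 = n2" "n1 \<ge> 0"
  proof -
    have "n1 * (z1 + z2) \<le> n1 * (c + 1)" using z that by (intro mult_left_mono) auto
    then show False using s3 that by (simp add: algebra_simps)
  qed
  have "\<not> (n1 = 0 \<and> n2 \<le> 0)" "\<not> (n2 = 0 \<and> n1 \<le> 0)" "\<not> (n1 = n2 \<and> n1 \<ge> 0)"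
    using n1 n2 n12 by blast+
  then have "(n1 < 0 \<and> n2 < 0) \<or> (n1 > 0 \<and> n1 > n2) \<or> (n2 > 0 \<and> n2 > n1)" by linarith
  then consider "n1 < 0 \<and> n2 < 0" | "n1 > 0 \<and> n1 > n2" | "n2 > 0 \<and> n2 > n1" by blast
  then show ?thesis
  proof cases
    case 1
    have "z1 + z2 \<le> c"
    proof (cases "n1 \<le> n2")
      case True
      have "(- n2) * (z1 + z2) \<le> (- n1) * z1 + (- n2) * z2"
        using True z mult_right_mono[of "- n2" "- n1" z1] by (simp add: algebra_simps)
      also have "\<dots> < (- n2) * y1" using s1 1 by simp
      also have "\<dots> \<le> (- n2) * c" using 1 q by (intro mult_left_mono) auto
      finally show ?thesis using 1 by simp
    next
      case False
      have "(- n1) * (z1 + z2) \<le> (- n1) * z1 + (- n2) * z2"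
        using False z mult_right_mono[of "- n1" "- n2" z2] by (simp add: algebra_simps)
      also have "\<dots> < (- n1) * x2" using s2 1 by simp
      also have "\<dots> \<le> (- n1) * c" using 1 q by (intro mult_left_mono) auto
      finally show ?thesis using 1 by simp
    qed
    then show ?thesis using 1 by simp
  next
    case 2
    have "z1 \<ge> 1"
    proof (rule ccontr)
      assume "\<not> z1 \<ge> 1"
      show False
      proof (cases "n2 \<le> 0")
        case True
        have "n1 * z1 \<le> n1 * 1" using \<open>\<not> z1 \<ge> 1\<close> 2 by (intro mult_left_mono) auto
        then have "n1 * z1 + n2 * z2 \<le> n1" using True z mult_nonpos_nonneg[of n2 z2] by simp
        moreover have "0 \<le> n1 * x2" using 2 q by simp
        ultimately show False using s2 2 by simp
      next
        case False
        have "n1 * z1 + n2 * z2 \<le> n1 * z1 + n2 * (c + 1 - z1)"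
          using z False by (intro add_left_mono mult_left_mono) auto
        moreover have "(n1 - n2) * z1 \<le> (n1 - n2) * 1" using 2 \<open>\<not> z1 \<ge> 1\<close> by (intro mult_left_mono) auto
        moreover have "n2 * x3 \<le> n1 * x3" using 2 q by (intro mult_right_mono) auto
        ultimately show False using s3 2 by (simp add: algebra_simps)
      qed
    qed
    then show ?thesis using 2 by simp
  next
    case 3
    have "z2 \<ge> 1"
    proof (rule ccontr)
      assume "\<not> z2 \<ge> 1"
      show False
      proof (cases "n1 \<le> 0")
        case True
        have "n2 * z2 \<le> n2 * 1" using \<open>\<not> z2 \<ge> 1\<close> 3 by (intro mult_left_mono) auto
        then have "n1 * z1 + n2 * z2 \<le> n2" using True z mult_nonpos_nonneg[of n1 z1] by simp
        moreover have "0 \<le> n2 * y1" using 3 q by simp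
        ultimately show False using s1 3 by simp
      next
        case False
        have "n1 * z1 + n2 * z2 \<le> n1 * (c + 1 - z2) + n2 * z2"
          using z False by (intro add_right_mono mult_left_mono) auto
        moreover have "(n2 - n1) * z2 \<le> (n2 - n1) * 1" using 3 \<open>\<not> z2 \<ge> 1\<close> by (intro mult_left_mono) auto
        moreover have "n1 * (c - x3) \<le> n2 * (c - x3)" using 3 q by (intro mult_right_mono) auto
        ultimately show False using s3 3 by (simp add: algebra_simps)
      qed
    qed
    then show ?thesis using 3 by simp
  qed
qed

text \<open>A convex set inscribed in the triangle of size \<open>c\<close> and touching its three sides already has the
  mixed area of the whole triangle as a lower bound. The gap between the triangle of size \<open>c + 1\<close>
  and \<open>Q\<close> plus the unit triangle is covered by translated pieces of the gap between the triangle
  of size \<open>c\<close> and \<open>Q\<close>, hence is no larger; writing out the areas gives the bound.\<close>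

proposition mixed_area_corner_ge:
  assumes Q: "compact Q" "convex Q" "Q \<subseteq> corner c"
    and q: "(0, y1) \<in> Q" "(x2, 0) \<in> Q" "(x3, c - x3) \<in> Q"
  shows "c \<le> mixed_area (corner 1) Q"
proof -
  let ?K = "Q + convex hull unit_corners"
  have ne: "Q \<noteq> {}" and cl: "closed Q" using q Q by (auto intro: compact_imp_closed)
  have fin: "finite unit_corners" by (simp add: unit_corners_def)
  have qb: "0 \<le> y1" "y1 \<le> c" "0 \<le> x2" "x2 \<le> c" "0 \<le> x3" "x3 \<le> c"
    using q Q(3) by (auto simp: corner_def)
  then have c0: "c \<ge> 0" by simp
  have compC: "compact (corner k)" if "k \<ge> 0" for k
    unfolding corner_hull[OF that] by (intro finite_imp_compact_convex_hull) simp
  have compK: "compact ?K"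
    by (intro compact_set_plus Q(1) finite_imp_compact_convex_hull fin)
  have "(0, 0) \<in> convex hull unit_corners" by (simp add: unit_corners_def hull_inc)
  from set_plus_intro[OF q(1) this] have "?K \<noteq> {}" by blast
  then have K: "compact ?K" "convex ?K" "closed ?K" "?K \<noteq> {}"
    using compK Q(2) by (auto intro: convex_set_plus compact_imp_closed)
  have sub: "?K \<subseteq> corner (c + 1)"
    unfolding hull_unit_corners using Q(3) by (fastforce simp: set_plus_def corner_def)
  have main: "measure lebesgue (corner (c + 1) - ?K) \<le> measure lebesgue (corner c - Q)"
  proof (rule measure_le_translated_pieces[OF Q(2) cl ne fin])
    show "corner c - Q \<in> lmeasurable"
      by (rule fmeasurable.Diff; rule lmeasurable_compact) (use compC[of c] c0 Q(1) in auto)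
    show "corner (c + 1) - ?K \<in> sets lebesgue"
      by (rule sets.Diff; rule compact_lebesgue_sets) (use compC[of "c + 1"] c0 K(1) in auto)
  next
    fix z assume z: "z \<in> corner (c + 1) - ?K"
    define r where "r = closest_point ?K z"
    have "r \<in> ?K" unfolding r_def using closest_point_in_set[OF K(3,4)] .
    then obtain p t where pt: "p \<in> Q" "t \<in> convex hull unit_corners" "r = p + t" by (auto simp: set_plus_def)
    define n where "n = z - r"
    have "n \<noteq> 0" using z \<open>r \<in> ?K\<close> by (auto simp: n_def)
    then have npos: "n \<bullet> n > 0" by simp
    have le: "n \<bullet> y \<le> n \<bullet> r" if "y \<in> ?K" for y
      using closest_point_dot[OF K(2,3) that, of z] by (simp add: n_def r_def inner_diff_right)
    have less: "n \<bullet> p' + n \<bullet> s < n \<bullet> z" if "p' \<in> Q" "s \<in> convex hull unit_corners" for p' s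
    proof -
      have "n \<bullet> (p' + s) \<le> n \<bullet> r" using that by (intro le set_plus_intro)
      moreover have "n \<bullet> r < n \<bullet> z" using npos by (simp add: n_def inner_diff_right inner_diff_left)
      ultimately show ?thesis by (simp add: inner_add_right)
    qed
    have lep: "n \<bullet> p' \<le> n \<bullet> p" if "p' \<in> Q" for p'
      using le[of "p' + t"] that pt by (auto simp: inner_add_right)
    have let_t: "n \<bullet> s \<le> n \<bullet> t" if "s \<in> convex hull unit_corners" for s
      using le[of "p + s"] that pt by (auto simp: inner_add_right)
    obtain n1 n2 z1 z2 t1 t2 where co: "n = (n1, n2)" "z = (z1, z2)" "t = (t1, t2)" by (metis surj_pair)
    have V: "(0, 0) \<in> convex hull unit_corners" "(1, 0) \<in> convex hull unit_corners" "(0, 1) \<in> convex hull unit_corners"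
      by (auto simp: unit_corners_def hull_inc)
    have t: "0 \<le> t1" "0 \<le> t2" "t1 + t2 \<le> 1" using pt(2) by (auto simp: hull_unit_corners corner_def co)
    have nt: "0 \<le> n1 * t1 + n2 * t2" "n1 \<le> n1 * t1 + n2 * t2" "n2 \<le> n1 * t1 + n2 * t2"
      using let_t[OF V(1)] let_t[OF V(2)] let_t[OF V(3)] by (auto simp: co inner_prod_def)
    have cases: "(n1 < 0 \<and> n2 < 0 \<and> z1 + z2 \<le> c) \<or> (n1 > 0 \<and> n1 > n2 \<and> z1 \<ge> 1) \<or> (n2 > 0 \<and> n2 > n1 \<and> z2 \<ge> 1)"
    proof (rule leading_corner_unique[where c = c, OF _ _ _ qb])
      show "0 \<le> z1" "0 \<le> z2" "z1 + z2 \<le> c + 1" using z by (auto simp: corner_def co)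
    qed (use less[OF q(1) V(1)] less[OF q(1) V(2)] less[OF q(1) V(3)]
          less[OF q(2) V(1)] less[OF q(2) V(2)] less[OF q(2) V(3)]
          less[OF q(3) V(1)] less[OF q(3) V(2)] less[OF q(3) V(3)] in \<open>auto simp: co inner_prod_def\<close>)
    have key: "\<exists>b\<in>unit_corners. t = b \<and> z - b \<in> corner c \<and> (\<forall>b'\<in>unit_corners - {b}. n \<bullet> b' < n \<bullet> b)"
      using cases
    proof (elim disjE)
      assume h: "n1 < 0 \<and> n2 < 0 \<and> z1 + z2 \<le> c"
      have "n1 * t1 \<le> 0" "n2 * t2 \<le> 0" using h t by (auto simp: mult_nonpos_nonneg)
      then have "n1 * t1 = 0" "n2 * t2 = 0" using nt by linarith+
      then have "t = (0, 0)" using h co by auto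
      then show ?thesis using h z
        by (intro bexI[of _ "(0, 0)"]) (auto simp: unit_corners_def co inner_prod_def corner_def)
    next
      assume h: "n1 > 0 \<and> n1 > n2 \<and> z1 \<ge> 1"
      have "n1 * (t1 + t2) \<le> n1 * 1" using h t by (intro mult_left_mono) auto
      then have "(n1 - n2) * t2 \<le> 0" using nt by (simp add: algebra_simps)
      then have "t2 = 0" using h t by (simp add: mult_le_0_iff)
      moreover from this have "t1 = 1" using nt h t by simp
      ultimately show ?thesis using h z
        by (intro bexI[of _ "(1, 0)"]) (auto simp: unit_corners_def co inner_prod_def corner_def)
    next
      assume h: "n2 > 0 \<and> n2 > n1 \<and> z2 \<ge> 1"
      have "n2 * (t1 + t2) \<le> n2 * 1" using h t by (intro mult_left_mono) auto
      then have "(n2 - n1) * t1 \<le> 0" using nt by (simp add: algebra_simps)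
      then have "t1 = 0" using h t by (simp add: mult_le_0_iff)
      moreover from this have "t2 = 1" using nt h t by simp
      ultimately show ?thesis using h z
        by (intro bexI[of _ "(0, 1)"]) (auto simp: unit_corners_def co inner_prod_def corner_def)
    qed
    then obtain b where b: "b \<in> unit_corners" "t = b" "z - b \<in> corner c"
      "\<forall>b'\<in>unit_corners - {b}. n \<bullet> b' < n \<bullet> b" by blast
    have "outward Q (z - b) = z - b - p"
    proof (rule outward_eqI[OF Q(2) cl pt(1)])
      fix p' assume "p' \<in> Q"
      then show "(z - b - p) \<bullet> (p' - p) \<le> 0"
        using lep[of p'] pt(3) b(2) by (simp add: n_def inner_diff_right algebra_simps)
    qed
    then have out: "outward Q (z - b) = n" using pt(3) b(2) by (simp add: n_def algebra_simps)
    have "z - b \<notin> Q"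
    proof
      assume "z - b \<in> Q"
      then have "z \<in> ?K" using b(1) hull_inc[of b unit_corners] set_plus_intro[of "z - b" Q b "convex hull unit_corners"] by simp
      then show False using z by simp
    qed
    then show "\<exists>b\<in>unit_corners. z - b \<in> corner c - Q \<and>
        (\<forall>b'\<in>unit_corners - {b}. outward Q (z - b) \<bullet> b' < outward Q (z - b) \<bullet> b)"
      using b(3,4) by (intro bexI[OF _ b(1)] conjI DiffI) (simp_all only: out not_False_eq_True)
  qed
  have "measure lebesgue (corner (c + 1) - ?K) = area (corner (c + 1)) - area ?K"
    unfolding area_def using sub compC[of "c + 1"] c0 K(1)
    by (intro measurable_measure_Diff) (auto intro: lmeasurable_compact compact_lebesgue_sets)
  moreover have "measure lebesgue (corner c - Q) = area (corner c) - area Q"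
    unfolding area_def using Q compC[of c] c0
    by (intro measurable_measure_Diff) (auto intro: lmeasurable_compact compact_lebesgue_sets)
  ultimately have "(c + 1)\<^sup>2 / 2 - area ?K \<le> c\<^sup>2 / 2 - area Q"
    using main c0 by (simp add: area_corner)
  then have "c \<le> area ?K - area Q - area (corner 1)"
    by (simp add: area_corner power2_eq_square field_simps)
  then show ?thesis by (simp add: mixed_area_def hull_unit_corners add.commute)
qed

section \<open>Mixed volume of lattice polygons\<close>

lemma MV_mixed_area: "MV A B = mixed_area (conv A) (conv B)"
  by (simp add: MV_def mixed_area_def)

lemma compact_conv: "finite A \<Longrightarrow> compact (conv A)"
  by (simp add: conv_def finite_imp_compact_convex_hull)

lemma conv_mono: "A \<subseteq> B \<Longrightarrow> conv A \<subseteq> conv B"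
  unfolding conv_def by (intro hull_mono image_mono)

lemma MV_commute: "MV A B = MV B A"
  by (simp add: MV_mixed_area mixed_area_commute)

lemma MV_mono_left:
  assumes "A \<subseteq> A'" "finite A'" "A \<noteq> {}" "finite B" "B \<noteq> {}"
  shows "MV A B \<le> MV A' B"
proof -
  have "finite A" using assms finite_subset by blast
  then show ?thesis
    unfolding MV_mixed_area conv_def[of B] using assms
    by (intro mixed_area_mono compact_conv conv_mono) (auto simp: conv_def)
qed

lemma MV_mono:
  assumes "A \<subseteq> A'" "finite A'" "A \<noteq> {}" "B \<subseteq> B'" "finite B'" "B \<noteq> {}"
  shows "MV A B \<le> MV A' B'"
proof -
  have "finite B" using assms finite_subset by blast
  have "MV A B \<le> MV A' B" using assms \<open>finite B\<close> by (intro MV_mono_left)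
  also have "\<dots> = MV B A'" by (rule MV_commute)
  also have "\<dots> \<le> MV B' A'" using assms by (intro MV_mono_left) auto
  also have "\<dots> = MV A' B'" by (rule MV_commute)
  finally show ?thesis .
qed

lemma area_translation: "area ((+) t ` P) = area P"
  by (simp add: area_def measure_translation)

text \<open>A linear map of determinant a sign preserves area and commutes with Minkowski sums, and translations only
  translate the sum.\<close>

lemma mixed_area_affine:
  assumes "compact P" "compact Q" "\<bar>a * d - b * c\<bar> = 1"
  shows "mixed_area ((+) s ` lin_map a b c d ` P) ((+) t ` lin_map a b c d ` Q) = mixed_area P Q"
proof -
  have "(+) s ` lin_map a b c d ` P + (+) t ` lin_map a b c d ` Q = (+) (s + t) ` lin_map a b c d ` (P + Q)"
  proof (rule Set.set_eqI)
    fix x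
    have "x \<in> (+) s ` lin_map a b c d ` P + (+) t ` lin_map a b c d ` Q \<longleftrightarrow>
        (\<exists>p\<in>P. \<exists>q\<in>Q. x = (s + lin_map a b c d p) + (t + lin_map a b c d q))"
      by (auto simp: set_plus_def)
    also have "\<dots> \<longleftrightarrow> (\<exists>p\<in>P. \<exists>q\<in>Q. x = (s + t) + lin_map a b c d (p + q))"
      using linear_add[OF lin_map_linear[of a b c d]] by (simp add: add_ac)
    also have "\<dots> \<longleftrightarrow> (\<exists>y\<in>P + Q. x = (s + t) + lin_map a b c d y)"
      unfolding set_plus_def by blast
    also have "\<dots> \<longleftrightarrow> x \<in> (+) (s + t) ` lin_map a b c d ` (P + Q)"
      by blast
    finally show "x \<in> (+) s ` lin_map a b c d ` P + (+) t ` lin_map a b c d ` Q \<longleftrightarrow>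
      x \<in> (+) (s + t) ` lin_map a b c d ` (P + Q)" .
  qed
  moreover have "area (lin_map a b c d ` X) = area X" if "compact X" for X
    unfolding area_def using measure_lin_map[OF that, of a d b c] assms(3) by auto
  ultimately show ?thesis
    using assms by (simp add: mixed_area_def area_translation compact_set_plus)
qed

lemma conv_lattice_map:
  "conv (lattice_map a u v ` A) = (+) (real_point a) `
    lin_map (real_of_int (fst u)) (real_of_int (fst v)) (real_of_int (snd u)) (real_of_int (snd v)) ` conv A"
  (is "_ = _ ` ?L ` _")
proof -
  have "real_point ` lattice_map a u v ` A = (+) (real_point a) ` ?L ` real_point ` A"
    by (auto simp: image_image lattice_map_def real_point_def lin_map_def algebra_simps intro!: image_cong)
  then show ?thesis
    by (simp add: conv_def convex_hull_translation convex_hull_linear_image[OF lin_map_linear])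
qed

lemma MV_lattice_map:
  assumes "finite A" "finite B" "\<bar>det2 u v\<bar> = 1"
  shows "MV (lattice_map a u v ` A) (lattice_map b u v ` B) = MV A B"
proof -
  have "\<bar>real_of_int (fst u) * real_of_int (snd v) - real_of_int (fst v) * real_of_int (snd u)\<bar>
      = real_of_int \<bar>det2 u v\<bar>" by (simp add: det2_def mult.commute)
  then show ?thesis
    unfolding MV_mixed_area conv_lattice_map using assms by (intro mixed_area_affine compact_conv) auto
qed

lemma conv_unit_triangle: "conv {(0, 0), (1, 0), (0, 1)} = corner 1"
  unfolding hull_unit_corners[symmetric] by (simp add: conv_def real_point_def unit_corners_def)

text \<open>The spread is bounded by the size of the smallest right triangle around \<open>B\<close> with the shape of the
  unit triangle; the polygon touches its three sides, so the mixed area with the unit triangle is at least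
  that size.\<close>

proposition MV_ge_spread:
  assumes A: "finite A" "{(0, 0), (1, 0), (0, 1)} \<subseteq> A" and B: "finite B"
    and q: "q1 \<in> B" "q2 \<in> B" "q3 \<in> B"
  shows "real_of_int (fst q3 + snd q3 - fst q1 - snd q2) \<le> MV A B"
proof -
  (* The three sides of the smallest surrounding triangle. *)
  define mx where "mx = Min (fst ` B)"
  define my where "my = Min (snd ` B)"
  define ms where "ms = Max ((\<lambda>p. fst p + snd p) ` B)"
  have ne: "B \<noteq> {}" using q by auto
  have "mx \<in> fst ` B" "my \<in> snd ` B" and ms: "ms \<in> (\<lambda>p. fst p + snd p) ` B"
    unfolding mx_def my_def ms_def using B ne
    by (simp_all only: Min_in Max_in finite_imageI image_is_empty not_False_eq_True)
  then obtain p1 p2 where p12: "p1 \<in> B" "fst p1 = mx" "p2 \<in> B" "snd p2 = my" by blast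
  obtain p3 where "p3 \<in> B" "fst p3 + snd p3 = ms" using ms by blast
  note p = p12 this
  have le: "mx \<le> fst b" "my \<le> snd b" "fst b + snd b \<le> ms" if "b \<in> B" for b
  proof -
    have "fst b \<in> fst ` B" "snd b \<in> snd ` B" "fst b + snd b \<in> (\<lambda>p. fst p + snd p) ` B"
      using that by blast+
    then show "mx \<le> fst b" "my \<le> snd b" "fst b + snd b \<le> ms"
      unfolding mx_def my_def ms_def using B by (simp_all only: Min_le Max_ge finite_imageI)
  qed
  define c where "c = real_of_int (ms - mx - my)"
  define t where "t = real_point (- mx, - my)"
  let ?Q = "(+) t ` conv B"
  have hull: "?Q = convex hull ((\<lambda>b. real_point (fst b - mx, snd b - my)) ` B)"
    unfolding conv_def convex_hull_translation[symmetric] image_image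
    by (simp add: t_def real_point_def algebra_simps)
  have mem: "real_point (fst b - mx, snd b - my) \<in> ?Q" if "b \<in> B" for b
    unfolding hull using that by (auto intro: hull_inc)
  have "c \<le> mixed_area (corner 1) ?Q"
  proof (rule mixed_area_corner_ge)
    show "compact ?Q" "convex ?Q"
      using compact_conv[OF B] by (auto simp: compact_translation convex_translation conv_def)
    have c0: "c \<ge> 0" using le[OF p(1)] le[OF p(3)] le[OF p(5)] p by (simp add: c_def)
    show "?Q \<subseteq> corner c"
      unfolding hull
    proof (rule hull_minimal)
      show "convex (corner c)" unfolding corner_hull[OF c0] by simp
      show "(\<lambda>b. real_point (fst b - mx, snd b - my)) ` B \<subseteq> corner c"
      proof
        fix x assume "x \<in> (\<lambda>b. real_point (fst b - mx, snd b - my)) ` B"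
        then obtain b where b: "b \<in> B" "x = real_point (fst b - mx, snd b - my)" by auto
        have "real_of_int (fst b) + real_of_int (snd b) \<le> real_of_int ms"
          using le(3)[OF b(1)] by linarith
        then show "x \<in> corner c" using le[OF b(1)] by (simp add: b(2) corner_def real_point_def c_def)
      qed
    qed
    show "(0, real_of_int (snd p1 - my)) \<in> ?Q" using mem[OF p(1)] p by (simp add: real_point_def)
    show "(real_of_int (fst p2 - mx), 0) \<in> ?Q" using mem[OF p(3)] p by (simp add: real_point_def)
    have "real_of_int (snd p3 - my) = c - real_of_int (fst p3 - mx)" using p(6)[symmetric] by (simp add: c_def)
    then show "(real_of_int (fst p3 - mx), c - real_of_int (fst p3 - mx)) \<in> ?Q"
      using mem[OF p(5)] by (simp add: real_point_def)
  qed
  also have "mixed_area (corner 1) ?Q = mixed_area (corner 1) (conv B)"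
    using mixed_area_affine[of "corner 1" "conv B" 1 1 0 0 0 t] compact_conv[OF B]
      compact_conv[of "{(0, 0), (1, 0), (0, 1)}"]
    by (simp add: conv_unit_triangle lin_map_def image_image)
  also have "\<dots> = MV {(0, 0), (1, 0), (0, 1)} B" by (simp add: MV_mixed_area conv_unit_triangle)
  also have "\<dots> \<le> MV A B" using A B ne by (intro MV_mono) auto
  finally have "c \<le> MV A B" .
  moreover have "fst q3 + snd q3 - fst q1 - snd q2 \<le> ms - mx - my"
    using le[OF q(1)] le[OF q(2)] le[OF q(3)] by simp
  ultimately show ?thesis unfolding c_def by linarith
qed

text \<open>By monotonicity the value is at most that of the unit triangle against its double, namely
  \<open>9/2 - 4/2 - 1/2\<close>.\<close>

lemma MV_triangle_double_triangle:
  assumes "B \<noteq> {}" "\<And>b. b \<in> B \<Longrightarrow> 0 \<le> fst b \<and> 0 \<le> snd b \<and> fst b + snd b \<le> 2"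
  shows "MV {(0, 0), (1, 0), (0, 1)} B \<le> 2"
proof -
  have fin: "B \<subseteq> {0..2} \<times> {0..2}" using assms(2) by fastforce
  then have "finite B" by (rule finite_subset) auto
  have sub: "conv B \<subseteq> corner 2"
    unfolding conv_def
  proof (rule hull_minimal)
    show "convex (corner 2)" by (simp add: corner_hull)
    show "real_point ` B \<subseteq> corner 2"
    proof
      fix x assume "x \<in> real_point ` B"
      then obtain b where b: "b \<in> B" "x = real_point b" by auto
      have "real_of_int (fst b) + real_of_int (snd b) \<le> 2" using assms(2)[OF b(1)] by linarith
      then show "x \<in> corner 2" using assms(2)[OF b(1)] by (simp add: b(2) corner_def real_point_def)
    qed
  qed
  have comp: "compact (corner k)" if "k \<ge> 0" for k
    unfolding corner_hull[OF that] by (intro finite_imp_compact_convex_hull) simp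
  have "MV {(0, 0), (1, 0), (0, 1)} B = mixed_area (conv B) (convex hull unit_corners)"
    unfolding MV_mixed_area conv_unit_triangle hull_unit_corners by (rule mixed_area_commute)
  also have "\<dots> \<le> mixed_area (corner 2) (convex hull unit_corners)"
    using \<open>finite B\<close> assms(1) comp sub
    by (intro mixed_area_mono) (auto simp: conv_def unit_corners_def intro: finite_imp_compact_convex_hull)
  also have "\<dots> = area (corner 2 + corner 1) - area (corner 2) - area (corner 1)"
    by (simp add: mixed_area_def hull_unit_corners)
  also have "area (corner 2 + corner 1) \<le> area (corner 3)"
    unfolding area_def
    by (intro measure_mono_fmeasurable compact_lebesgue_sets lmeasurable_compact compact_set_plus comp)
      (auto simp: set_plus_def corner_def)
  finally show ?thesis by (simp add: area_corner)
qed

text \<open>For a convex body \<open>P + P\<close> is the double of \<open>P\<close>, with four times its area.\<close>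

lemma mixed_area_self_le:
  assumes "compact P" "convex P"
  shows "mixed_area P P \<le> 2 * area P"
proof -
  have "P + P \<subseteq> (\<lambda>x. 2 *\<^sub>R x + 0) ` P"
  proof
    fix x assume "x \<in> P + P"
    then obtain p q where pq: "p \<in> P" "q \<in> P" "x = p + q" by (auto simp: set_plus_def)
    have "(1 / 2) *\<^sub>R p + (1 / 2) *\<^sub>R q \<in> P" using assms(2) pq by (intro convexD) auto
    moreover have "x = 2 *\<^sub>R ((1 / 2) *\<^sub>R p + (1 / 2) *\<^sub>R q) + 0" by (simp add: pq scaleR_add_right)
    ultimately show "x \<in> (\<lambda>x. 2 *\<^sub>R x + 0) ` P" by blast
  qed
  moreover have "compact ((\<lambda>x. 2 *\<^sub>R x + 0) ` P)" using assms(1) by (simp add: compact_scaling)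
  ultimately have "area (P + P) \<le> area ((\<lambda>x. 2 *\<^sub>R x + 0) ` P)"
    unfolding area_def using assms
    by (intro measure_mono_fmeasurable compact_lebesgue_sets lmeasurable_compact compact_set_plus)
  also have "\<dots> = 4 * area P"
    unfolding area_def using measure_lebesgue_affine[of 2 0 P] by simp
  finally show ?thesis by (simp add: mixed_area_def)
qed

lemma MV_square_square:
  "MV {(0, 0), (1, 0), (0, 1), (1, 1)} {(0, 0), (1, 0), (0, 1), (1, 1)} \<le> 2" (is "MV ?S ?S \<le> 2")
proof -
  have "conv ?S \<subseteq> cbox (0, 0) (1, 1)"
    unfolding conv_def by (rule hull_minimal) (auto simp: real_point_def)
  then have "area (conv ?S) \<le> area (cbox (0, 0) (1, 1))"
    unfolding area_def
    by (intro measure_mono_fmeasurable compact_lebesgue_sets compact_conv lmeasurable_compact) auto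
  also have "\<dots> = 1" by (simp add: area_def content_Pair)
  finally show ?thesis
    using mixed_area_self_le[of "conv ?S"] compact_conv[of ?S] by (simp add: MV_mixed_area conv_def)
qed

lemma MV_long_triangle_self:
  "MV {(0, 0), (1, 0), (2, 0), (0, 1)} {(0, 0), (1, 0), (2, 0), (0, 1)} \<le> 2" (is "MV ?S ?S \<le> 2")
proof -
  have comp: "compact (corner 1)" using compact_conv[of "{(0, 0), (1, 0), (0, 1)}"] by (simp add: conv_unit_triangle)
  have c2: "compact (lin_map 2 0 0 1 ` corner 1)"
    using comp linear_continuous_on[OF lin_map_linear[unfolded linear_conv_bounded_linear]]
    by (intro compact_continuous_image) auto
  (* The long triangle is the unit triangle stretched by two, with area one. *)
  have "conv ?S \<subseteq> lin_map 2 0 0 1 ` corner 1"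
    unfolding conv_def
  proof (rule hull_minimal)
    show "convex (lin_map 2 0 0 1 ` corner 1)"
      by (intro convex_linear_image lin_map_linear) (simp add: corner_hull)
    have "lin_map 2 0 0 1 (0, 0) = (0, 0)" "lin_map 2 0 0 1 (1 / 2, 0) = (1, 0)"
      "lin_map 2 0 0 1 (1, 0) = (2, 0)" "lin_map 2 0 0 1 (0, 1) = (0, 1)" by (auto simp: lin_map_def)
    moreover have "(0, 0) \<in> corner 1" "(1 / 2, 0) \<in> corner 1" "(1, 0) \<in> corner 1" "(0, 1) \<in> corner 1"
      by (auto simp: corner_def)
    ultimately have "(0, 0) \<in> lin_map 2 0 0 1 ` corner 1" "(1, 0) \<in> lin_map 2 0 0 1 ` corner 1"
      "(2, 0) \<in> lin_map 2 0 0 1 ` corner 1" "(0, 1) \<in> lin_map 2 0 0 1 ` corner 1" by (metis imageI)+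
    then show "real_point ` ?S \<subseteq> lin_map 2 0 0 1 ` corner 1" by (auto simp: real_point_def)
  qed
  then have "area (conv ?S) \<le> area (lin_map 2 0 0 1 ` corner 1)"
    unfolding area_def using c2
    by (intro measure_mono_fmeasurable compact_lebesgue_sets compact_conv lmeasurable_compact) auto
  also have "\<dots> = 1"
    unfolding area_def using measure_lin_map[OF comp, of 2 1 0 0] area_corner[of 1] by (simp add: area_def)
  finally show ?thesis
    using mixed_area_self_le[of "conv ?S"] compact_conv[of ?S] by (simp add: MV_mixed_area conv_def)
qed

section \<open>Characters of the Laurent ring and germs of rational functions\<close>

lemma laurent_as_sum: "f = (\<Sum>a\<in>Poly_Mapping.keys f. Poly_Mapping.single a (Poly_Mapping.lookup f a))"
  for f :: laurent
proof (rule poly_mapping_eqI)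
  fix k
  have "(\<Sum>a\<in>Poly_Mapping.keys f. Poly_Mapping.lookup (Poly_Mapping.single a (Poly_Mapping.lookup f a)) k)
      = (\<Sum>a\<in>Poly_Mapping.keys f. if a = k then Poly_Mapping.lookup f a else 0)"
    by (intro sum.cong) (auto simp: lookup_single when_def)
  also have "\<dots> = Poly_Mapping.lookup f k"
    by (simp add: sum.delta in_keys_iff)
  finally show "Poly_Mapping.lookup f k = Poly_Mapping.lookup
      (\<Sum>a\<in>Poly_Mapping.keys f. Poly_Mapping.single a (Poly_Mapping.lookup f a)) k"
    by (simp add: lookup_sum)
qed

text \<open>The data of a ring homomorphism from the Laurent polynomials: its values on constants and on monomials.
  Evaluation at a torus point and the passage to rational functions are both of this kind.\<close>

locale laurent_character =
  fixes coef :: "complex \<Rightarrow> 'r::comm_ring_1" and chr :: "int \<times> int \<Rightarrow> 'r"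
  assumes coef_0 [simp]: "coef 0 = 0" and coef_1 [simp]: "coef 1 = 1"
    and coef_add: "coef (c + d) = coef c + coef d" and coef_mult: "coef (c * d) = coef c * coef d"
    and chr_0 [simp]: "chr 0 = 1" and chr_add: "chr (a + b) = chr a * chr b"
begin

definition ev :: "laurent \<Rightarrow> 'r"
  where "ev f = (\<Sum>a\<in>Poly_Mapping.keys f. coef (Poly_Mapping.lookup f a) * chr a)"

lemma ev_superset:
  assumes "finite S" "Poly_Mapping.keys f \<subseteq> S"
  shows "ev f = (\<Sum>a\<in>S. coef (Poly_Mapping.lookup f a) * chr a)"
  unfolding ev_def using assms by (intro sum.mono_neutral_left) (auto simp: in_keys_iff)

lemma ev_0 [simp]: "ev 0 = 0" by (simp add: ev_def)

lemma ev_single [simp]: "ev (Poly_Mapping.single a c) = coef c * chr a"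
  by (subst ev_superset[of "{a}"]) auto

lemma ev_1 [simp]: "ev 1 = 1"
  using ev_single[of 0 1] by (simp del: ev_single add: single_one)

lemma ev_add: "ev (f + g) = ev f + ev g"
proof -
  let ?S = "Poly_Mapping.keys f \<union> Poly_Mapping.keys g"
  have "ev (f + g) = (\<Sum>a\<in>?S. coef (Poly_Mapping.lookup (f + g) a) * chr a)"
    using keys_add[of f g] by (intro ev_superset) auto
  also have "\<dots> = (\<Sum>a\<in>?S. coef (Poly_Mapping.lookup f a) * chr a) + (\<Sum>a\<in>?S. coef (Poly_Mapping.lookup g a) * chr a)"
    by (simp add: lookup_add coef_add distrib_right sum.distrib)
  also have "\<dots> = ev f + ev g" by (simp add: ev_superset[of ?S])
  finally show ?thesis .
qed

lemma ev_sum: "ev (\<Sum>i\<in>I. F i) = (\<Sum>i\<in>I. ev (F i))"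
  by (induction I rule: infinite_finite_induct) (auto simp: ev_add)

lemma ev_uminus: "ev (- f) = - ev f"
proof -
  have "ev f + ev (- f) = 0" using ev_add[of f "- f"] by simp
  then show ?thesis by (rule minus_unique[symmetric])
qed

lemma ev_diff: "ev (f - g) = ev f - ev g"
  using ev_add[of f "- g"] by (simp add: ev_uminus)

lemma ev_mult: "ev (f * g) = ev f * ev g"
proof -
  let ?s = "\<lambda>f a. Poly_Mapping.single a (Poly_Mapping.lookup f a)"
  have "f * g = (\<Sum>a\<in>Poly_Mapping.keys f. ?s f a) * (\<Sum>b\<in>Poly_Mapping.keys g. ?s g b)"
    using laurent_as_sum[of f] laurent_as_sum[of g] by simp
  also have "\<dots> = (\<Sum>a\<in>Poly_Mapping.keys f. \<Sum>b\<in>Poly_Mapping.keys g. ?s f a * ?s g b)"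
    by (simp add: sum_product)
  finally have "ev (f * g) = (\<Sum>a\<in>Poly_Mapping.keys f. \<Sum>b\<in>Poly_Mapping.keys g. ev (?s f a * ?s g b))"
    by (simp add: ev_sum)
  also have "\<dots> = (\<Sum>a\<in>Poly_Mapping.keys f. \<Sum>b\<in>Poly_Mapping.keys g.
      (coef (Poly_Mapping.lookup f a) * chr a) * (coef (Poly_Mapping.lookup g b) * chr b))"
    by (simp add: mult_single coef_mult chr_add mult_ac)
  also have "\<dots> = ev f * ev g" by (simp add: sum_product ev_def)
  finally show ?thesis .
qed

lemma ev_power: "ev (f ^ n) = ev f ^ n"
  by (induction n) (auto simp: ev_mult)

end

text \<open>Applying a ring homomorphism to coefficients and then evaluating respects sums and products; only the
  coefficient map varies between the uses below.\<close>

lemma poly_map_hom: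
  fixes h :: "'a::comm_ring_1 \<Rightarrow> 'b::comm_ring_1"
  assumes h: "h 0 = 0" "\<And>x y. h (x + y) = h x + h y" "\<And>x y. h (x * y) = h x * h y"
  shows "poly (map_poly h (p + q)) y = poly (map_poly h p) y + poly (map_poly h q) y"
    and "poly (map_poly h (p * q)) y = poly (map_poly h p) y * poly (map_poly h q) y"
proof -
  have c: "poly (map_poly h (pCons a p)) y = h a + y * poly (map_poly h p) y" for a p
    by (cases "p = 0 \<and> a = 0") (auto simp: map_poly_pCons h)
  have add: "poly (map_poly h (p + q)) y = poly (map_poly h p) y + poly (map_poly h q) y" for p q
    by (induction p q rule: poly_induct2) (auto simp: c h algebra_simps)
  have sm: "poly (map_poly h (Polynomial.smult a q)) y = h a * poly (map_poly h q) y" for a q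
    by (induction q) (auto simp: c h algebra_simps)
  show "poly (map_poly h (p + q)) y = poly (map_poly h p) y + poly (map_poly h q) y" by (rule add)
  show "poly (map_poly h (p * q)) y = poly (map_poly h p) y * poly (map_poly h q) y"
    by (induction p) (auto simp: c add sm h algebra_simps)
qed

text \<open>A homomorphism \<open>H\<close> from polynomials into a domain that does not kill denominators allowed at
  \<open>p\<close>, so that it extends to the local ring at \<open>p\<close>. Point values and Taylor
  expansions along a curve are the two instances.\<close>

locale point_evaluation =
  fixes p :: "complex \<times> complex" and H :: "complex poly poly \<Rightarrow> 'r::idom"
  assumes H_add: "H (a + b) = H a + H b" and H_mult: "H (a * b) = H a * H b"
    and H_1: "H 1 = 1"
    and H_nz: "poly2 b p \<noteq> 0 \<Longrightarrow> H b \<noteq> 0"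
begin

text \<open>The extension of \<open>H\<close> to rational functions regular at \<open>p\<close>, as a relation: this
  avoids choosing a representing fraction and dividing in the target.\<close>

definition germ :: "ratfun \<Rightarrow> 'r \<Rightarrow> bool"
  where "germ x v \<longleftrightarrow> (\<exists>a b. poly2 b p \<noteq> 0 \<and> x = to_fract a / to_fract b \<and> v * H b = H a)"

end

lemma poly2_add: "poly2 (a + b) p = poly2 a p + poly2 b p"
  and poly2_mult: "poly2 (a * b) p = poly2 a p * poly2 b p"
  and poly2_1: "poly2 1 p = 1"
  and poly2_0: "poly2 0 p = 0"
  and poly2_uminus: "poly2 (- a) p = - poly2 a p"
  by (simp_all add: poly2_def)

lemma poly2_nz: "poly2 b p \<noteq> 0 \<Longrightarrow> b \<noteq> 0"
  by (auto simp: poly2_def)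

context point_evaluation
begin

lemma germI: "poly2 b p \<noteq> 0 \<Longrightarrow> v * H b = H a \<Longrightarrow> germ (to_fract a / to_fract b) v"
  unfolding germ_def by blast

lemma germ_poly: "germ (to_fract a) (H a)"
  using germI[of 1 "H a" a] by (simp add: H_1 poly2_1)

lemma germ_add:
  assumes "germ x v" "germ y w" shows "germ (x + y) (v + w)"
proof -
  obtain a b where a: "poly2 b p \<noteq> 0" "x = to_fract a / to_fract b" "v * H b = H a"
    using assms(1) unfolding germ_def by blast
  obtain c d where c: "poly2 d p \<noteq> 0" "y = to_fract c / to_fract d" "w * H d = H c"
    using assms(2) unfolding germ_def by blast
  have nz: "to_fract b \<noteq> 0" "to_fract d \<noteq> 0" using a(1) c(1) poly2_nz by auto
  have "x + y = to_fract (a * d + c * b) / to_fract (b * d)"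
    unfolding a(2) c(2) using nz by (simp add: add_frac_eq)
  moreover have "(v + w) * H (b * d) = H (a * d + c * b)"
  proof -
    have "(v + w) * H (b * d) = (v * H b) * H d + (w * H d) * H b" by (simp add: H_mult algebra_simps)
    also have "\<dots> = H (a * d + c * b)" by (simp only: a(3) c(3) H_add H_mult)
    finally show ?thesis .
  qed
  ultimately show ?thesis
    using germI[of "b * d" "v + w" "a * d + c * b"] a(1) c(1) by (simp add: poly2_mult)
qed

lemma germ_mult:
  assumes "germ x v" "germ y w" shows "germ (x * y) (v * w)"
proof -
  obtain a b where a: "poly2 b p \<noteq> 0" "x = to_fract a / to_fract b" "v * H b = H a"
    using assms(1) unfolding germ_def by blast
  obtain c d where c: "poly2 d p \<noteq> 0" "y = to_fract c / to_fract d" "w * H d = H c"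
    using assms(2) unfolding germ_def by blast
  have "x * y = to_fract (a * c) / to_fract (b * d)" unfolding a(2) c(2) by simp
  moreover have "(v * w) * H (b * d) = H (a * c)"
  proof -
    have "(v * w) * H (b * d) = (v * H b) * (w * H d)" by (simp add: H_mult algebra_simps)
    also have "\<dots> = H (a * c)" by (simp only: a(3) c(3) H_mult)
    finally show ?thesis .
  qed
  ultimately show ?thesis
    using germI[of "b * d" "v * w" "a * c"] a(1) c(1) by (simp add: poly2_mult)
qed

text \<open>Cross-multiplying two representing fractions gives a polynomial identity, to which \<open>H\<close> applies.\<close>

lemma germ_unique:
  assumes "germ x v" "germ x w" shows "v = w"
proof -
  obtain a b where a: "poly2 b p \<noteq> 0" "x = to_fract a / to_fract b" "v * H b = H a"
    using assms(1) unfolding germ_def by blast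
  obtain c d where c: "poly2 d p \<noteq> 0" "x = to_fract c / to_fract d" "w * H d = H c"
    using assms(2) unfolding germ_def by blast
  have nz: "to_fract b \<noteq> 0" "to_fract d \<noteq> 0" using a(1) c(1) poly2_nz by auto
  then have "to_fract (a * d) = to_fract (c * b)" using a(2) c(2) by (simp add: frac_eq_eq)
  then have "a * d = c * b" by (simp only: to_fract_eq_iff)
  then have "H a * H d = H c * H b" by (metis H_mult)
  then have "v * (H b * H d) = w * (H b * H d)" unfolding a(3)[symmetric] c(3)[symmetric] by (simp add: mult_ac)
  then show ?thesis using H_nz[OF a(1)] H_nz[OF c(1)] by simp
qed

lemma germ_sum:
  assumes "finite I" "\<And>i. i \<in> I \<Longrightarrow> germ (F i) (v i)" shows "germ (sum F I) (sum v I)"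
proof -
  have "H 0 + H 0 = H 0 + 0" using H_add[of 0 0] by simp
  then have "H 0 = 0" by (rule add_left_imp_eq)
  then have "germ 0 0" using germ_poly[of 0] by simp
  show ?thesis using assms by (induction I rule: finite_induct) (auto intro: germ_add \<open>germ 0 0\<close>)
qed

lemma germ_power: "germ x v \<Longrightarrow> germ (x ^ n) (v ^ n)"
proof (induction n)
  case 0 then show ?case using germ_poly[of 1] by (simp add: H_1)
qed (auto intro: germ_mult)

lemma germ_unit:
  assumes "germ x v" "germ x' v'" "x * x' = 1" shows "v * v' = 1"
  using germ_unique[OF germ_mult[OF assms(1,2)]] germ_poly[of 1] by (simp add: assms(3) H_1)

end

section \<open>The local ring at a torus point\<close>

interpretation pv: point_evaluation p "\<lambda>q. poly2 q p" for p
  by unfold_locales (auto simp: poly2_add poly2_mult poly2_1)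

abbreviation regular :: "complex \<times> complex \<Rightarrow> ratfun \<Rightarrow> complex \<Rightarrow> bool"
  where "regular p \<equiv> point_evaluation.germ p (\<lambda>q. poly2 q p)"

lemma carrier_local_ring: "x \<in> carrier (local_ring p) \<longleftrightarrow> (\<exists>c. regular p x c)"
proof
  assume "x \<in> carrier (local_ring p)"
  then obtain a b where ab: "poly2 b p \<noteq> 0" "x = to_fract a / to_fract b" by (auto simp: local_ring_def)
  then have "regular p x (poly2 a p / poly2 b p)" using pv.germI[of b p "poly2 a p / poly2 b p" a] by simp
  then show "\<exists>c. regular p x c" ..
next
  assume "\<exists>c. regular p x c"
  then show "x \<in> carrier (local_ring p)"
    unfolding pv.germ_def local_ring_def by auto
qed

lemma regular_const: "regular p (const_fun c) c"
  using pv.germ_poly[where p = p, of "[:[:c:]:]"] by (simp add: const_fun_def poly2_def)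

lemma regular_z1: "regular p z1 (fst p)" and regular_z2: "regular p z2 (snd p)"
  using pv.germ_poly[where p = p, of "[:[:0, 1:]:]"] pv.germ_poly[where p = p, of "[:0, 1:]"]
  by (simp_all add: z1_def z2_def poly2_def)

lemma regular_inverse:
  assumes "regular p x c" "c \<noteq> 0" shows "regular p (inverse x) (inverse c)"
proof -
  obtain a b where ab: "poly2 b p \<noteq> 0" "x = to_fract a / to_fract b" "c * poly2 b p = poly2 a p"
    using assms(1) unfolding pv.germ_def by blast
  have "poly2 a p \<noteq> 0" using ab assms(2) by (metis mult_eq_0_iff)
  then have "regular p (to_fract b / to_fract a) (inverse c)"
    using ab assms(2) by (intro pv.germI) (auto simp: field_simps)
  then show ?thesis by (simp add: ab(2))
qed

lemma const_fun_hom: "const_fun 0 = 0" "const_fun 1 = 1" "const_fun (c + d) = const_fun c + const_fun d"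
  "const_fun (c * d) = const_fun c * const_fun d"
  by (simp_all add: const_fun_def to_fract_add[symmetric] to_fract_mult[symmetric] one_pCons[symmetric])

lemma const_fun_uminus: "const_fun (- c) = - const_fun c"
  and const_fun_diff: "const_fun (c - d) = const_fun c - const_fun d"
proof -
  have *: "const_fun (- c) = - const_fun c" for c
    using const_fun_hom(3)[of c "- c"] by (simp add: const_fun_hom(1) minus_unique)
  show "const_fun (- c) = - const_fun c" by (rule *)
  show "const_fun (c - d) = const_fun c - const_fun d" using const_fun_hom(3)[of c "- d"] by (simp add: *)
qed

lemma const_fun_inverse: "const_fun (inverse c) = inverse (const_fun c)"
proof (cases "c = 0")
  case False
  then have "const_fun c * const_fun (inverse c) = 1" by (simp add: const_fun_hom(2,4)[symmetric])
  then show ?thesis by (metis inverse_unique)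
qed (simp add: const_fun_hom)

lemma const_fun_power: "const_fun (c ^ n) = const_fun c ^ n"
  by (induction n) (auto simp: const_fun_hom)

definition monomial_fun :: "int \<times> int \<Rightarrow> ratfun"
  where "monomial_fun a = z1 powi fst a * z2 powi snd a"

definition monomial_eval :: "int \<times> int \<Rightarrow> complex \<times> complex \<Rightarrow> complex"
  where "monomial_eval a p = fst p powi fst a * snd p powi snd a"

lemma z_nonzero: "z1 \<noteq> 0" "z2 \<noteq> 0"
  by (simp_all add: z1_def z2_def)

lemma monomial_fun_0 [simp]: "monomial_fun 0 = 1"
  and monomial_fun_add: "monomial_fun (a + b) = monomial_fun a * monomial_fun b"
  and monomial_fun_nz: "monomial_fun a \<noteq> 0"
  by (auto simp: monomial_fun_def power_int_add z_nonzero)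

lemma monomial_eval_0 [simp]: "monomial_eval 0 p = 1"
  and monomial_eval_add: "p \<in> torus \<Longrightarrow> monomial_eval (a + b) p = monomial_eval a p * monomial_eval b p"
  and monomial_eval_nz: "p \<in> torus \<Longrightarrow> monomial_eval a p \<noteq> 0"
  by (auto simp: monomial_eval_def power_int_add torus_def)

lemma regular_power_int:
  assumes "regular p x c" "c \<noteq> 0" shows "regular p (x powi k) (c powi k)"
proof (cases "k \<ge> 0")
  case True
  then show ?thesis using pv.germ_power[OF assms(1)] by (simp add: power_int_def)
next
  case False
  then show ?thesis using pv.germ_power[OF regular_inverse[OF assms]] by (simp add: power_int_def)
qed

lemma regular_monomial: "p \<in> torus \<Longrightarrow> regular p (monomial_fun a) (monomial_eval a p)"
  unfolding monomial_fun_def monomial_eval_def torus_def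
  by (intro pv.germ_mult regular_power_int regular_z1 regular_z2) auto

interpretation lf: laurent_character const_fun monomial_fun
  by unfold_locales (auto simp: const_fun_hom monomial_fun_add)

lemma laurent_fun_ev: "laurent_fun = lf.ev"
  by (auto simp: laurent_fun_def lf.ev_def monomial_fun_def mult.assoc)

lemma torus_character: "p \<in> torus \<Longrightarrow> laurent_character (\<lambda>c. c) (\<lambda>a. monomial_eval a p)"
  by unfold_locales (auto simp: monomial_eval_add)

lemma laurent_eval_ev: "p \<in> torus \<Longrightarrow> laurent_eval f p = laurent_character.ev (\<lambda>c. c) (\<lambda>a. monomial_eval a p) f"
  by (subst laurent_character.ev_def[OF torus_character])
    (simp_all add: laurent_eval_def monomial_eval_def mult.assoc)

text \<open>On the torus, evaluation is the character of the monomial values.\<close>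

lemma laurent_eval_hom:
  assumes "p \<in> torus"
  shows "laurent_eval (f + g) p = laurent_eval f p + laurent_eval g p"
    and "laurent_eval (f - g) p = laurent_eval f p - laurent_eval g p"
    and "laurent_eval (f * g) p = laurent_eval f p * laurent_eval g p"
    and "laurent_eval (Poly_Mapping.single a c) p = c * monomial_eval a p"
    and "laurent_eval 0 p = 0" and "laurent_eval 1 p = 1"
    and "laurent_eval (f ^ n) p = laurent_eval f p ^ n"
  using laurent_character.ev_add[OF torus_character[OF assms]] laurent_character.ev_diff[OF torus_character[OF assms]]
    laurent_character.ev_mult[OF torus_character[OF assms]] laurent_character.ev_single[OF torus_character[OF assms]]
    laurent_character.ev_0[OF torus_character[OF assms]] laurent_character.ev_1[OF torus_character[OF assms]]
    laurent_character.ev_power[OF torus_character[OF assms]]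
  by (simp_all add: laurent_eval_ev[OF assms])

lemma regular_laurent:
  assumes "p \<in> torus" shows "regular p (laurent_fun f) (laurent_eval f p)"
proof -
  have "laurent_fun f = (\<Sum>a\<in>Poly_Mapping.keys f. const_fun (Poly_Mapping.lookup f a) * monomial_fun a)"
    "laurent_eval f p = (\<Sum>a\<in>Poly_Mapping.keys f. Poly_Mapping.lookup f a * monomial_eval a p)"
    by (auto simp: laurent_fun_def laurent_eval_def monomial_fun_def monomial_eval_def mult.assoc)
  then show ?thesis
    by (auto intro!: pv.germ_sum pv.germ_mult regular_const regular_monomial assms)
qed

abbreviation (input) stalk :: "complex \<times> complex \<Rightarrow> ratfun set"
  where "stalk p \<equiv> carrier (local_ring p)"

lemma stalk_add: "x \<in> stalk p \<Longrightarrow> y \<in> stalk p \<Longrightarrow> x + y \<in> stalk p"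
  and stalk_mult: "x \<in> stalk p \<Longrightarrow> y \<in> stalk p \<Longrightarrow> x * y \<in> stalk p"
  and stalk_const: "const_fun c \<in> stalk p"
  unfolding carrier_local_ring by (blast intro: pv.germ_add pv.germ_mult regular_const)+

lemma stalk_0: "0 \<in> stalk p" and stalk_1: "1 \<in> stalk p"
  using stalk_const[of 0] stalk_const[of 1] by (simp_all add: const_fun_hom)

lemma stalk_uminus: "x \<in> stalk p \<Longrightarrow> - x \<in> stalk p"
  using stalk_mult[OF stalk_const[of "-1"]] by (fastforce simp: const_fun_uminus const_fun_hom)

lemma stalk_diff: "x \<in> stalk p \<Longrightarrow> y \<in> stalk p \<Longrightarrow> x - y \<in> stalk p"
  using stalk_add[of x p "- y"] stalk_uminus[of y p] by simp

lemma stalk_monomial: "p \<in> torus \<Longrightarrow> monomial_fun a \<in> stalk p"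
  and stalk_laurent: "p \<in> torus \<Longrightarrow> laurent_fun f \<in> stalk p"
  unfolding carrier_local_ring using regular_monomial regular_laurent by blast+

lemmas stalk_closed = stalk_add stalk_mult stalk_diff stalk_uminus stalk_const stalk_0 stalk_1
  stalk_monomial stalk_laurent

lemma local_ring_simps [simp]:
  "x \<otimes>\<^bsub>local_ring p\<^esub> y = x * y" "x \<oplus>\<^bsub>local_ring p\<^esub> y = x + y"
  "\<one>\<^bsub>local_ring p\<^esub> = 1" "\<zero>\<^bsub>local_ring p\<^esub> = 0"
  by (simp_all add: local_ring_def)

lemma cring_local_ring: "cring (local_ring p)"
proof (rule cringI)
  show "abelian_group (local_ring p)"
  proof (rule abelian_groupI)
    fix x assume "x \<in> stalk p"
    then show "\<exists>y\<in>stalk p. y \<oplus>\<^bsub>local_ring p\<^esub> x = \<zero>\<^bsub>local_ring p\<^esub>"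
      by (intro bexI[of _ "- x"]) (auto intro: stalk_uminus)
  qed (auto intro: stalk_closed simp: add_ac)
  show "Group.comm_monoid (local_ring p)"
    by (rule comm_monoidI) (auto intro: stalk_closed simp: mult_ac)
qed (auto simp: algebra_simps)

lemma a_minus_local_ring:
  assumes "x \<in> stalk p" "y \<in> stalk p" shows "x \<ominus>\<^bsub>local_ring p\<^esub> y = x - y"
proof -
  interpret cring "local_ring p" by (rule cring_local_ring)
  have "\<ominus>\<^bsub>local_ring p\<^esub> y = - y"
    by (rule minus_equality) (use assms in \<open>auto intro: stalk_uminus\<close>)
  then show ?thesis by (simp add: a_minus_def)
qed

definition ideal2 :: "complex \<times> complex \<Rightarrow> ratfun \<Rightarrow> ratfun \<Rightarrow> ratfun set"
  where "ideal2 p x y = {x * a + y * b | a b. a \<in> stalk p \<and> b \<in> stalk p}"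

lemma ideal2_closed:
  "s \<in> ideal2 p x y \<Longrightarrow> t \<in> ideal2 p x y \<Longrightarrow> s + t \<in> ideal2 p x y"
  "s \<in> ideal2 p x y \<Longrightarrow> a \<in> stalk p \<Longrightarrow> s * a \<in> ideal2 p x y"
  "s \<in> ideal2 p x y \<Longrightarrow> a \<in> stalk p \<Longrightarrow> a * s \<in> ideal2 p x y"
  "x \<in> ideal2 p x y" "y \<in> ideal2 p x y" "0 \<in> ideal2 p x y"
proof -
  show "s + t \<in> ideal2 p x y" if st: "s \<in> ideal2 p x y" "t \<in> ideal2 p x y"
  proof -
    obtain a b c d where "a \<in> stalk p" "b \<in> stalk p" "c \<in> stalk p" "d \<in> stalk p"
      "s = x * a + y * b" "t = x * c + y * d" using st unfolding ideal2_def by blast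
    then have "s + t = x * (a + c) + y * (b + d)" "a + c \<in> stalk p" "b + d \<in> stalk p"
      by (auto intro: stalk_closed simp: algebra_simps)
    then show ?thesis unfolding ideal2_def by blast
  qed
  show m: "s * a \<in> ideal2 p x y" if st: "s \<in> ideal2 p x y" "a \<in> stalk p" for a
  proof -
    obtain c d where "c \<in> stalk p" "d \<in> stalk p" "s = x * c + y * d" using st unfolding ideal2_def by blast
    then have "s * a = x * (c * a) + y * (d * a)" "c * a \<in> stalk p" "d * a \<in> stalk p"
      using st by (auto intro: stalk_closed simp: algebra_simps)
    then show ?thesis unfolding ideal2_def by blast
  qed
  show "a * s \<in> ideal2 p x y" if "s \<in> ideal2 p x y" "a \<in> stalk p" using m[OF that] by (simp add: mult.commute)
  have "x = x * 1 + y * 0" "y = x * 0 + y * 1" "0 = x * 0 + y * 0" by simp_all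
  then show "x \<in> ideal2 p x y" "y \<in> ideal2 p x y" "0 \<in> ideal2 p x y"
    unfolding ideal2_def using stalk_0 stalk_1 by blast+
qed

lemma ideal2_uminus: "s \<in> ideal2 p x y \<Longrightarrow> - s \<in> ideal2 p x y"
  using ideal2_closed(2)[of s p x y "- 1"] stalk_uminus[OF stalk_1] by simp

lemma ideal2_diff: "s \<in> ideal2 p x y \<Longrightarrow> t \<in> ideal2 p x y \<Longrightarrow> s - t \<in> ideal2 p x y"
  using ideal2_closed(1)[of s p x y "- t"] ideal2_uminus by simp

lemma ideal_ideal2:
  assumes "x \<in> stalk p" "y \<in> stalk p" shows "ideal (ideal2 p x y) (local_ring p)"
proof -
  interpret cring "local_ring p" by (rule cring_local_ring)
  have sub: "ideal2 p x y \<subseteq> stalk p" unfolding ideal2_def using assms by (auto intro: stalk_closed)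
  show ?thesis
  proof (rule idealI)
    show "ring (local_ring p)" by (rule ring_axioms)
    show "subgroup (ideal2 p x y) (add_monoid (local_ring p))"
    proof (rule group.subgroupI)
      show "Group.group (add_monoid (local_ring p))" by (rule a_group)
      show "ideal2 p x y \<subseteq> carrier (add_monoid (local_ring p))" using sub by simp
      show "ideal2 p x y \<noteq> {}" using ideal2_closed(6) by blast
      fix s assume s: "s \<in> ideal2 p x y"
      have "inv\<^bsub>add_monoid (local_ring p)\<^esub> s = \<ominus>\<^bsub>local_ring p\<^esub> s" by (simp add: a_inv_def)
      also have "\<dots> = - s" by (rule minus_equality) (use s sub in \<open>auto intro: stalk_uminus\<close>)
      finally show "inv\<^bsub>add_monoid (local_ring p)\<^esub> s \<in> ideal2 p x y" using ideal2_uminus[OF s] by simp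
      fix t assume "t \<in> ideal2 p x y"
      then show "s \<otimes>\<^bsub>add_monoid (local_ring p)\<^esub> t \<in> ideal2 p x y" using ideal2_closed(1)[OF s] by simp
    qed
  qed (auto intro: ideal2_closed)
qed

text \<open>The generated ideal is the least ideal with the two generators, and the combinations form one.\<close>

lemma system_ideal_eq:
  assumes "p \<in> torus"
  shows "system_ideal p f g = ideal2 p (laurent_fun f) (laurent_fun g)"
proof -
  interpret cring "local_ring p" by (rule cring_local_ring)
  let ?x = "laurent_fun f" and ?y = "laurent_fun g"
  have mem: "?x \<in> stalk p" "?y \<in> stalk p" using assms by (auto intro: stalk_closed)
  show ?thesis
  proof
    show "system_ideal p f g \<subseteq> ideal2 p ?x ?y"
      unfolding system_ideal_def
      by (rule genideal_minimal[OF ideal_ideal2[OF mem]]) (auto intro: ideal2_closed)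
    have I: "ideal (system_ideal p f g) (local_ring p)" "{?x, ?y} \<subseteq> system_ideal p f g"
      unfolding system_ideal_def using mem by (auto intro: genideal_ideal genideal_self[THEN subsetD])
    interpret I: ideal "system_ideal p f g" "local_ring p" by (rule I(1))
    show "ideal2 p ?x ?y \<subseteq> system_ideal p f g"
      unfolding ideal2_def using I(2) I.a_closed I.I_r_closed by (auto simp: subset_iff)
  qed
qed

section \<open>Dimension of a quotient of the local ring\<close>

text \<open>The operations of the quotient ring on cosets, in terms of field arithmetic on representatives.\<close>

lemma quotient_hom:
  assumes "ideal I (local_ring p)" "x \<in> stalk p" "y \<in> stalk p"
  shows "(I +>\<^bsub>local_ring p\<^esub> x) \<otimes>\<^bsub>local_ring p Quot I\<^esub> (I +>\<^bsub>local_ring p\<^esub> y) = I +>\<^bsub>local_ring p\<^esub> (x * y)"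
    and "(I +>\<^bsub>local_ring p\<^esub> x) \<oplus>\<^bsub>local_ring p Quot I\<^esub> (I +>\<^bsub>local_ring p\<^esub> y) = I +>\<^bsub>local_ring p\<^esub> (x + y)"
    and "(I +>\<^bsub>local_ring p\<^esub> x = I +>\<^bsub>local_ring p\<^esub> y) \<longleftrightarrow> x - y \<in> I"
    and "\<zero>\<^bsub>local_ring p Quot I\<^esub> = I +>\<^bsub>local_ring p\<^esub> 0"
    and "carrier (local_ring p Quot I) = (\<lambda>x. I +>\<^bsub>local_ring p\<^esub> x) ` stalk p"
proof -
  interpret R: cring "local_ring p" by (rule cring_local_ring)
  interpret I: ideal I "local_ring p" by (rule assms(1))
  have hom: "(\<lambda>x. I +>\<^bsub>local_ring p\<^esub> x) \<in> ring_hom (local_ring p) (local_ring p Quot I)"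
    using I.rcos_ring_hom by simp
  show "(I +>\<^bsub>local_ring p\<^esub> x) \<otimes>\<^bsub>local_ring p Quot I\<^esub> (I +>\<^bsub>local_ring p\<^esub> y) = I +>\<^bsub>local_ring p\<^esub> (x * y)"
    using ring_hom_mult[OF hom assms(2,3)] by simp
  show "(I +>\<^bsub>local_ring p\<^esub> x) \<oplus>\<^bsub>local_ring p Quot I\<^esub> (I +>\<^bsub>local_ring p\<^esub> y) = I +>\<^bsub>local_ring p\<^esub> (x + y)"
    using ring_hom_add[OF hom assms(2,3)] by simp
  show "(I +>\<^bsub>local_ring p\<^esub> x = I +>\<^bsub>local_ring p\<^esub> y) \<longleftrightarrow> x - y \<in> I"
    using R.quotient_eq_iff_same_a_r_cos[OF assms] a_minus_local_ring[OF assms(2,3)] by simp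
  have "0 \<in> I" using I.zero_closed by simp
  then have "I +>\<^bsub>local_ring p\<^esub> 0 = I" using I.a_rcos_const[of 0] by simp
  then show "\<zero>\<^bsub>local_ring p Quot I\<^esub> = I +>\<^bsub>local_ring p\<^esub> 0" by (simp add: FactRing_def)
  show "carrier (local_ring p Quot I) = (\<lambda>x. I +>\<^bsub>local_ring p\<^esub> x) ` stalk p"
    by (auto simp: FactRing_def A_RCOSETS_def')
qed

text \<open>Translates one step of the recursive construction of finite-dimensional subspaces from cosets to
  representatives.\<close>

lemma line_extension_quotient:
  assumes I: "ideal I (local_ring p)" and b: "b \<in> stalk p" and S: "S \<subseteq> stalk p"
  shows "ring.line_extension (local_ring p Quot I) (range (\<lambda>c. I +>\<^bsub>local_ring p\<^esub> const_fun c))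
      (I +>\<^bsub>local_ring p\<^esub> b) ((\<lambda>x. I +>\<^bsub>local_ring p\<^esub> x) ` S)
    = (\<lambda>x. I +>\<^bsub>local_ring p\<^esub> x) ` {const_fun c * b + s | c s. s \<in> S}"
    (is "ring.line_extension ?Q ?K _ (?h ` S) = ?h ` ?T")
proof -
  interpret I: ideal I "local_ring p" by (rule I)
  interpret Q: ring ?Q by (rule I.quotient_is_ring)
  have eq: "?h (const_fun c) \<otimes>\<^bsub>?Q\<^esub> ?h b \<oplus>\<^bsub>?Q\<^esub> ?h s = ?h (const_fun c * b + s)" if "s \<in> S" for c s
    using that S b by (simp add: quotient_hom(1)[OF I stalk_const b] quotient_hom(2)[OF I stalk_mult[OF stalk_const b]] subset_iff)
  have "u \<in> Q.line_extension ?K (?h b) (?h ` S) \<longleftrightarrow> u \<in> ?h ` ?T" for u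
  proof -
    have "u \<in> Q.line_extension ?K (?h b) (?h ` S) \<longleftrightarrow> (\<exists>c. \<exists>s\<in>S. u = ?h (const_fun c) \<otimes>\<^bsub>?Q\<^esub> ?h b \<oplus>\<^bsub>?Q\<^esub> ?h s)"
      unfolding Q.line_extension_mem_iff by blast
    also have "\<dots> \<longleftrightarrow> (\<exists>c. \<exists>s\<in>S. u = ?h (const_fun c * b + s))" using eq by metis
    also have "\<dots> \<longleftrightarrow> u \<in> ?h ` ?T" by blast
    finally show ?thesis .
  qed
  then show ?thesis by blast
qed

text \<open>The basis is consumed one vector at a time by the inductive definition of dimension; independence supplies the
  side condition of every step.\<close>

proposition dimension_three_of_basis:
  assumes I: "ideal I (local_ring p)" and b: "b1 \<in> stalk p" "b2 \<in> stalk p" "b3 \<in> stalk p"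
    and span: "\<And>x. x \<in> stalk p \<Longrightarrow>
      \<exists>c1 c2 c3. x - (const_fun c1 * b1 + const_fun c2 * b2 + const_fun c3 * b3) \<in> I"
    and indep: "\<And>c1 c2 c3. const_fun c1 * b1 + const_fun c2 * b2 + const_fun c3 * b3 \<in> I \<Longrightarrow>
      c1 = 0 \<and> c2 = 0 \<and> c3 = 0"
  shows "ring.dimension (local_ring p Quot I) 3 (range (\<lambda>c. I +>\<^bsub>local_ring p\<^esub> const_fun c))
    (carrier (local_ring p Quot I))"
proof -
  let ?Q = "local_ring p Quot I" and ?K = "range (\<lambda>c. I +>\<^bsub>local_ring p\<^esub> const_fun c)"
  let ?h = "\<lambda>x. I +>\<^bsub>local_ring p\<^esub> x"
  interpret I: ideal I "local_ring p" by (rule I)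
  interpret Q: ring ?Q by (rule I.quotient_is_ring)
  define S1 where "S1 = {const_fun c * b3 + s | c s. s \<in> {0::ratfun}}"
  define S2 where "S2 = {const_fun c * b2 + s | c s. s \<in> S1}"
  define S3 where "S3 = {const_fun c * b1 + s | c s. s \<in> S2}"
  have S1: "S1 \<subseteq> stalk p" unfolding S1_def using b by (auto intro: stalk_closed)
  have S2: "S2 \<subseteq> stalk p" unfolding S2_def using b S1 by (auto intro!: stalk_closed)
  have S3: "S3 \<subseteq> stalk p" unfolding S3_def using b S2 by (auto intro!: stalk_closed)
  have eq: "?h x = ?h y \<longleftrightarrow> x - y \<in> I" if "x \<in> stalk p" "y \<in> stalk p" for x y
    using quotient_hom(3)[OF I that] .
  have car: "?h x \<in> carrier ?Q" if "x \<in> stalk p" for x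
    using that quotient_hom(5)[OF I that that] by blast
  have d0: "Q.dimension 0 ?K (?h ` {0})"
    using Q.zero_dim[of ?K] quotient_hom(4)[OF I stalk_0 stalk_0] by simp
  have d1: "Q.dimension (Suc 0) ?K (?h ` S1)"
  proof -
    have "?h b3 \<notin> ?h ` {0}"
      using eq[OF b(3) stalk_0] indep[of 0 0 1] by (auto simp: const_fun_hom)
    then show ?thesis
      using Q.Suc_dim[OF car[OF b(3)] _ d0] line_extension_quotient[OF I b(3), of "{0}"] stalk_0
      unfolding S1_def by simp
  qed
  have d2: "Q.dimension (Suc (Suc 0)) ?K (?h ` S2)"
  proof -
    have "?h b2 \<notin> ?h ` S1"
    proof
      assume "?h b2 \<in> ?h ` S1"
      then obtain c where c: "const_fun c * b3 \<in> S1" "?h b2 = ?h (const_fun c * b3)" unfolding S1_def by auto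
      then have "b2 - const_fun c * b3 \<in> I" using eq[OF b(2)] S1 by blast
      then show False using indep[of 0 1 "- c"] by (simp add: const_fun_hom const_fun_uminus)
    qed
    then show ?thesis
      using Q.Suc_dim[OF car[OF b(2)] _ d1] line_extension_quotient[OF I b(2) S1] unfolding S2_def by simp
  qed
  have d3: "Q.dimension (Suc (Suc (Suc 0))) ?K (?h ` S3)"
  proof -
    have "?h b1 \<notin> ?h ` S2"
    proof
      assume "?h b1 \<in> ?h ` S2"
      then obtain x where x: "x \<in> S2" "?h b1 = ?h x" by auto
      then obtain c d where c: "x = const_fun c * b2 + const_fun d * b3" unfolding S1_def S2_def by auto
      have "b1 - x \<in> I" using eq[OF b(1)] S2 x by blast
      then show False using indep[of 1 "- c" "- d"] by (simp add: c const_fun_hom const_fun_uminus algebra_simps)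
    qed
    then show ?thesis
      using Q.Suc_dim[OF car[OF b(1)] _ d2] line_extension_quotient[OF I b(1) S2] unfolding S3_def by simp
  qed
  have "?h ` S3 = carrier ?Q"
  proof
    show "?h ` S3 \<subseteq> carrier ?Q" using S3 car by blast
    show "carrier ?Q \<subseteq> ?h ` S3"
    proof
      fix u assume "u \<in> carrier ?Q"
      then obtain x where x: "x \<in> stalk p" "u = ?h x" using quotient_hom(5)[OF I stalk_0 stalk_0] by auto
      from span[OF x(1)] obtain c1 c2 c3
        where c: "x - (const_fun c1 * b1 + const_fun c2 * b2 + const_fun c3 * b3) \<in> I" by blast
      have m: "const_fun c1 * b1 + (const_fun c2 * b2 + (const_fun c3 * b3 + 0)) \<in> S3"
        unfolding S3_def S2_def S1_def by blast
      then have "?h x = ?h (const_fun c1 * b1 + (const_fun c2 * b2 + (const_fun c3 * b3 + 0)))"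
        using eq[OF x(1)] S3 c by (auto simp: add.assoc)
      then show "u \<in> ?h ` S3" using m x(2) by blast
    qed
  qed
  then show ?thesis using d3 by (simp add: numeral_3_eq_3)
qed

text \<open>A space of dimension three contains three independent vectors, but three vectors in the span of two are
  dependent. The dependency is found by hand from the coordinates: either the last coordinate vector vanishes,
  or the last two are parallel, or Cramer's rule applies.\<close>

proposition not_dimension_three_of_two_generators:
  assumes I: "ideal I (local_ring p)" and b: "b1 \<in> stalk p" "b2 \<in> stalk p"
    and span: "\<And>x. x \<in> stalk p \<Longrightarrow> \<exists>c1 c2. x - (const_fun c1 * b1 + const_fun c2 * b2) \<in> I"
  shows "\<not> ring.dimension (local_ring p Quot I) 3 (range (\<lambda>c. I +>\<^bsub>local_ring p\<^esub> const_fun c))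
    (carrier (local_ring p Quot I))"
proof
  let ?Q = "local_ring p Quot I" and ?K = "range (\<lambda>c. I +>\<^bsub>local_ring p\<^esub> const_fun c)"
  let ?h = "\<lambda>x. I +>\<^bsub>local_ring p\<^esub> x"
  interpret I: ideal I "local_ring p" by (rule I)
  interpret Q: ring ?Q by (rule I.quotient_is_ring)
  assume "Q.dimension 3 ?K (carrier ?Q)"
  then have "Q.dimension (Suc (Suc (Suc 0))) ?K (carrier ?Q)" by (simp add: numeral_3_eq_3)
  then obtain v1 E1 where v1: "v1 \<in> carrier ?Q" "v1 \<notin> E1" "Q.dimension (Suc (Suc 0)) ?K E1"
    by (cases rule: Q.dimension.cases) auto
  from v1(3) obtain v2 E2 where v2: "v2 \<in> carrier ?Q" "v2 \<notin> E2" "Q.dimension (Suc 0) ?K E2"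
    "E1 = Q.line_extension ?K v2 E2"
    by (cases rule: Q.dimension.cases) auto
  from v2(3) obtain v3 E3 where v3: "v3 \<in> carrier ?Q" "v3 \<notin> E3" "Q.dimension 0 ?K E3"
    "E2 = Q.line_extension ?K v3 E3"
    by (cases rule: Q.dimension.cases) auto
  from v3(3) have E3: "E3 = ?h ` {0}"
    using quotient_hom(4)[OF I stalk_0 stalk_0] by (cases rule: Q.dimension.cases) auto
  from v1(1) v2(1) v3(1) obtain x1 x2 x3
    where x: "x1 \<in> stalk p" "x2 \<in> stalk p" "x3 \<in> stalk p" and v: "v1 = ?h x1" "v2 = ?h x2" "v3 = ?h x3"
    using quotient_hom(5)[OF I stalk_0 stalk_0] by auto
  define S1 where "S1 = {const_fun c * x3 + s | c s. s \<in> {0::ratfun}}"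
  define S2 where "S2 = {const_fun c * x2 + s | c s. s \<in> S1}"
  have S1: "S1 \<subseteq> stalk p" unfolding S1_def using x by (auto intro: stalk_closed)
  have S2: "S2 \<subseteq> stalk p" unfolding S2_def using x S1 by (auto intro!: stalk_closed)
  have E2: "E2 = ?h ` S1" unfolding v3(4) E3 v S1_def using x stalk_0 by (intro line_extension_quotient[OF I]) auto
  have E1: "E1 = ?h ` S2" unfolding v2(4) E2 v S2_def using x S1 by (intro line_extension_quotient[OF I]) auto
  have eq: "?h x = ?h y \<longleftrightarrow> x - y \<in> I" if "x \<in> stalk p" "y \<in> stalk p" for x y
    using quotient_hom(3)[OF I that] .
  have n3: "x3 \<notin> I" using v3(2) eq[OF x(3) stalk_0] unfolding E3 v by auto
  have n2: "x2 - const_fun c * x3 \<notin> I" for c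
  proof
    assume *: "x2 - const_fun c * x3 \<in> I"
    have m: "const_fun c * x3 + 0 \<in> S1" unfolding S1_def by blast
    then have "?h x2 = ?h (const_fun c * x3 + 0)" using eq[OF x(2)] S1 * by (auto simp: subset_iff)
    then show False using v2(2) m unfolding E2 v by blast
  qed
  have n1: "x1 - (const_fun c * x2 + const_fun d * x3) \<notin> I" for c d
  proof
    assume *: "x1 - (const_fun c * x2 + const_fun d * x3) \<in> I"
    have m: "const_fun c * x2 + (const_fun d * x3 + 0) \<in> S2" unfolding S2_def S1_def by blast
    then have "?h x1 = ?h (const_fun c * x2 + (const_fun d * x3 + 0))" using eq[OF x(1)] S2 * by (auto simp: subset_iff)
    then show False using v1(2) m unfolding E1 v by blast
  qed
  obtain a1 c1 where r1: "x1 - (const_fun a1 * b1 + const_fun c1 * b2) \<in> I" using span[OF x(1)] by blast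
  obtain a2 c2 where r2: "x2 - (const_fun a2 * b1 + const_fun c2 * b2) \<in> I" using span[OF x(2)] by blast
  obtain a3 c3 where r3: "x3 - (const_fun a3 * b1 + const_fun c3 * b2) \<in> I" using span[OF x(3)] by blast
  have mem: "s + t \<in> I" "const_fun c * s \<in> I" "s - t \<in> I" if "s \<in> I" "t \<in> I" for s t c
  proof -
    show "s + t \<in> I" using additive_subgroup.a_closed[OF I.is_additive_subgroup that] by simp
    have sm: "const_fun c * s \<in> I" if "s \<in> I" for c s using I.I_l_closed[OF that stalk_const] by simp
    then show "const_fun c * s \<in> I" using that by blast
    have "- t \<in> I" using sm[OF that(2), of "-1"] by (simp add: const_fun_uminus const_fun_hom)
    then show "s - t \<in> I" using additive_subgroup.a_closed[OF I.is_additive_subgroup that(1), of "- t"] by simp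
  qed
  have comb: "const_fun k1 * x1 + const_fun k2 * x2 + const_fun k3 * x3 \<in> I"
    if "k1 * a1 + k2 * a2 + k3 * a3 = 0" "k1 * c1 + k2 * c2 + k3 * c3 = 0" for k1 k2 k3
  proof -
    have z: "const_fun (k1 * a1 + k2 * a2 + k3 * a3) = 0" "const_fun (k1 * c1 + k2 * c2 + k3 * c3) = 0"
      using that by (simp_all add: const_fun_hom)
    have "const_fun k1 * (x1 - (const_fun a1 * b1 + const_fun c1 * b2)) +
        const_fun k2 * (x2 - (const_fun a2 * b1 + const_fun c2 * b2)) +
        const_fun k3 * (x3 - (const_fun a3 * b1 + const_fun c3 * b2)) \<in> I"
      by (intro mem(1) mem(2)[OF r1 r1] mem(2)[OF r2 r2] mem(2)[OF r3 r3])
    moreover have "const_fun k1 * (x1 - (const_fun a1 * b1 + const_fun c1 * b2)) +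
        const_fun k2 * (x2 - (const_fun a2 * b1 + const_fun c2 * b2)) +
        const_fun k3 * (x3 - (const_fun a3 * b1 + const_fun c3 * b2))
      = const_fun k1 * x1 + const_fun k2 * x2 + const_fun k3 * x3
        - const_fun (k1 * a1 + k2 * a2 + k3 * a3) * b1 - const_fun (k1 * c1 + k2 * c2 + k3 * c3) * b2"
      by (simp add: const_fun_hom algebra_simps)
    ultimately show ?thesis by (simp add: z)
  qed
  show False
  proof (cases "a3 = 0 \<and> c3 = 0")
    case True
    then show False using comb[of 0 0 1] n3 by (simp add: const_fun_hom)
  next
    case nz: False
    show False
    proof (cases "a2 * c3 = a3 * c2")
      case True
      have "\<exists>c. a2 = c * a3 \<and> c2 = c * c3"
      proof (cases "a3 = 0")
        case True
        then show ?thesis using nz \<open>a2 * c3 = a3 * c2\<close> by (intro exI[of _ "c2 / c3"]) auto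
      next
        case False
        then show ?thesis using \<open>a2 * c3 = a3 * c2\<close> by (intro exI[of _ "a2 / a3"]) (auto simp: field_simps)
      qed
      then obtain c where "a2 = c * a3" "c2 = c * c3" by blast
      then show False using comb[of 0 1 "- c"] n2[of c] by (simp add: const_fun_hom const_fun_uminus)
    next
      case False
      define D where "D = a2 * c3 - a3 * c2"
      have D: "D \<noteq> 0" using False by (simp add: D_def)
      define k2 where "k2 = (a3 * c1 - a1 * c3) / D"
      define k3 where "k3 = (a1 * c2 - a2 * c1) / D"
      have "k2 * a2 + k3 * a3 = ((a3 * c1 - a1 * c3) * a2 + (a1 * c2 - a2 * c1) * a3) / D"
        "k2 * c2 + k3 * c3 = ((a3 * c1 - a1 * c3) * c2 + (a1 * c2 - a2 * c1) * c3) / D"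
        unfolding k2_def k3_def by (simp_all add: add_divide_distrib)
      moreover have "(a3 * c1 - a1 * c3) * a2 + (a1 * c2 - a2 * c1) * a3 = - a1 * D"
        "(a3 * c1 - a1 * c3) * c2 + (a1 * c2 - a2 * c1) * c3 = - c1 * D"
        unfolding D_def by (simp_all add: algebra_simps)
      ultimately have "1 * a1 + k2 * a2 + k3 * a3 = 0" "1 * c1 + k2 * c2 + k3 * c3 = 0"
        using D by (simp_all add: add.assoc)
      then show False using comb[of 1 k2 k3] n1[of "- k2" "- k3"]
        by (simp add: const_fun_hom const_fun_uminus algebra_simps)
    qed
  qed
qed

section \<open>Regular functions in unimodular coordinates\<close>

text \<open>Divide by the outer linear factor; the remainder depends on the inner variable only and vanishes at the point.\<close>

lemma poly2_root_split:
  assumes "poly2 q p = 0"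
  shows "\<exists>q1 r. q = [:- [:snd p:], 1:] * q1 + [:[:- fst p, 1:]:] * [:r:]"
proof -
  have "[:- fst p, 1:] dvd poly q [:snd p:]" using assms by (simp add: poly2_def poly_eq_0_iff_dvd)
  then obtain r where r: "poly q [:snd p:] = [:- fst p, 1:] * r" by (elim dvdE)
  have "q = [:- [:snd p:], 1:] * synthetic_div q [:snd p:] + [:poly q [:snd p:]:]"
    using synthetic_div_correct'[of "[:snd p:]" q] by simp
  then show ?thesis unfolding r by (intro exI[of _ "synthetic_div q [:snd p:]"] exI[of _ r]) simp
qed

lemma to_fract_linear: "to_fract [:- [:c:], 1:] = z2 - const_fun c" "to_fract [:[:- c, 1:]:] = z1 - const_fun c"
  unfolding z1_def z2_def const_fun_def to_fract_diff[symmetric] by simp_all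

text \<open>The maximal ideal of the local ring is generated by the two coordinate differences.\<close>

lemma stalk_split:
  assumes "x \<in> stalk p"
  shows "\<exists>c y y'. y \<in> stalk p \<and> y' \<in> stalk p \<and>
    x = const_fun c + (z1 - const_fun (fst p)) * y + (z2 - const_fun (snd p)) * y'"
proof -
  obtain a b where ab: "poly2 b p \<noteq> 0" "x = to_fract a / to_fract b" using assms by (auto simp: local_ring_def)
  define c where "c = poly2 a p / poly2 b p"
  define N where "N = a - [:[:c:]:] * b"
  have "poly2 N p = 0" using ab(1) by (simp add: N_def c_def poly2_def)
  then obtain q1 r where N: "N = [:- [:snd p:], 1:] * q1 + [:[:- fst p, 1:]:] * [:r:]"
    using poly2_root_split by blast
  have bnz: "to_fract b \<noteq> 0" using poly2_nz[OF ab(1)] by simp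
  have "to_fract N = to_fract a - const_fun c * to_fract b"
    by (simp only: N_def const_fun_def to_fract_diff to_fract_mult)
  then have "x - const_fun c = to_fract N / to_fract b"
    unfolding ab(2) using bnz by (simp add: diff_divide_distrib)
  also have "to_fract N = (z2 - const_fun (snd p)) * to_fract q1 + (z1 - const_fun (fst p)) * to_fract [:r:]"
    unfolding N to_fract_add to_fract_mult to_fract_linear ..
  also have "((z2 - const_fun (snd p)) * to_fract q1 + (z1 - const_fun (fst p)) * to_fract [:r:]) / to_fract b
      = (z1 - const_fun (fst p)) * (to_fract [:r:] / to_fract b) + (z2 - const_fun (snd p)) * (to_fract q1 / to_fract b)"
    by (simp only: add_divide_distrib times_divide_eq_right add.commute)
  finally have "x = const_fun c + (z1 - const_fun (fst p)) * (to_fract [:r:] / to_fract b)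
      + (z2 - const_fun (snd p)) * (to_fract q1 / to_fract b)"
    by (simp only: diff_eq_eq add_ac)
  moreover have "to_fract [:r:] / to_fract b \<in> stalk p" "to_fract q1 / to_fract b \<in> stalk p"
    using ab(1) by (auto simp: local_ring_def)
  ultimately show ?thesis by blast
qed

lemma power_diff_divides:
  assumes "regular p x c"
  shows "\<exists>y\<in>stalk p. x ^ n - const_fun (c ^ n) = (x - const_fun c) * y"
proof (induction n)
  case 0 then show ?case by (auto simp: const_fun_hom intro!: bexI[of _ 0] stalk_0)
next
  case (Suc n)
  then obtain y where y: "y \<in> stalk p" "x ^ n - const_fun (c ^ n) = (x - const_fun c) * y" by blast
  have "x ^ Suc n - const_fun (c ^ Suc n) = x * (x ^ n - const_fun (c ^ n)) + (x - const_fun c) * const_fun (c ^ n)"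
    by (simp add: const_fun_hom algebra_simps)
  also have "\<dots> = (x - const_fun c) * (x * y + const_fun (c ^ n))" unfolding y(2) by (simp add: algebra_simps)
  finally show ?case using y(1) assms carrier_local_ring by (blast intro: stalk_closed)
qed

text \<open>For negative exponents, divide the difference of the positive powers by the two units involved.\<close>

lemma power_int_diff_divides:
  assumes x: "regular p x c" "c \<noteq> 0" "x \<noteq> 0"
  shows "\<exists>y\<in>stalk p. x powi k - const_fun (c powi k) = (x - const_fun c) * y"
proof (cases "k \<ge> 0")
  case True
  then show ?thesis using power_diff_divides[OF x(1), of "nat k"] by (simp add: power_int_def)
next
  case False
  obtain y where y: "y \<in> stalk p" "x ^ nat (- k) - const_fun (c ^ nat (- k)) = (x - const_fun c) * y"
    using power_diff_divides[OF x(1)] by blast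
  let ?n = "nat (- k)"
  define A where "A = x ^ ?n"
  define C where "C = const_fun (c ^ ?n)"
  have "const_fun (c ^ ?n) * const_fun (inverse (c ^ ?n)) = 1"
    using x(2) by (simp add: const_fun_hom(4)[symmetric] const_fun_hom(2))
  then have nz: "A \<noteq> 0" "C \<noteq> 0" using x(3) by (auto simp: A_def C_def)
  have e1: "x powi k = inverse A" "const_fun (c powi k) = inverse C"
    using False by (simp_all add: A_def C_def power_int_def power_inverse const_fun_inverse)
  have "inverse A - inverse C = - (A - C) * (inverse A * inverse C)"
    using nz by (simp add: field_simps)
  also have "\<dots> = (x - const_fun c) * (- y * (inverse A * inverse C))"
    using y(2) unfolding A_def[symmetric] C_def[symmetric] by simp
  finally have e: "x powi k - const_fun (c powi k)
      = (x - const_fun c) * (- y * (inverse (x ^ ?n) * const_fun (inverse (c ^ ?n))))"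
    unfolding e1 unfolding A_def C_def const_fun_inverse .
  have "regular p (inverse (x ^ ?n)) (inverse (c ^ ?n))"
    using x pv.germ_power by (intro regular_inverse) auto
  then have "inverse (x ^ ?n) \<in> stalk p" using carrier_local_ring by blast
  then have "- y * (inverse (x ^ ?n) * const_fun (inverse (c ^ ?n))) \<in> stalk p"
    using y(1) by (intro stalk_closed)
  then show ?thesis using e by blast
qed

lemma monomial_fun_lattice: "monomial_fun (lattice_map 0 u v c) = monomial_fun u powi fst c * monomial_fun v powi snd c"
  by (simp add: monomial_fun_def lattice_map_def power_int_mult_distrib power_int_add z_nonzero
      power_int_mult[symmetric] mult_ac)

lemma monomial_eval_lattice:
  "p \<in> torus \<Longrightarrow> monomial_eval (lattice_map 0 u v c) p = monomial_eval u p powi fst c * monomial_eval v p powi snd c"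
  by (simp add: monomial_eval_def torus_def lattice_map_def power_int_mult_distrib power_int_add
      power_int_mult[symmetric] mult_ac)

text \<open>Express the exponent in the basis \<open>u\<close>, \<open>v\<close> and telescope the difference of products.\<close>

lemma monomial_diff_divides:
  assumes p: "p \<in> torus" and uv: "\<bar>det2 u v\<bar> = 1"
  shows "\<exists>y\<in>stalk p. \<exists>y'\<in>stalk p. monomial_fun a - const_fun (monomial_eval a p)
    = (monomial_fun u - const_fun (monomial_eval u p)) * y + (monomial_fun v - const_fun (monomial_eval v p)) * y'"
proof -
  obtain i j where ij: "coord u v a = (i, j)" by (cases "coord u v a")
  have a: "a = lattice_map 0 u v (i, j)" using lattice_map_coord[OF uv, of a] ij by simp
  let ?U = "monomial_fun u" and ?V = "monomial_fun v" and ?cU = "monomial_eval u p" and ?cV = "monomial_eval v p"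
  obtain y where y: "y \<in> stalk p" "?U powi i - const_fun (?cU powi i) = (?U - const_fun ?cU) * y"
    using power_int_diff_divides[OF regular_monomial monomial_eval_nz monomial_fun_nz] p by blast
  obtain y' where y': "y' \<in> stalk p" "?V powi j - const_fun (?cV powi j) = (?V - const_fun ?cV) * y'"
    using power_int_diff_divides[OF regular_monomial monomial_eval_nz monomial_fun_nz] p by blast
  have "monomial_fun a - const_fun (monomial_eval a p)
      = ?U powi i * ?V powi j - const_fun (?cU powi i) * const_fun (?cV powi j)"
    unfolding a monomial_fun_lattice monomial_eval_lattice[OF p] by (simp add: const_fun_hom)
  also have "\<dots> = (?U powi i - const_fun (?cU powi i)) * ?V powi j + const_fun (?cU powi i) * (?V powi j - const_fun (?cV powi j))"
    by (simp add: algebra_simps)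
  also have "\<dots> = (?U - const_fun ?cU) * (y * ?V powi j) + (?V - const_fun ?cV) * (const_fun (?cU powi i) * y')"
    unfolding y(2) y'(2) by (simp add: algebra_simps)
  finally have e: "monomial_fun a - const_fun (monomial_eval a p) =
    (?U - const_fun ?cU) * (y * ?V powi j) + (?V - const_fun ?cV) * (const_fun (?cU powi i) * y')" .
  have "?V powi j \<in> stalk p"
    using regular_power_int[OF regular_monomial[OF p] monomial_eval_nz[OF p]] carrier_local_ring by blast
  then have "y * ?V powi j \<in> stalk p" "const_fun (?cU powi i) * y' \<in> stalk p"
    using y(1) y'(1) by (auto intro: stalk_closed)
  then show ?thesis using e by blast
qed

text \<open>Any unimodular pair of monomials gives local coordinates, since the standard coordinates are monomials in
  them. This makes the later arguments independent of the frame.\<close>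

proposition stalk_split_basis:
  assumes p: "p \<in> torus" and uv: "\<bar>det2 u v\<bar> = 1" and x: "x \<in> stalk p"
  shows "\<exists>c y y'. y \<in> stalk p \<and> y' \<in> stalk p \<and>
    x = const_fun c + (monomial_fun u - const_fun (monomial_eval u p)) * y
      + (monomial_fun v - const_fun (monomial_eval v p)) * y'"
proof -
  obtain c y y' where c: "y \<in> stalk p" "y' \<in> stalk p"
    "x = const_fun c + (z1 - const_fun (fst p)) * y + (z2 - const_fun (snd p)) * y'"
    using stalk_split[OF x] by blast
  have z: "z1 = monomial_fun (1, 0)" "z2 = monomial_fun (0, 1)" "fst p = monomial_eval (1, 0) p" "snd p = monomial_eval (0, 1) p"
    by (simp_all add: monomial_fun_def monomial_eval_def)
  obtain s s' where s: "s \<in> stalk p" "s' \<in> stalk p" "z1 - const_fun (fst p) =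
      (monomial_fun u - const_fun (monomial_eval u p)) * s + (monomial_fun v - const_fun (monomial_eval v p)) * s'"
    using monomial_diff_divides[OF p uv, of "(1, 0)"] unfolding z[symmetric] by blast
  obtain t t' where t: "t \<in> stalk p" "t' \<in> stalk p" "z2 - const_fun (snd p) =
      (monomial_fun u - const_fun (monomial_eval u p)) * t + (monomial_fun v - const_fun (monomial_eval v p)) * t'"
    using monomial_diff_divides[OF p uv, of "(0, 1)"] unfolding z[symmetric] by blast
  have "x = const_fun c + (monomial_fun u - const_fun (monomial_eval u p)) * (s * y + t * y')
      + (monomial_fun v - const_fun (monomial_eval v p)) * (s' * y + t' * y')"
    unfolding c(3) s(3) t(3) by (simp add: algebra_simps)
  moreover have "s * y + t * y' \<in> stalk p" "s' * y + t' * y' \<in> stalk p"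
    using c s t by (auto intro: stalk_closed)
  ultimately show ?thesis by blast
qed

section \<open>Taylor expansion of regular functions along curves\<close>

text \<open>Substitution of two power series for the variables, \<open>X\<close> for the inner and \<open>Y\<close> for
  the outer one.\<close>

definition series_at :: "complex fps \<Rightarrow> complex fps \<Rightarrow> complex poly poly \<Rightarrow> complex fps"
  where "series_at X Y q = poly (map_poly (\<lambda>r. poly (map_poly fps_const r) X) q) Y"

lemma series_at_hom:
  "series_at X Y (a + b) = series_at X Y a + series_at X Y b"
  "series_at X Y (a * b) = series_at X Y a * series_at X Y b"
  "series_at X Y 1 = 1"
proof -
  let ?h = "\<lambda>r. poly (map_poly fps_const r) X"
  have h: "?h 0 = 0" "?h (x + y) = ?h x + ?h y" "?h (x * y) = ?h x * ?h y" for x y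
    using poly_map_hom[of fps_const x y X] by (auto simp: fps_const_add[symmetric] fps_const_mult[symmetric] simp del: fps_const_add fps_const_mult)
  show "series_at X Y (a + b) = series_at X Y a + series_at X Y b"
    "series_at X Y (a * b) = series_at X Y a * series_at X Y b"
    unfolding series_at_def using poly_map_hom[of ?h a b Y] h by auto
  show "series_at X Y 1 = 1" by (simp add: series_at_def map_poly_1)
qed

lemma series_at_pCons: "series_at X Y (pCons r q) = poly (map_poly fps_const r) X + Y * series_at X Y q"
  unfolding series_at_def by (cases "q = 0 \<and> r = 0") (auto simp: map_poly_pCons)

lemma series_at_nth_0:
  assumes "fps_nth X 0 = fst p" "fps_nth Y 0 = snd p"
  shows "fps_nth (series_at X Y q) 0 = poly2 q p"
proof (induction q)
  case 0 show ?case by (simp add: series_at_def poly2_def)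
next
  case (pCons r q)
  have "fps_nth (poly (map_poly fps_const r) X) 0 = poly r (fst p)" for r
    by (induction r) (auto simp: map_poly_pCons assms)
  then show ?case using pCons by (simp add: series_at_pCons poly2_def assms)
qed

lemma series_point_evaluation:
  assumes "fps_nth X 0 = fst p" "fps_nth Y 0 = snd p"
  shows "point_evaluation p (series_at X Y)"
proof
  show "poly2 b p \<noteq> 0 \<Longrightarrow> series_at X Y b \<noteq> 0" for b
    using series_at_nth_0[OF assms, of b] by auto
qed (auto simp: series_at_hom)

text \<open>A denominator that does not vanish at the point becomes a power series with nonzero constant term, hence
  invertible.\<close>

lemma series_exists:
  assumes "fps_nth X 0 = fst p" "fps_nth Y 0 = snd p" "x \<in> stalk p"
  shows "\<exists>\<phi>. point_evaluation.germ p (series_at X Y) x \<phi>"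
proof -
  interpret point_evaluation p "series_at X Y" by (rule series_point_evaluation[OF assms(1,2)])
  obtain a b where ab: "poly2 b p \<noteq> 0" "x = to_fract a / to_fract b" using assms(3) by (auto simp: local_ring_def)
  have "inverse (series_at X Y b) * series_at X Y b = 1"
    using series_at_nth_0[OF assms(1,2), of b] ab(1) by (intro inverse_mult_eq_1) simp
  then have "(series_at X Y a * inverse (series_at X Y b)) * series_at X Y b = series_at X Y a"
    by (simp add: mult.assoc)
  then show ?thesis using germI[OF ab(1)] ab(2) by blast
qed

section \<open>Expansion along a line through the unit point\<close>

text \<open>The expansion at \<open>t = 0\<close> of \<open>(1 + t)^m (1 + s t)^n\<close>, the monomial with exponent
  \<open>(m, n)\<close> on the line through \<open>(1, 1)\<close> of slope \<open>s\<close>. Binomial series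
  cover negative exponents without a case distinction.\<close>

definition line_monomial :: "complex \<Rightarrow> int \<times> int \<Rightarrow> complex fps"
  where "line_monomial s c =
    fps_binomial (of_int (fst c)) * (fps_compose (fps_binomial (of_int (snd c))) (fps_const s * fps_X))"

lemma line_monomial_add: "line_monomial s (c + d) = line_monomial s c * line_monomial s d"
  by (simp add: line_monomial_def fps_binomial_add_mult fps_compose_mult_distrib mult_ac)

lemma line_monomial_0: "line_monomial s 0 = 1"
  by (simp add: line_monomial_def)

lemma fps_binomial_compose_nth:
  "fps_nth (fps_compose (fps_binomial c) (fps_const s * fps_X)) k = (c gchoose k) * s ^ k"
  by (simp add: fps_compose_linear fps_binomial_nth)

lemma line_monomial_nth:
  "fps_nth (line_monomial s c) k =
    (\<Sum>i=0..k. (of_int (fst c) gchoose i) * ((of_int (snd c) gchoose (k - i)) * s ^ (k - i)))"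
  unfolding line_monomial_def by (simp only: fps_mult_nth fps_binomial_compose_nth fps_binomial_nth)

lemma one_plus_X_compose: "fps_compose (1 + fps_X) (fps_const s * fps_X) = 1 + fps_const s * fps_X"
  for s :: complex
proof -
  have "fps_nth (fps_const s * fps_X) 0 = 0" by simp
  from fps_X_fps_compose_startby0[OF this] show ?thesis by (simp only: fps_compose_add_distrib fps_compose_1)
qed

lemma line_monomial_nat:
  "line_monomial s (int m, int n) = (1 + fps_X) ^ m * (1 + fps_const s * fps_X) ^ n"
  using fps_binomial_of_nat[of m, where 'a = complex] fps_binomial_of_nat[of n, where 'a = complex]
  by (simp add: line_monomial_def fps_compose_power[symmetric] one_plus_X_compose)

lemma line_monomial_basis: "line_monomial s (1, 0) = 1 + fps_X" "line_monomial s (0, 1) = 1 + fps_const s * fps_X"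
  using line_monomial_nat[of s 1 0] line_monomial_nat[of s 0 1] by simp_all

lemma line_monomial_nth_0: "fps_nth (line_monomial s c) 0 = 1"
  by (simp add: line_monomial_nth)

lemma one_one_torus: "(1, 1) \<in> torus" by (simp add: torus_def)

lemma monomial_eval_one: "monomial_eval a (1, 1) = 1" by (simp add: monomial_eval_def)

text \<open>The monomials at \<open>u\<close> and \<open>v\<close> serve as coordinates \<open>U\<close>, \<open>V\<close>
  of the torus, and the curve under study is the line \<open>V - 1 = s (U - 1)\<close>, parametrised by
  \<open>t = U - 1\<close>.\<close>

locale line_frame =
  fixes u v :: "int \<times> int" and s :: complex
  assumes uv: "\<bar>det2 u v\<bar> = 1"
begin

text \<open>The expansion along the line of the monomial with exponent \<open>a\<close>, where \<open>a\<close> is a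
  vector in the standard coordinates.\<close>

definition expn :: "int \<times> int \<Rightarrow> complex fps"
  where "expn a = line_monomial s (coord u v a)"

lemma expn_add: "expn (a + b) = expn a * expn b"
  by (simp add: expn_def coord_add line_monomial_add)

lemma expn_0: "expn 0 = 1" by (simp add: expn_def coord_0 line_monomial_0)

lemma expn_uv: "expn u = 1 + fps_X" "expn v = 1 + fps_const s * fps_X"
  by (simp_all add: expn_def coord_basis[OF uv] line_monomial_basis)

lemma expn_nth_0: "fps_nth (expn a) 0 = 1" by (simp add: expn_def line_monomial_nth_0)

sublocale series: point_evaluation "(1, 1)" "series_at (expn (1, 0)) (expn (0, 1))"
  by (rule series_point_evaluation) (simp_all add: expn_nth_0)

abbreviation taylor :: "ratfun \<Rightarrow> complex fps \<Rightarrow> bool" where "taylor \<equiv> series.germ"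

lemma taylor_const: "taylor (const_fun c) (fps_const c)"
  using series.germ_poly[of "[:[:c:]:]"] by (simp add: const_fun_def series_at_def map_poly_pCons)

lemma taylor_z: "taylor z1 (expn (1, 0))" "taylor z2 (expn (0, 1))"
proof -
  have 1: "map_poly (\<lambda>r. poly (map_poly fps_const r) X) [:1:] = [:1:]"
    "poly (map_poly fps_const [:0, 1:]) X = X" for X :: "complex fps"
    by (simp_all add: map_poly_pCons)
  show "taylor z1 (expn (1, 0))"
    using series.germ_poly[of "[:[:0, 1:]:]"] by (simp add: z1_def series_at_pCons 1) (simp add: series_at_def)
  show "taylor z2 (expn (0, 1))"
    using series.germ_poly[of "[:0, 1:]"] by (simp add: z2_def series_at_pCons) (simp add: series_at_def)
qed

lemma taylor_exists: "x \<in> stalk (1, 1) \<Longrightarrow> \<exists>\<phi>. taylor x \<phi>"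
  by (rule series_exists) (simp_all add: expn_nth_0)

lemma taylor_power_int:
  assumes x: "taylor x (expn a)" "x \<noteq> 0" "inverse x \<in> stalk (1, 1)"
  shows "taylor (x powi k) (expn (k * fst a, k * snd a))"
proof -
  have nat: "taylor (y ^ n) (expn (int n * fst b, int n * snd b))" if "taylor y (expn b)" for y b n
  proof (induction n)
    case 0 show ?case using series.germ_poly[of 1] expn_0 by (simp add: series_at_hom zero_prod_def)
  next
    case (Suc n)
    have "(int (Suc n) * fst b, int (Suc n) * snd b) = b + (int n * fst b, int n * snd b)"
      by (simp add: prod_eq_iff algebra_simps)
    then show ?case using series.germ_mult[OF that Suc] by (simp add: expn_add)
  qed
  show ?thesis
  proof (cases "k \<ge> 0")
    case True
    then show ?thesis using nat[OF x(1), of "nat k"] by (simp add: power_int_def)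
  next
    case False
    obtain \<psi> where \<psi>: "taylor (inverse x) \<psi>" using taylor_exists[OF x(3)] by blast
    have "expn a * \<psi> = 1" using series.germ_unit[OF x(1) \<psi>] x(2) by simp
    moreover have "expn a * expn (- a) = 1" using expn_add[of a "- a"] by (simp add: expn_0)
    ultimately have "\<psi> = expn (- a)" by (metis mult.commute mult.left_commute mult_1)
    then show ?thesis using nat[of "inverse x" "- a" "nat (- k)"] \<psi> False
      by (simp add: power_int_def)
  qed
qed

text \<open>The expansion of a monomial is known on the two standard coordinates and multiplicative; inverses are
  determined by uniqueness of expansions.\<close>

lemma taylor_monomial: "taylor (monomial_fun a) (expn a)"
proof -
  have inv: "inverse z1 \<in> stalk (1, 1)" "inverse z2 \<in> stalk (1, 1)"
    using regular_inverse[OF regular_z1, of "(1, 1)"] regular_inverse[OF regular_z2, of "(1, 1)"]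
      carrier_local_ring by auto
  have "taylor (z1 powi fst a * z2 powi snd a) (expn (fst a, 0) * expn (0, snd a))"
    using taylor_power_int[OF taylor_z(1) z_nonzero(1) inv(1), of "fst a"]
      taylor_power_int[OF taylor_z(2) z_nonzero(2) inv(2), of "snd a"]
    by (intro series.germ_mult) simp_all
  then show ?thesis by (simp add: monomial_fun_def expn_add[symmetric])
qed

text \<open>Modulo the equation of the line, the second local coordinate is a multiple of the first, so one coordinate
  suffices.\<close>

lemma stalk_along_line:
  assumes I: "const_fun s * (monomial_fun u - 1) - (monomial_fun v - 1) \<in> ideal2 (1, 1) F G"
    and x: "x \<in> stalk (1, 1)"
  shows "\<exists>c y. y \<in> stalk (1, 1) \<and> x - (const_fun c + (monomial_fun u - 1) * y) \<in> ideal2 (1, 1) F G"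
proof -
  obtain c y y' where c: "y \<in> stalk (1, 1)" "y' \<in> stalk (1, 1)"
    "x = const_fun c + (monomial_fun u - 1) * y + (monomial_fun v - 1) * y'"
    using stalk_split_basis[OF one_one_torus uv x] by (auto simp: monomial_eval_one const_fun_hom)
  have "x - (const_fun c + (monomial_fun u - 1) * (y + const_fun s * y'))
      = - ((const_fun s * (monomial_fun u - 1) - (monomial_fun v - 1)) * y')"
    unfolding c(3) by (simp add: algebra_simps)
  also have "\<dots> \<in> ideal2 (1, 1) F G" using I c(2) by (intro ideal2_uminus ideal2_closed(2))
  finally show ?thesis using c by (meson stalk_closed)
qed

end

section \<open>Contact of order three with a line\<close>

context line_frame
begin

text \<open>Modulo the line \<open>F\<close> every germ is a polynomial of degree two in the coordinate
  \<open>T = U - 1\<close> plus a multiple of the cube of \<open>T\<close>. Comparing expansions, contact of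
  order exactly three says that \<open>G\<close> is the cube of \<open>T\<close> times a unit. Hence
  \<open>1\<close>, \<open>T\<close> and the square of \<open>T\<close> span the quotient; they are
  independent because every element of the ideal has an expansion starting at order three.\<close>

proposition contact_gives_dimension_three:
  assumes F: "F \<in> stalk (1, 1)" and G: "G \<in> stalk (1, 1)"
    and I: "const_fun s * (monomial_fun u - 1) - (monomial_fun v - 1) \<in> ideal2 (1, 1) F 0"
    and tF: "taylor F 0" and tG: "taylor G \<phi>"
    and \<phi>: "fps_nth \<phi> 0 = 0" "fps_nth \<phi> 1 = 0" "fps_nth \<phi> 2 = 0" "fps_nth \<phi> 3 \<noteq> 0"
  shows "ring.dimension (local_ring (1, 1) Quot ideal2 (1, 1) F G) 3
    (range (\<lambda>c. ideal2 (1, 1) F G +>\<^bsub>local_ring (1, 1)\<^esub> const_fun c))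
    (carrier (local_ring (1, 1) Quot ideal2 (1, 1) F G))"
proof -
  let ?O = "stalk (1, 1)" and ?I = "ideal2 (1, 1) F G" and ?J = "ideal2 (1, 1) F 0"
  define T where "T = monomial_fun u - 1"
  have T: "T \<in> ?O" unfolding T_def by (intro stalk_closed one_one_torus)
  have tT: "taylor T fps_X"
  proof -
    have "taylor (monomial_fun u + const_fun (-1)) (expn u + fps_const (-1))"
      by (intro series.germ_add taylor_monomial taylor_const)
    moreover have "fps_const (- 1) = (- 1 :: complex fps)" by (simp add: fps_eq_iff)
    ultimately show ?thesis by (simp add: T_def expn_uv const_fun_uminus const_fun_hom)
  qed
  have step: "\<exists>c y. y \<in> ?O \<and> x - (const_fun c + T * y) \<in> ?J" if "x \<in> ?O" for x
    using stalk_along_line[OF I that] unfolding T_def by blast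
  have expand: "\<exists>c1 c2 c3 y. y \<in> ?O \<and> x - (const_fun c1 + const_fun c2 * T + const_fun c3 * T\<^sup>2 + T ^ 3 * y) \<in> ?J"
    if x: "x \<in> ?O" for x
  proof -
    obtain c1 y1 where 1: "y1 \<in> ?O" "x - (const_fun c1 + T * y1) \<in> ?J" using step[OF x] by blast
    obtain c2 y2 where 2: "y2 \<in> ?O" "y1 - (const_fun c2 + T * y2) \<in> ?J" using step[OF 1(1)] by blast
    obtain c3 y3 where 3: "y3 \<in> ?O" "y2 - (const_fun c3 + T * y3) \<in> ?J" using step[OF 2(1)] by blast
    have "(x - (const_fun c1 + T * y1)) + T * (y1 - (const_fun c2 + T * y2)) + (T * T) * (y2 - (const_fun c3 + T * y3)) \<in> ?J"
      by (intro ideal2_closed(1) ideal2_closed(3) 1(2) 2(2) 3(2) T stalk_mult)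
    moreover have "(x - (const_fun c1 + T * y1)) + T * (y1 - (const_fun c2 + T * y2)) + (T * T) * (y2 - (const_fun c3 + T * y3))
        = x - (const_fun c1 + const_fun c2 * T + const_fun c3 * T\<^sup>2 + T ^ 3 * y3)"
      by (simp add: algebra_simps power2_eq_square power3_eq_cube)
    ultimately show ?thesis using 3(1) by auto
  qed
  (* The expansion of an element of the ideal is a multiple of that of G. *)
  have low: "fps_nth \<xi> 0 = 0 \<and> fps_nth \<xi> 1 = 0 \<and> fps_nth \<xi> 2 = 0" if x: "x \<in> ?I" "taylor x \<xi>" for x \<xi>
  proof -
    obtain a b where ab: "a \<in> ?O" "b \<in> ?O" "x = F * a + G * b" using x(1) unfolding ideal2_def by blast
    obtain \<alpha> \<beta> where "taylor a \<alpha>" "taylor b \<beta>" using taylor_exists ab by blast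
    then have "taylor x (0 * \<alpha> + \<phi> * \<beta>)" unfolding ab(3) by (intro series.germ_add series.germ_mult tF tG)
    then have "\<xi> = \<phi> * \<beta>" using series.germ_unique[OF x(2)] by simp
    then show ?thesis using \<phi> by (simp add: fps_mult_nth numeral_2_eq_2)
  qed
  have taylor3: "taylor (const_fun c1 + const_fun c2 * T + const_fun c3 * T\<^sup>2)
      (fps_const c1 + fps_const c2 * fps_X + fps_const c3 * fps_X\<^sup>2)" for c1 c2 c3
    by (intro series.germ_add series.germ_mult series.germ_power taylor_const tT)
  have JI: "?J \<subseteq> ?I"
  proof
    fix x assume "x \<in> ?J"
    then obtain a where "a \<in> ?O" "x = F * a + G * 0" unfolding ideal2_def by auto
    then show "x \<in> ?I" unfolding ideal2_def using stalk_0 by blast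
  qed
  obtain c1 c2 c3 y where g: "y \<in> ?O" "G - (const_fun c1 + const_fun c2 * T + const_fun c3 * T\<^sup>2 + T ^ 3 * y) \<in> ?J"
    using expand[OF G] by blast
  (* One further step isolates c4, the order-three coefficient of G. *)
  obtain c4 y4 where y: "y4 \<in> ?O" "y - (const_fun c4 + T * y4) \<in> ?J" using step[OF g(1)] by blast
  (* E is the unit in G = T^3 E modulo the line. *)
  define E where "E = const_fun c4 + T * y4"
  define P where "P = const_fun c1 + const_fun c2 * T + const_fun c3 * T\<^sup>2 + T ^ 3 * E"
  obtain \<psi> where \<psi>: "taylor y4 \<psi>" using taylor_exists[OF y(1)] by blast
  have T3: "T ^ 3 \<in> ?O" using T by (simp add: power3_eq_cube stalk_mult)
  have GP: "G - P \<in> ?J"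
  proof -
    have "(G - (const_fun c1 + const_fun c2 * T + const_fun c3 * T\<^sup>2 + T ^ 3 * y)) + T ^ 3 * (y - (const_fun c4 + T * y4)) \<in> ?J"
      by (intro ideal2_closed(1) ideal2_closed(3) g y T3)
    then show ?thesis by (simp add: P_def E_def algebra_simps)
  qed
  have "\<phi> = fps_const c1 + fps_const c2 * fps_X + fps_const c3 * fps_X\<^sup>2 + fps_X ^ 3 * (fps_const c4 + fps_X * \<psi>)"
  proof -
    have tP: "taylor P (fps_const c1 + fps_const c2 * fps_X + fps_const c3 * fps_X\<^sup>2 + fps_X ^ 3 * (fps_const c4 + fps_X * \<psi>))"
      unfolding P_def E_def
      by (intro series.germ_add[OF taylor3] series.germ_add series.germ_mult series.germ_power taylor_const tT \<psi>)
    obtain a where a: "a \<in> ?O" "G - P = F * a" using GP unfolding ideal2_def by auto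
    obtain \<alpha> where "taylor a \<alpha>" using taylor_exists[OF a(1)] by blast
    then have "taylor (P + F * a) (fps_const c1 + fps_const c2 * fps_X + fps_const c3 * fps_X\<^sup>2 + fps_X ^ 3 * (fps_const c4 + fps_X * \<psi>) + 0 * \<alpha>)"
      by (intro series.germ_add[OF tP] series.germ_mult tF)
    moreover have "P + F * a = G" using a(2) by (simp add: algebra_simps)
    ultimately show ?thesis using series.germ_unique[OF tG] by simp
  qed
  then have nth: "fps_nth \<phi> k = fps_nth (fps_const c1 + fps_const c2 * fps_X + fps_const c3 * fps_X\<^sup>2
      + fps_X ^ 3 * (fps_const c4 + fps_X * \<psi>)) k" for k by simp
  have c: "c1 = 0" "c2 = 0" "c3 = 0" "c4 \<noteq> 0"
    using nth[of 0] nth[of 1] nth[of 2] nth[of 3] \<phi> by (simp_all add: fps_X_power_mult_nth)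
  have "regular (1, 1) T (1 - 1)"
    using pv.germ_add[OF regular_monomial[OF one_one_torus, of u] regular_const[where c = "-1"]]
    by (simp add: T_def monomial_eval_one const_fun_uminus const_fun_hom)
  moreover obtain d where "regular (1, 1) y4 d" using y(1) carrier_local_ring by blast
  ultimately have "regular (1, 1) E (c4 + (1 - 1) * d)"
    unfolding E_def by (intro pv.germ_add pv.germ_mult regular_const)
  then have E: "regular (1, 1) E c4" by simp
  have "inverse E \<in> ?O" using regular_inverse[OF E c(4)] carrier_local_ring by blast
  have "E \<noteq> 0"
  proof
    assume "E = 0"
    then have "c4 = 0" using pv.germ_unique[OF E, of 0] regular_const[where c = 0] by (simp add: const_fun_hom)
    then show False using c(4) by simp
  qed
  have "P = G - (G - P)" by simp
  moreover have "G - (G - P) \<in> ?I" using GP JI ideal2_closed(5) by (blast intro: ideal2_diff)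
  ultimately have "T ^ 3 * E \<in> ?I" using c by (simp add: P_def const_fun_hom)
  then have "T ^ 3 * E * inverse E \<in> ?I" using \<open>inverse E \<in> ?O\<close> by (rule ideal2_closed(2))
  moreover have "T ^ 3 * E * inverse E = T ^ 3" using \<open>E \<noteq> 0\<close> by (simp add: mult.assoc)
  ultimately have TI: "T ^ 3 \<in> ?I" by metis
  show ?thesis
  proof (rule dimension_three_of_basis[OF ideal_ideal2[OF F G] stalk_1 T])
    show "T\<^sup>2 \<in> ?O" using T by (simp add: power2_eq_square stalk_mult)
    fix x assume "x \<in> ?O"
    then obtain d1 d2 d3 w where w: "w \<in> ?O"
      "x - (const_fun d1 + const_fun d2 * T + const_fun d3 * T\<^sup>2 + T ^ 3 * w) \<in> ?J"
      using expand by blast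
    have "x - (const_fun d1 + const_fun d2 * T + const_fun d3 * T\<^sup>2 + T ^ 3 * w) + T ^ 3 * w \<in> ?I"
      using w JI TI by (intro ideal2_closed(1)) (auto intro: ideal2_closed(2))
    then have "x - (const_fun d1 * 1 + const_fun d2 * T + const_fun d3 * T\<^sup>2) \<in> ?I"
      by (simp add: algebra_simps)
    then show "\<exists>d1 d2 d3. x - (const_fun d1 * 1 + const_fun d2 * T + const_fun d3 * T\<^sup>2) \<in> ?I" by blast
  next
    fix d1 d2 d3 assume "const_fun d1 * 1 + const_fun d2 * T + const_fun d3 * T\<^sup>2 \<in> ?I"
    then have "const_fun d1 + const_fun d2 * T + const_fun d3 * T\<^sup>2 \<in> ?I" by simp
    from low[OF this taylor3] show "d1 = 0 \<and> d2 = 0 \<and> d3 = 0"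
      by (simp add: fps_X_power_nth)
  qed
qed

end

text \<open>A torus point is determined by the values of a unimodular pair of monomials.\<close>

lemma finite_torus_fibre:
  assumes uv: "\<bar>det2 u v\<bar> = 1" and S: "S \<subseteq> torus"
    and fin: "finite ((\<lambda>q. (monomial_eval u q, monomial_eval v q)) ` S)"
  shows "finite S"
proof (rule finite_imageD[OF fin])
  show "inj_on (\<lambda>q. (monomial_eval u q, monomial_eval v q)) S"
  proof (rule inj_onI)
    fix q q' assume q: "q \<in> S" "q' \<in> S"
      and eq: "(monomial_eval u q, monomial_eval v q) = (monomial_eval u q', monomial_eval v q')"
    have t: "q \<in> torus" "q' \<in> torus" using q S by auto
    have "monomial_eval a q = monomial_eval a q'" for a
      using monomial_eval_lattice[OF t(1), of u v "coord u v a"]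
        monomial_eval_lattice[OF t(2), of u v "coord u v a"] eq lattice_map_coord[OF uv, of a] by auto
    from this[of "(1, 0)"] this[of "(0, 1)"] show "q = q'" by (simp add: monomial_eval_def prod_eq_iff)
  qed
qed

lemma finite_isolated:
  fixes S :: "(complex \<times> complex) set"
  assumes "finite S" "p \<in> S" shows "p isolated_in S"
  using assms by (simp add: isolated_in_islimpt_iff islimpt_finite)

context line_frame
begin

lemma fps_of_poly_linear_power: "fps_of_poly ([:1, c:] ^ n) = (1 + fps_const c * fps_X) ^ n"
  for c :: complex
  by (simp add: fps_of_poly_power fps_of_poly_pCons mult.commute)

text \<open>After multiplication by a high power of \<open>U V\<close> the restriction of the second equation to the line
  becomes a polynomial in \<open>t\<close>, nonzero because its expansion is. It has finitely many zeros, and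
  \<open>t\<close> determines the point.\<close>

lemma line_solutions_finite:
  fixes \<beta> :: "int \<times> int \<Rightarrow> complex"
  assumes B: "finite B" and nz: "(\<Sum>b\<in>B. fps_const (\<beta> b) * expn b) \<noteq> 0"
  shows "finite {q \<in> torus. monomial_eval v q = 1 + s * (monomial_eval u q - 1) \<and>
    (\<Sum>b\<in>B. \<beta> b * monomial_eval b q) = 0}" (is "finite ?S")
proof -
  let ?m = "\<lambda>b. fst (coord u v b)" and ?n = "\<lambda>b. snd (coord u v b)"
  (* A common shift that makes all exponents nonnegative. *)
  define N where "N = (\<Sum>b\<in>B. \<bar>?m b\<bar> + \<bar>?n b\<bar>)"
  have N: "0 \<le> ?m b + N" "0 \<le> ?n b + N" if "b \<in> B" for b
  proof -
    have "\<bar>?m b\<bar> + \<bar>?n b\<bar> \<le> N" unfolding N_def using B that by (intro member_le_sum) auto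
    then show "0 \<le> ?m b + N" "0 \<le> ?n b + N" by linarith+
  qed
  define Q where "Q = (\<Sum>b\<in>B. [:\<beta> b:] * ([:1, 1:] ^ nat (?m b + N) * [:1, s:] ^ nat (?n b + N)))"
  have "fps_of_poly Q = (\<Sum>b\<in>B. fps_const (\<beta> b) * line_monomial s (?m b + N, ?n b + N))"
  proof -
    have "fps_of_poly ([:\<beta> b:] * ([:1, 1:] ^ nat (?m b + N) * [:1, s:] ^ nat (?n b + N)))
        = fps_const (\<beta> b) * line_monomial s (?m b + N, ?n b + N)" if "b \<in> B" for b
      using line_monomial_nat[of s "nat (?m b + N)" "nat (?n b + N)"] N[OF that]
        fps_of_poly_linear_power[of 1 "nat (?m b + N)"] fps_of_poly_linear_power[of s "nat (?n b + N)"]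
      by (simp only: fps_of_poly_mult fps_of_poly_const int_nat_eq if_True fps_const_1_eq_1 mult_1)
    then show ?thesis unfolding Q_def fps_of_poly_sum by (intro sum.cong) auto
  qed
  also have "\<dots> = line_monomial s (N, N) * (\<Sum>b\<in>B. fps_const (\<beta> b) * expn b)"
  proof -
    have "line_monomial s (?m b + N, ?n b + N) = line_monomial s (N, N) * expn b" for b
      using line_monomial_add[of s "(N, N)" "coord u v b"] by (simp add: expn_def plus_prod_def add.commute)
    then show ?thesis by (simp add: sum_distrib_left mult_ac)
  qed
  finally have eqQ: "fps_of_poly Q = line_monomial s (N, N) * (\<Sum>b\<in>B. fps_const (\<beta> b) * expn b)" .
  have "line_monomial s (N, N) \<noteq> 0" using line_monomial_nth_0[of s "(N, N)"] by auto
  then have "fps_of_poly Q \<noteq> 0" unfolding eqQ using nz by simp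
  then have "Q \<noteq> 0" by auto
  then have fin: "finite {t. poly Q t = 0}" by (rule poly_roots_finite)
  show ?thesis
  proof (rule finite_torus_fibre[OF uv])
    show "?S \<subseteq> torus" by auto
    have "(\<lambda>q. (monomial_eval u q, monomial_eval v q)) ` ?S \<subseteq> (\<lambda>t. (1 + t, 1 + s * t)) ` {t. poly Q t = 0}"
    proof
      fix x assume "x \<in> (\<lambda>q. (monomial_eval u q, monomial_eval v q)) ` ?S"
      then obtain q where q: "q \<in> torus" "monomial_eval v q = 1 + s * (monomial_eval u q - 1)"
        "(\<Sum>b\<in>B. \<beta> b * monomial_eval b q) = 0" "x = (monomial_eval u q, monomial_eval v q)" by auto
      let ?U = "monomial_eval u q" and ?V = "monomial_eval v q"
      define t where "t = ?U - 1"
      have UV: "1 + t = ?U" "1 + t * s = ?V" using q(2) by (simp_all add: t_def mult.commute)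
      have nz: "?U \<noteq> 0" "?V \<noteq> 0" using monomial_eval_nz[OF q(1)] by auto
      have "poly ([:1, 1:] ^ nat (?m b + N) * [:1, s:] ^ nat (?n b + N)) t = ?U powi N * ?V powi N * monomial_eval b q"
        if "b \<in> B" for b
      proof -
        have "poly ([:1, 1:] ^ nat (?m b + N) * [:1, s:] ^ nat (?n b + N)) t = ?U ^ nat (?m b + N) * ?V ^ nat (?n b + N)"
          by (simp add: UV)
        also have "\<dots> = ?U powi (?m b + N) * ?V powi (?n b + N)" using N[OF that] by (simp add: power_int_def)
        also have "\<dots> = ?U powi N * ?V powi N * (?U powi ?m b * ?V powi ?n b)" using nz by (simp add: power_int_add)
        also have "?U powi ?m b * ?V powi ?n b = monomial_eval b q"
          using monomial_eval_lattice[OF q(1), of u v "coord u v b"] lattice_map_coord[OF uv, of b] by simp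
        finally show ?thesis .
      qed
      then have "poly Q t = (\<Sum>b\<in>B. \<beta> b * (?U powi N * ?V powi N * monomial_eval b q))"
        unfolding Q_def poly_sum by (intro sum.cong) (auto simp del: mult_pCons_left poly_mult simp: poly_mult[of "[:_:]"])
      also have "\<dots> = ?U powi N * ?V powi N * (\<Sum>b\<in>B. \<beta> b * monomial_eval b q)"
        by (simp add: sum_distrib_left mult_ac)
      finally have "poly Q t = 0" using q(3) by simp
      then show "x \<in> (\<lambda>t. (1 + t, 1 + s * t)) ` {t. poly Q t = 0}"
        unfolding q(4) using UV by (auto simp: mult.commute intro!: image_eqI[of _ _ t])
    qed
    then show "finite ((\<lambda>q. (monomial_eval u q, monomial_eval v q)) ` ?S)"
      by (rule finite_subset) (use fin in auto)
  qed
qed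

text \<open>The first polynomial is the line, shifted by \<open>a\<close> into the support; the second has the given
  coefficients. The unit point is isolated because the whole solution set is finite.\<close>

proposition contact_root:
  assumes A: "{a, a + u, a + v} \<subseteq> A" and B: "finite B" 
    and \<phi>: "\<phi> = (\<Sum>b\<in>B. fps_const (\<beta> b) * expn b)"
      "fps_nth \<phi> 0 = 0" "fps_nth \<phi> 1 = 0" "fps_nth \<phi> 2 = 0" "fps_nth \<phi> 3 \<noteq> 0"
  shows "can_have_root_of_multiplicity A B 3"
proof -
  define f :: laurent where "f = Poly_Mapping.single (a + u) s - Poly_Mapping.single (a + v) 1
    + Poly_Mapping.single a (1 - s)"
  define g :: laurent where "g = (\<Sum>b\<in>B. Poly_Mapping.single b (\<beta> b))"
  (* f is z^a (s (U - 1) - (V - 1)). *)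
  have fA: "f \<in> laurent_space A"
  proof -
    have "Poly_Mapping.keys f \<subseteq> {a, a + u, a + v}"
      unfolding f_def using keys_add keys_diff by (fastforce split: if_splits)
    then show ?thesis using A by (auto simp: laurent_space_def)
  qed
  have gB: "g \<in> laurent_space B"
  proof -
    have "Poly_Mapping.lookup g k = 0" if "k \<notin> B" for k
      unfolding g_def lookup_sum using that by (intro sum.neutral) (auto simp: lookup_single when_def)
    then show ?thesis by (auto simp: laurent_space_def in_keys_iff)
  qed
  have evf: "laurent_eval f q = monomial_eval a q * (s * (monomial_eval u q - 1) - (monomial_eval v q - 1))"
    if "q \<in> torus" for q
    unfolding f_def by (simp add: laurent_eval_hom[OF that] monomial_eval_add[OF that] algebra_simps)
  have evg: "laurent_eval g q = (\<Sum>b\<in>B. \<beta> b * monomial_eval b q)" if "q \<in> torus" for q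
  proof -
    have "laurent_eval (\<Sum>b\<in>C. Poly_Mapping.single b (\<beta> b)) q = (\<Sum>b\<in>C. \<beta> b * monomial_eval b q)" for C
      by (induction C rule: infinite_finite_induct) (auto simp: laurent_eval_hom[OF that])
    then show ?thesis unfolding g_def .
  qed
  have ff: "laurent_fun f = monomial_fun a * (const_fun s * (monomial_fun u - 1) - (monomial_fun v - 1))"
    unfolding f_def laurent_fun_ev
    by (simp add: lf.ev_add lf.ev_diff monomial_fun_add const_fun_hom const_fun_diff algebra_simps)
  have fg: "laurent_fun g = (\<Sum>b\<in>B. const_fun (\<beta> b) * monomial_fun b)"
    unfolding g_def laurent_fun_ev by (simp add: lf.ev_sum)
  have mem: "laurent_fun f \<in> stalk (1, 1)" "laurent_fun g \<in> stalk (1, 1)"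
    by (intro stalk_closed one_one_torus)+
  have tg: "taylor (laurent_fun g) \<phi>"
    unfolding fg \<phi>(1) by (intro series.germ_sum B series.germ_mult taylor_const taylor_monomial)
  have tf: "taylor (laurent_fun f) 0"
  proof -
    have "taylor (monomial_fun a * (const_fun s * (monomial_fun u + const_fun (-1)) + const_fun (-1) * (monomial_fun v + const_fun (-1))))
        (expn a * (fps_const s * (expn u + fps_const (-1)) + fps_const (-1) * (expn v + fps_const (-1))))"
      by (intro series.germ_add series.germ_mult taylor_const taylor_monomial)
    moreover have m1: "fps_const (- 1) = (- 1 :: complex fps)" by (simp add: fps_eq_iff)
    have "fps_const s * (expn u + fps_const (-1)) + fps_const (-1) * (expn v + fps_const (-1)) = 0"
      unfolding m1 expn_uv by simp
    moreover have eq: "const_fun s * (monomial_fun u - 1) - (monomial_fun v - 1)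
        = const_fun s * (monomial_fun u + const_fun (-1)) + const_fun (-1) * (monomial_fun v + const_fun (-1))"
      by (simp add: const_fun_uminus const_fun_hom)
    ultimately show ?thesis unfolding ff eq by (simp only: mult_zero_right)
  qed
  have I: "const_fun s * (monomial_fun u - 1) - (monomial_fun v - 1) \<in> ideal2 (1, 1) (laurent_fun f) 0"
  proof -
    have "monomial_fun (- a) * laurent_fun f \<in> ideal2 (1, 1) (laurent_fun f) 0"
      by (intro ideal2_closed(3,4) stalk_closed one_one_torus)
    moreover have "monomial_fun (- a) * monomial_fun a = 1" using monomial_fun_add[of "- a" a] by simp
    ultimately show ?thesis unfolding ff by (simp add: mult.assoc[symmetric])
  qed
  have dim: "intersection_multiplicity (1, 1) f g 3"
    unfolding intersection_multiplicity_def quotient_ring_def quotient_constants_def system_ideal_eq[OF one_one_torus]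
    by (rule contact_gives_dimension_three[OF mem I tf tg \<phi>(2-)])
  have "solutions f g \<subseteq> {q \<in> torus. monomial_eval v q = 1 + s * (monomial_eval u q - 1) \<and>
      (\<Sum>b\<in>B. \<beta> b * monomial_eval b q) = 0}"
  proof
    fix q assume "q \<in> solutions f g"
    then have q: "q \<in> torus" "laurent_eval f q = 0" "laurent_eval g q = 0" by (auto simp: solutions_def)
    have "s * (monomial_eval u q - 1) - (monomial_eval v q - 1) = 0"
      using q(2) evf[OF q(1)] monomial_eval_nz[OF q(1)] by simp
    then have "monomial_eval v q = 1 + s * (monomial_eval u q - 1)" by (simp add: algebra_simps)
    then show "q \<in> {q \<in> torus. monomial_eval v q = 1 + s * (monomial_eval u q - 1) \<and>
        (\<Sum>b\<in>B. \<beta> b * monomial_eval b q) = 0}" using q evg by simp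
  qed
  moreover have "\<phi> \<noteq> 0" using \<phi>(5) by auto
  ultimately have "finite (solutions f g)"
    using line_solutions_finite[OF B, of \<beta>] \<phi>(1) finite_subset by blast
  moreover have "(1, 1) \<in> solutions f g"
  proof -
    have "fps_nth \<phi> 0 = (\<Sum>b\<in>B. \<beta> b)" unfolding \<phi>(1) by (simp add: fps_sum_nth expn_nth_0)
    then show ?thesis using \<phi>(2) one_one_torus
      by (simp add: solutions_def evf evg monomial_eval_one)
  qed
  ultimately have "(1, 1) \<in> roots f g" by (simp add: roots_def finite_isolated)
  then show ?thesis
    unfolding can_have_root_of_multiplicity_def root_of_multiplicity_def using fA gB dim by blast
qed

end

lemma can_have_root_mono:
  assumes "can_have_root_of_multiplicity A B n" "A \<subseteq> A'" "B \<subseteq> B'"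
  shows "can_have_root_of_multiplicity A' B' n"
  using assms unfolding can_have_root_of_multiplicity_def laurent_space_def by blast

definition contact3 :: "complex fps \<Rightarrow> bool"
  where "contact3 \<phi> \<longleftrightarrow> fps_nth \<phi> 0 = 0 \<and> fps_nth \<phi> 1 = 0 \<and> fps_nth \<phi> 2 = 0 \<and> fps_nth \<phi> 3 \<noteq> 0"

lemma contact3_unit_mult:
  assumes "contact3 \<phi>" "fps_nth e 0 = 1" shows "contact3 (e * \<phi>)"
  using assms by (simp add: contact3_def fps_mult_nth numeral_2_eq_2 numeral_3_eq_3)

text \<open>The same criterion with exponents given in coordinates with respect to \<open>b\<close>, \<open>u\<close>,
  \<open>v\<close>. The translation by \<open>b\<close> multiplies the expansion by a unit with constant term
  one, which does not affect the order of contact.\<close>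

proposition contact_root_coord:
  assumes uv: "\<bar>det2 u v\<bar> = 1" and A: "{a, a + u, a + v} \<subseteq> A"
    and C: "finite C" "lattice_map b u v ` C \<subseteq> B"
    and contact: "contact3 (\<Sum>c\<in>C. fps_const (\<beta> c) * line_monomial s c)"
  shows "can_have_root_of_multiplicity A B 3"
proof -
  interpret line_frame u v s by unfold_locales (rule uv)
  define \<beta>' where "\<beta>' x = \<beta> (coord u v (x - b))" for x
  have lm: "coord u v (lattice_map b u v c - b) = c" for c
    using coord_lattice_map[OF uv, of c] lattice_map_translate[of b u v c] by simp
  have inj: "inj_on (lattice_map b u v) C" by (rule inj_onI) (metis lm)
  have ex: "expn (lattice_map b u v c) = expn b * line_monomial s c" for c
    unfolding lattice_map_translate[of b] expn_add by (simp add: expn_def coord_lattice_map[OF uv])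
  have "(\<Sum>x\<in>lattice_map b u v ` C. fps_const (\<beta>' x) * expn x)
      = (\<Sum>c\<in>C. fps_const (\<beta> c) * (expn b * line_monomial s c))"
    by (simp add: sum.reindex[OF inj] \<beta>'_def lm ex)
  also have "\<dots> = expn b * (\<Sum>c\<in>C. fps_const (\<beta> c) * line_monomial s c)"
    by (simp add: sum_distrib_left mult_ac)
  finally have eq: "(\<Sum>x\<in>lattice_map b u v ` C. fps_const (\<beta>' x) * expn x)
      = expn b * (\<Sum>c\<in>C. fps_const (\<beta> c) * line_monomial s c)" .
  have "contact3 (\<Sum>x\<in>lattice_map b u v ` C. fps_const (\<beta>' x) * expn x)"
    unfolding eq by (rule contact3_unit_mult[OF contact expn_nth_0])
  then have "can_have_root_of_multiplicity A (lattice_map b u v ` C) 3"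
    unfolding contact3_def using C(1) by (intro contact_root[OF A _ refl]) auto
  then show ?thesis using can_have_root_mono C(2) by blast
qed

lemma gchoose_low:
  "(x gchoose 0) = 1" "(x gchoose 1) = x" "2 * (x gchoose 2) = x * (x - 1)" "6 * (x gchoose 3) = x * (x - 1) * (x - 2)"
  for x :: complex
  by (simp_all add: gbinomial_prod_rev numeral_2_eq_2 numeral_3_eq_3 atLeast0_lessThan_Suc fact_numeral)

text \<open>The logarithm of \<open>(1 + t)^m (1 + s t)^n\<close> has the coefficients \<open>m + n s^j\<close> up to sign
  and the factor \<open>1 / j\<close>. The first Taylor coefficients are therefore these polynomials in the
  numbers \<open>m + n s^j\<close>, as in Newton's identities.\<close>

lemma line_monomial_low:
  fixes c :: "int \<times> int"
  defines "m \<equiv> of_int (fst c) :: complex" and "n \<equiv> of_int (snd c) :: complex"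
  shows "fps_nth (line_monomial s c) 0 = 1"
    and "fps_nth (line_monomial s c) 1 = m + n * s"
    and "2 * fps_nth (line_monomial s c) 2 = (m + n * s)\<^sup>2 - (m + n * s\<^sup>2)"
    and "6 * fps_nth (line_monomial s c) 3 =
      (m + n * s) ^ 3 - 3 * (m + n * s) * (m + n * s\<^sup>2) + 2 * (m + n * s ^ 3)"
proof -
  show "fps_nth (line_monomial s c) 0 = 1" by (rule line_monomial_nth_0)
  show "fps_nth (line_monomial s c) 1 = m + n * s"
    unfolding line_monomial_nth m_def n_def by (simp add: gchoose_low)
  have "2 * fps_nth (line_monomial s c) 2 = 2 * (n gchoose 2) * s\<^sup>2 + 2 * m * n * s + 2 * (m gchoose 2)"
    unfolding line_monomial_nth m_def[symmetric] n_def[symmetric]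
    by (simp add: numeral_2_eq_2 algebra_simps)
  then show "2 * fps_nth (line_monomial s c) 2 = (m + n * s)\<^sup>2 - (m + n * s\<^sup>2)"
    unfolding gchoose_low by (simp add: algebra_simps power2_eq_square)
  have "6 * fps_nth (line_monomial s c) 3 = 6 * (n gchoose 3) * s ^ 3 + 3 * m * (2 * (n gchoose 2)) * s\<^sup>2
      + 3 * (2 * (m gchoose 2)) * n * s + 6 * (m gchoose 3)"
    unfolding line_monomial_nth m_def[symmetric] n_def[symmetric]
    by (simp add: numeral_2_eq_2 numeral_3_eq_3 algebra_simps)
  then show "6 * fps_nth (line_monomial s c) 3 =
      (m + n * s) ^ 3 - 3 * (m + n * s) * (m + n * s\<^sup>2) + 2 * (m + n * s ^ 3)"
    unfolding gchoose_low by (simp add: algebra_simps power2_eq_square power3_eq_cube)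
qed

section \<open>Elimination and isolated zeros\<close>

text \<open>One equation in two variables has no isolated zero. Either it vanishes on the fibre over \<open>x0\<close>, or
  by Hurwitz's theorem the zero on that fibre persists on the nearby fibres over \<open>X n\<close>.\<close>

lemma laurent_zero_not_isolated:
  fixes e :: laurent
  assumes p: "p \<in> torus" "laurent_eval e p = 0"
  shows "\<not> p isolated_in {q \<in> torus. laurent_eval e q = 0}" (is "\<not> p isolated_in ?Z")
proof
  assume "p isolated_in ?Z"
  then obtain \<epsilon> where \<epsilon>: "\<epsilon> > 0" "\<And>q. q \<in> ?Z \<Longrightarrow> dist p q < \<epsilon> \<Longrightarrow> q = p"
    unfolding isolated_in_dist_Ex_iff by blast
  obtain x0 y0 where xy: "p = (x0, y0)" by (cases p)
  have nz: "x0 \<noteq> 0" "y0 \<noteq> 0" using p(1) by (auto simp: xy torus_def)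
  (* A polydisc of this radius avoids the coordinate axes and lies in the isolating ball. *)
  define \<delta> where "\<delta> = Min {\<epsilon> / 2, cmod x0 / 2, cmod y0 / 2}"
  have \<delta>: "\<delta> > 0" "\<delta> \<le> \<epsilon> / 2" "\<delta> \<le> cmod x0 / 2" "\<delta> \<le> cmod y0 / 2" using \<epsilon>(1) nz by (auto simp: \<delta>_def)
  have tor: "(x, y) \<in> torus" if "dist x0 x \<le> \<delta>" "dist y0 y \<le> \<delta>" for x y
  proof -
    have "x \<noteq> 0" using that(1) \<delta> nz by auto
    moreover have "y \<noteq> 0" using that(2) \<delta> nz by auto
    ultimately show ?thesis by (simp add: torus_def)
  qed
  have only: "x = x0 \<and> y = y0" if "dist x0 x < \<delta>" "dist y0 y < \<delta>" "laurent_eval e (x, y) = 0" for x y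
  proof -
    have "dist p (x, y) \<le> dist x0 x + dist y0 y"
      unfolding xy dist_prod_def using sqrt_sum_squares_le_sum[of "dist x0 x" "dist y0 y"] by simp
    then have "dist p (x, y) < \<epsilon>" using that \<delta> by linarith
    then show ?thesis using \<epsilon>(2)[of "(x, y)"] tor[of x y] that by (auto simp: xy)
  qed
  (* Nearby fibres, on which isolation leaves no zero at all. *)
  define X where "X n = x0 + complex_of_real (\<delta> / (real n + 2))" for n :: nat
  have X: "dist x0 (X n) < \<delta>" "X n \<noteq> x0" for n
  proof -
    have "0 < \<delta> + \<delta> * real n" using \<delta>(1) by (intro add_pos_nonneg) auto
    then have "0 < \<delta> / (real n + 2)" "\<delta> / (real n + 2) < \<delta>"
      using \<delta>(1) by (simp_all add: divide_less_eq distrib_left)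
    then show "dist x0 (X n) < \<delta>" "X n \<noteq> x0"
      by (auto simp: X_def dist_norm simp del: of_real_divide)
  qed
  have Xlim: "X \<longlonglongrightarrow> x0"
  proof -
    have "(\<lambda>n. \<delta> / (real n + 2)) \<longlonglongrightarrow> 0" by real_asymp
    then have "(\<lambda>n. complex_of_real (\<delta> / (real n + 2))) \<longlonglongrightarrow> complex_of_real 0" by (rule tendsto_of_real)
    then show ?thesis unfolding X_def using tendsto_add[OF tendsto_const[of x0]] by fastforce
  qed
  let ?S = "ball y0 \<delta>"
  have contK: "continuous_on (cball x0 \<delta> \<times> cball y0 \<delta>) (laurent_eval e)"
    unfolding laurent_eval_def
    by (intro continuous_intros) (use tor in \<open>auto simp: torus_def\<close>)
  have hol: "(\<lambda>y. laurent_eval e (x, y)) holomorphic_on ?S" if x: "dist x0 x \<le> \<delta>" for x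
  proof -
    have "x \<noteq> 0" using tor[OF x, of y0] \<delta>(1) by (simp add: torus_def)
    then show ?thesis
      unfolding laurent_eval_def
      by (intro holomorphic_intros) (use tor[OF x] in \<open>auto simp: torus_def\<close>)
  qed
  have unif: "uniform_limit K (\<lambda>n y. laurent_eval e (X n, y)) (\<lambda>y. laurent_eval e (x0, y)) sequentially"
    if K: "compact K" "K \<subseteq> ?S" for K
  proof (rule uniform_limitI)
    fix \<eta> :: real assume "\<eta> > 0"
    have "uniformly_continuous_on (cball x0 \<delta> \<times> cball y0 \<delta>) (laurent_eval e)"
      by (intro compact_uniformly_continuous contK compact_Times) auto
    then obtain \<rho> where \<rho>: "\<rho> > 0" "\<And>q q'. q \<in> cball x0 \<delta> \<times> cball y0 \<delta> \<Longrightarrow> q' \<in> cball x0 \<delta> \<times> cball y0 \<delta> \<Longrightarrow>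
        dist q' q < \<rho> \<Longrightarrow> dist (laurent_eval e q') (laurent_eval e q) < \<eta>"
      unfolding uniformly_continuous_on_def using \<open>\<eta> > 0\<close> by metis
    have "\<forall>\<^sub>F n in sequentially. dist (X n) x0 < \<rho>" using Xlim \<rho>(1) by (rule tendstoD)
    then show "\<forall>\<^sub>F n in sequentially. \<forall>y\<in>K. dist (laurent_eval e (X n, y)) (laurent_eval e (x0, y)) < \<eta>"
    proof eventually_elim
      case (elim n)
      show ?case
      proof
        fix y assume "y \<in> K"
        then have y: "y \<in> cball y0 \<delta>" using K(2) by auto
        have "X n \<in> cball x0 \<delta>" using X(1)[of n] by simp
        then show "dist (laurent_eval e (X n, y)) (laurent_eval e (x0, y)) < \<eta>"
          using elim y \<delta>(1) by (intro \<rho>(2)) (auto simp: dist_prod_def)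
      qed
    qed
  qed
  show False
  proof (cases "(\<lambda>y. laurent_eval e (x0, y)) constant_on ?S")
    case True
    then obtain c where c: "\<And>y. y \<in> ?S \<Longrightarrow> laurent_eval e (x0, y) = c" unfolding constant_on_def by blast
    have "c = 0" using c[of y0] \<delta>(1) p(2) by (simp add: xy)
    define y where "y = y0 + complex_of_real (\<delta> / 2)"
    have "dist y0 y < \<delta>" "y \<noteq> y0" using \<delta>(1) by (auto simp: y_def dist_norm simp del: of_real_divide)
    then show False using only[of x0 y] c[of y] \<open>c = 0\<close> \<delta>(1) by simp
  next
    case False
    have "laurent_eval e (x0, y0) \<noteq> 0"
    proof (rule Hurwitz_no_zeros[where S = ?S and \<F> = "\<lambda>n y. laurent_eval e (X n, y)" and g = "\<lambda>y. laurent_eval e (x0, y)"])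
      show "(\<lambda>y. laurent_eval e (X n, y)) holomorphic_on ?S" for n using hol X(1)[of n] by simp
      show "(\<lambda>y. laurent_eval e (x0, y)) holomorphic_on ?S" using hol \<delta>(1) by simp
      show "laurent_eval e (X n, y) \<noteq> 0" if "y \<in> ?S" for n y
        using only[of "X n" y] X[of n] that by auto
    qed (use False unif \<delta>(1) in auto)
    then show False using p(2) by (simp add: xy)
  qed
qed

text \<open>The global ideal of the system. Both sides of the dichotomy below depend on the system only through it, which
  permits elimination before passing to local rings.\<close>

definition laurent_ideal :: "laurent \<Rightarrow> laurent \<Rightarrow> laurent set"
  where "laurent_ideal f g = {r * f + s * g | r s. True}"

lemma laurent_ideal_closed:
  "x \<in> laurent_ideal f g \<Longrightarrow> y \<in> laurent_ideal f g \<Longrightarrow> x + y \<in> laurent_ideal f g"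
  "x \<in> laurent_ideal f g \<Longrightarrow> r * x \<in> laurent_ideal f g"
  "f \<in> laurent_ideal f g" "g \<in> laurent_ideal f g"
proof -
  show "x + y \<in> laurent_ideal f g" if xy: "x \<in> laurent_ideal f g" "y \<in> laurent_ideal f g"
  proof -
    obtain a b c d where "x = a * f + b * g" "y = c * f + d * g" using xy by (auto simp: laurent_ideal_def)
    then have "x + y = (a + c) * f + (b + d) * g" by (simp add: algebra_simps)
    then show ?thesis by (auto simp: laurent_ideal_def)
  qed
  show "r * x \<in> laurent_ideal f g" if x: "x \<in> laurent_ideal f g"
  proof -
    obtain a b where "x = a * f + b * g" using x by (auto simp: laurent_ideal_def)
    then have "r * x = (r * a) * f + (r * b) * g" by (simp add: algebra_simps)
    then show ?thesis by (auto simp: laurent_ideal_def)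
  qed
  have "f = 1 * f + 0 * g" "g = 0 * f + 1 * g" by simp_all
  then show "f \<in> laurent_ideal f g" "g \<in> laurent_ideal f g" unfolding laurent_ideal_def by blast+
qed

lemma laurent_ideal_subset:
  assumes "f \<in> laurent_ideal f' g'" "g \<in> laurent_ideal f' g'"
  shows "laurent_ideal f g \<subseteq> laurent_ideal f' g'"
  using assms laurent_ideal_closed unfolding laurent_ideal_def[of f g] by blast

lemma laurent_ideal_eqI:
  assumes "f \<in> laurent_ideal f' g'" "g \<in> laurent_ideal f' g'" "f' \<in> laurent_ideal f g" "g' \<in> laurent_ideal f g"
  shows "laurent_ideal f g = laurent_ideal f' g'"
  using laurent_ideal_subset assms by blast

lemma laurent_ideal_eval:
  assumes "x \<in> laurent_ideal f g" "q \<in> solutions f g" shows "laurent_eval x q = 0"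
  using assms by (auto simp: laurent_ideal_def solutions_def laurent_eval_hom)

lemma solutions_ideal: "solutions f g = {q \<in> torus. \<forall>x\<in>laurent_ideal f g. laurent_eval x q = 0}"
proof
  show "solutions f g \<subseteq> {q \<in> torus. \<forall>x\<in>laurent_ideal f g. laurent_eval x q = 0}"
    using laurent_ideal_eval by (auto simp: solutions_def)
  show "{q \<in> torus. \<forall>x\<in>laurent_ideal f g. laurent_eval x q = 0} \<subseteq> solutions f g"
    using laurent_ideal_closed(3,4) by (auto simp: solutions_def)
qed

lemma laurent_ideal_fun:
  assumes "x \<in> laurent_ideal f g" "p \<in> torus"
  shows "laurent_fun x \<in> ideal2 p (laurent_fun f) (laurent_fun g)"
proof -
  obtain r s where "x = r * f + s * g" using assms(1) by (auto simp: laurent_ideal_def)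
  then have "laurent_fun x = laurent_fun r * laurent_fun f + laurent_fun s * laurent_fun g"
    by (simp add: laurent_fun_ev lf.ev_add lf.ev_mult)
  then show ?thesis using assms(2) by (auto intro!: ideal2_closed(1,3,4,5) ideal2_closed(3) stalk_closed)
qed

abbreviation lconst :: "complex \<Rightarrow> laurent" where "lconst c \<equiv> Poly_Mapping.single 0 c"
abbreviation lmono :: "int \<times> int \<Rightarrow> laurent" where "lmono a \<equiv> Poly_Mapping.single a 1"

lemma lconst_hom: "lconst (c + d) = lconst c + lconst d" "lconst (c * d) = lconst c * lconst d"
  "lconst (c - d) = lconst c - lconst d" "lconst (- c) = - lconst c"
  by (simp_all add: single_add mult_single single_diff single_uminus)

definition quad :: "int \<times> int \<Rightarrow> complex \<Rightarrow> complex \<Rightarrow> complex \<Rightarrow> laurent"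
  where "quad u c0 c1 c2 = lconst c0 + lconst c1 * lmono u + lconst c2 * (lmono u)\<^sup>2"

lemma quad_eval: "q \<in> torus \<Longrightarrow> laurent_eval (quad u c0 c1 c2) q
    = c0 + c1 * monomial_eval u q + c2 * (monomial_eval u q)\<^sup>2"
  by (simp add: quad_def laurent_eval_hom)

lemma quad_fun: "laurent_fun (quad u c0 c1 c2)
    = const_fun c0 + const_fun c1 * monomial_fun u + const_fun c2 * (monomial_fun u)\<^sup>2"
  by (simp add: quad_def laurent_fun_ev lf.ev_add lf.ev_mult lf.ev_power const_fun_hom)

text \<open>In suitable coordinates the ideal contains \<open>V - a(U)\<close> and a nonzero polynomial
  \<open>h(U)\<close>, both of degree at most two in \<open>U\<close>: the solutions lie on the graph of
  \<open>a\<close> over at most two values of \<open>U\<close>.\<close>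

definition eliminable :: "laurent \<Rightarrow> laurent \<Rightarrow> bool"
  where "eliminable f g \<longleftrightarrow> (\<exists>u v a0 a1 a2 h0 h1 h2. \<bar>det2 u v\<bar> = 1 \<and> (h0 \<noteq> 0 \<or> h1 \<noteq> 0 \<or> h2 \<noteq> 0) \<and>
    lmono v - quad u a0 a1 a2 \<in> laurent_ideal f g \<and> quad u h0 h1 h2 \<in> laurent_ideal f g)"

text \<open>The graph equation makes \<open>T = U - U(p)\<close> a local parameter modulo the ideal. The quadratic
  \<open>h\<close> vanishes at the point, so up to a unit it is \<open>T\<close> or its square. Hence
  \<open>1\<close> and \<open>T\<close> span the local quotient, whose dimension is at most two.\<close>

proposition eliminable_not_triple:
  assumes el: "eliminable f g" and p: "p \<in> solutions f g"
  shows "\<not> intersection_multiplicity p f g 3"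
proof -
  obtain u v a0 a1 a2 h0 h1 h2 where uv: "\<bar>det2 u v\<bar> = 1" and h: "h0 \<noteq> 0 \<or> h1 \<noteq> 0 \<or> h2 \<noteq> 0"
    and W: "lmono v - quad u a0 a1 a2 \<in> laurent_ideal f g" and H: "quad u h0 h1 h2 \<in> laurent_ideal f g"
    using el unfolding eliminable_def by blast
  have t: "p \<in> torus" using p by (simp add: solutions_def)
  let ?I = "ideal2 p (laurent_fun f) (laurent_fun g)" and ?O = "stalk p"
  define T where "T = monomial_fun u - const_fun (monomial_eval u p)"
  let ?U = "monomial_fun u" and ?V = "monomial_fun v" and ?cU = "monomial_eval u p" and ?cV = "monomial_eval v p"
  have T: "T \<in> ?O" unfolding T_def by (intro stalk_closed t)
  have UT: "?U = const_fun ?cU + T" by (simp add: T_def)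
  have regT: "regular p T 0"
    using pv.germ_add[OF regular_monomial[OF t, of u] regular_const[where c = "- ?cU"]]
    by (simp add: T_def const_fun_uminus)
  have WI: "?V - (const_fun a0 + const_fun a1 * ?U + const_fun a2 * ?U\<^sup>2) \<in> ?I"
    using laurent_ideal_fun[OF W t] by (simp add: quad_fun laurent_fun_ev lf.ev_diff const_fun_hom quad_fun[unfolded laurent_fun_ev])
  have HI: "const_fun h0 + const_fun h1 * ?U + const_fun h2 * ?U\<^sup>2 \<in> ?I"
    using laurent_ideal_fun[OF H t] by (simp add: quad_fun)
  have V0: "?cV = a0 + a1 * ?cU + a2 * ?cU\<^sup>2"
    using laurent_ideal_eval[OF W p] by (simp add: laurent_eval_hom[OF t] quad_eval[OF t])
  have H0: "h0 + h1 * ?cU + h2 * ?cU\<^sup>2 = 0"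
    using laurent_ideal_eval[OF H p] by (simp add: quad_eval[OF t])
  have step: "\<exists>c y. y \<in> ?O \<and> x - (const_fun c + T * y) \<in> ?I" if x: "x \<in> ?O" for x
  proof -
    obtain c y y' where c: "y \<in> ?O" "y' \<in> ?O"
      "x = const_fun c + T * y + (?V - const_fun ?cV) * y'"
      using stalk_split_basis[OF t uv x] unfolding T_def by blast
    let ?k = "const_fun a1 + const_fun a2 * (?U + const_fun ?cU)"
    have k: "?k \<in> ?O" by (intro stalk_closed t)
    have "const_fun ?cV = const_fun a0 + const_fun a1 * const_fun ?cU + const_fun a2 * (const_fun ?cU)\<^sup>2"
      unfolding V0 by (simp add: const_fun_hom const_fun_power)
    then have "?V - const_fun ?cV = (?V - (const_fun a0 + const_fun a1 * ?U + const_fun a2 * ?U\<^sup>2)) + T * ?k"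
      by (simp add: T_def algebra_simps power2_eq_square)
    then have "x - (const_fun c + T * (y + ?k * y')) = (?V - (const_fun a0 + const_fun a1 * ?U + const_fun a2 * ?U\<^sup>2)) * y'"
      unfolding c(3) by (simp add: algebra_simps)
    moreover have "y + ?k * y' \<in> ?O" by (intro stalk_closed t c)
    ultimately show ?thesis using ideal2_closed(2)[OF WI c(2)] by metis
  qed
  (* The derivative of the quadratic at the point, which decides between T and its square. *)
  define k where "k = h1 + (h2 + h2) * ?cU"
  have id: "a + b * (x + t) + c * (x + t)\<^sup>2 = (a + b * x + c * x\<^sup>2) + t * ((b + (c + c) * x) + c * t)"
    for a b c x t :: ratfun by (simp add: algebra_simps power2_eq_square)
  have "const_fun h0 + const_fun h1 * ?U + const_fun h2 * ?U\<^sup>2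
      = const_fun (h0 + h1 * ?cU + h2 * ?cU\<^sup>2) + T * (const_fun k + const_fun h2 * T)"
    by (simp only: UT id const_fun_hom const_fun_power k_def)
  then have TI: "T * (const_fun k + const_fun h2 * T) \<in> ?I" using HI by (simp add: H0 const_fun_hom)
  have T2: "T * T \<in> ?I"
  proof (cases "k = 0")
    case False
    have r: "regular p (const_fun k + const_fun h2 * T) (k + h2 * 0)"
      by (intro pv.germ_add pv.germ_mult regular_const regT)
    then have "inverse (const_fun k + const_fun h2 * T) \<in> ?O"
      using regular_inverse[of p "const_fun k + const_fun h2 * T" k] False carrier_local_ring by auto
    then have "T * (const_fun k + const_fun h2 * T) * inverse (const_fun k + const_fun h2 * T) \<in> ?I"
      by (intro ideal2_closed(2)[OF TI])
    moreover have "const_fun k + const_fun h2 * T \<noteq> 0"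
    proof
      assume "const_fun k + const_fun h2 * T = 0"
      then have "k + h2 * 0 = 0" using pv.germ_unique[OF r, of 0] regular_const[where c = 0] by (simp add: const_fun_hom)
      then show False using False by simp
    qed
    ultimately have "T \<in> ?I" by (simp add: mult.assoc)
    then show ?thesis using T by (rule ideal2_closed(2))
  next
    case True
    have "h2 \<noteq> 0"
    proof
      assume "h2 = 0"
      then have "h1 = 0" using True by (simp add: k_def)
      then show False using H0 h \<open>h2 = 0\<close> by simp
    qed
    then have "const_fun (inverse h2) * const_fun h2 = 1" by (simp add: const_fun_hom(4)[symmetric] const_fun_hom(2))
    then have "const_fun (inverse h2) * (T * (const_fun k + const_fun h2 * T)) = T * T"
      using True by (simp add: const_fun_hom mult.left_commute mult.assoc[symmetric])
    then show ?thesis using ideal2_closed(3)[OF TI stalk_const[of "inverse h2"]] by (simp only:)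
  qed
  have mem: "laurent_fun f \<in> ?O" "laurent_fun g \<in> ?O" using t by (auto intro: stalk_closed)
  show ?thesis
    unfolding intersection_multiplicity_def quotient_ring_def quotient_constants_def system_ideal_eq[OF t]
  proof (rule not_dimension_three_of_two_generators[OF ideal_ideal2[OF mem] stalk_1 T])
    fix x assume "x \<in> ?O"
    then obtain c y where c: "y \<in> ?O" "x - (const_fun c + T * y) \<in> ?I" using step by blast
    obtain c' y' where c': "y' \<in> ?O" "y - (const_fun c' + T * y') \<in> ?I" using step[OF c(1)] by blast
    have "(x - (const_fun c + T * y)) + T * (y - (const_fun c' + T * y')) + (T * T) * y' \<in> ?I"
      by (intro ideal2_closed(1) c ideal2_closed(3)[OF c'(2) T] ideal2_closed(2)[OF T2] c')
    then have "x - (const_fun c * 1 + const_fun c' * T) \<in> ?I" by (simp add: algebra_simps)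
    then show "\<exists>c1 c2. x - (const_fun c1 * 1 + const_fun c2 * T) \<in> ?I" by blast
  qed
qed

text \<open>A solution is determined by its value of \<open>U\<close>, a root of \<open>h\<close>.\<close>

lemma eliminable_few_roots:
  assumes el: "eliminable f g" and S: "S \<subseteq> solutions f g"
  shows "card S \<le> 2"
proof -
  obtain u v a0 a1 a2 h0 h1 h2 where uv: "\<bar>det2 u v\<bar> = 1" and h: "h0 \<noteq> 0 \<or> h1 \<noteq> 0 \<or> h2 \<noteq> 0"
    and W: "lmono v - quad u a0 a1 a2 \<in> laurent_ideal f g" and H: "quad u h0 h1 h2 \<in> laurent_ideal f g"
    using el unfolding eliminable_def by blast
  have V0: "monomial_eval v q = a0 + a1 * monomial_eval u q + a2 * (monomial_eval u q)\<^sup>2"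
    and H0: "h0 + h1 * monomial_eval u q + h2 * (monomial_eval u q)\<^sup>2 = 0" and t: "q \<in> torus" if "q \<in> S" for q
  proof -
    show t: "q \<in> torus" using that S by (auto simp: solutions_def)
    show "monomial_eval v q = a0 + a1 * monomial_eval u q + a2 * (monomial_eval u q)\<^sup>2"
      using laurent_ideal_eval[OF W, of q] that S by (auto simp: laurent_eval_hom[OF t] quad_eval[OF t])
    show "h0 + h1 * monomial_eval u q + h2 * (monomial_eval u q)\<^sup>2 = 0"
      using laurent_ideal_eval[OF H, of q] that S by (auto simp: quad_eval[OF t])
  qed
  have inj: "inj_on (monomial_eval u) S"
  proof (rule inj_onI)
    fix q q' assume q: "q \<in> S" "q' \<in> S" and eq: "monomial_eval u q = monomial_eval u q'"
    have eqv: "monomial_eval v q = monomial_eval v q'" using V0 q eq by simp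
    have "monomial_eval a q = monomial_eval a q'" for a
      using monomial_eval_lattice[OF t[OF q(1)], of u v "coord u v a"]
        monomial_eval_lattice[OF t[OF q(2)], of u v "coord u v a"] eq eqv lattice_map_coord[OF uv, of a] by simp
    from this[of "(1, 0)"] this[of "(0, 1)"] show "q = q'" by (simp add: monomial_eval_def prod_eq_iff)
  qed
  have nz: "[:h0, h1, h2:] \<noteq> 0" using h by simp
  have "card S = card (monomial_eval u ` S)" using inj by (simp add: card_image)
  also have "\<dots> \<le> card {t. poly [:h0, h1, h2:] t = 0}"
    using H0 by (intro card_mono poly_roots_finite nz) (auto simp: algebra_simps power2_eq_square)
  also have "\<dots> \<le> degree [:h0, h1, h2:]" using nz by (rule card_poly_roots_bound)
  also have "\<dots> \<le> 2" by simp
  finally show ?thesis .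
qed

text \<open>A dichotomy that excludes triple roots and three roots at once: either elimination to a quadratic is possible,
  or through every solution passes the zero set of a single Laurent polynomial consisting of solutions, so
  that no solution is isolated.\<close>

definition small_system :: "laurent \<Rightarrow> laurent \<Rightarrow> bool"
  where "small_system f g \<longleftrightarrow> eliminable f g \<or>
    (\<forall>p\<in>solutions f g. \<exists>e. laurent_eval e p = 0 \<and> {q \<in> torus. laurent_eval e q = 0} \<subseteq> solutions f g)"

lemma small_system_roots:
  assumes "small_system f g"
  shows "\<not> root_of_multiplicity f g p 3" and "S \<subseteq> roots f g \<Longrightarrow> card S \<noteq> 3"
proof -
  have sol: "roots f g \<subseteq> solutions f g" by (auto simp: roots_def isolated_in_def)
  have none: "roots f g = {}" if "\<not> eliminable f g"
  proof -
    have False if r: "p \<in> roots f g" for p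
    proof -
      obtain e where e: "laurent_eval e p = 0" "{q \<in> torus. laurent_eval e q = 0} \<subseteq> solutions f g"
        using assms \<open>\<not> eliminable f g\<close> r sol unfolding small_system_def by blast
      have p: "p \<in> torus" using r sol by (auto simp: solutions_def)
      have "p isolated_in {q \<in> torus. laurent_eval e q = 0}"
        using r e p unfolding roots_def isolated_in_def by blast
      then show False using laurent_zero_not_isolated[OF p e(1)] by blast
    qed
    then show ?thesis by blast
  qed
  show "\<not> root_of_multiplicity f g p 3"
    using none sol eliminable_not_triple unfolding root_of_multiplicity_def by blast
  show "card S \<noteq> 3" if "S \<subseteq> roots f g"
  proof (cases "eliminable f g")
    case True
    then show ?thesis using eliminable_few_roots[of f g S] that sol by force
  next
    case False
    then show ?thesis using none that by simp
  qed
qed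

lemma small_system_ideal:
  assumes "laurent_ideal f g = laurent_ideal f' g'" "small_system f g" shows "small_system f' g'"
  using assms solutions_ideal[of f g] solutions_ideal[of f' g'] unfolding small_system_def eliminable_def by simp

section \<open>Systems without triple roots\<close>

lemma laurent_ideal_commute: "laurent_ideal f g = laurent_ideal g f"
  by (intro laurent_ideal_eqI laurent_ideal_closed)

lemma small_system_commute: "small_system f g \<Longrightarrow> small_system g f"
  using small_system_ideal[OF laurent_ideal_commute] .

text \<open>If the remainder of \<open>G\<close> after elimination vanishes, then \<open>G\<close> is a multiple of
  \<open>F\<close> and the solution set is a curve.\<close>

lemma small_system_graph:
  assumes uv: "\<bar>det2 u v\<bar> = 1" and W: "lmono v - quad u a0 a1 a2 = r * F"
    and G: "G = quad u h0 h1 h2 + s * F"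
  shows "small_system F G"
proof (cases "h0 = 0 \<and> h1 = 0 \<and> h2 = 0")
  case False
  have "r * F \<in> laurent_ideal F G" "G + (- s) * F \<in> laurent_ideal F G"
    by (intro laurent_ideal_closed)+
  then have "lmono v - quad u a0 a1 a2 \<in> laurent_ideal F G" "quad u h0 h1 h2 \<in> laurent_ideal F G"
    unfolding W by (simp_all add: G)
  then show ?thesis using uv False unfolding small_system_def eliminable_def by blast
next
  case True
  then have "G = s * F" by (simp add: G quad_def)
  then have "{q \<in> torus. laurent_eval F q = 0} \<subseteq> solutions F G" by (auto simp: solutions_def laurent_eval_hom)
  then show ?thesis unfolding small_system_def by (auto simp: solutions_def)
qed

lemma lconst_inverse: "c \<noteq> 0 \<Longrightarrow> lconst (1 / c) * lconst c = 1"
  by (simp add: mult_single single_one)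

text \<open>Solve the linear equation for the monomial at \<open>v\<close> and substitute in the quadratic one.\<close>

lemma small_system_linear_solved:
  assumes uv: "\<bar>det2 u v\<bar> = 1" and c: "c2 \<noteq> 0"
    and F: "F = lconst c0 + lconst c1 * lmono u + lconst c2 * lmono v"
    and G: "G = lconst g00 + lconst g10 * lmono u + lconst g01 * lmono v
      + lconst g20 * (lmono u)\<^sup>2 + lconst g11 * (lmono u * lmono v) + lconst g02 * (lmono v)\<^sup>2"
  shows "small_system F G"
proof -
  define k where "k = lconst (1 / c2)"
  have k: "k * lconst c2 = 1" unfolding k_def by (rule lconst_inverse[OF c])
  define a0 a1 where "a0 = - c0 / c2" and "a1 = - c1 / c2"
  have a: "lconst a0 = - (k * lconst c0)" "lconst a1 = - (k * lconst c1)"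
    by (simp_all add: a0_def a1_def k_def mult_single single_uminus)
  let ?U = "lmono u" and ?V = "lmono v"
  define A where "A = lconst a0 + lconst a1 * ?U"
  have D: "?V - A = k * F"
  proof -
    have "k * F = k * lconst c0 + k * lconst c1 * ?U + (k * lconst c2) * ?V" by (simp add: F algebra_simps)
    then show ?thesis by (simp add: A_def a k)
  qed
  define h0 h1 h2 where "h0 = g00 + g01 * a0 + g02 * (a0 * a0)"
    and "h1 = g10 + g01 * a1 + g11 * a0 + g02 * (a0 * a1 + a0 * a1)" and "h2 = g20 + g11 * a1 + g02 * (a1 * a1)"
  have id: "p00 + p10 * x + p01 * y + p20 * x\<^sup>2 + p11 * (x * y) + p02 * y\<^sup>2
      = ((p00 + p01 * b0 + p02 * (b0 * b0)) + (p10 + p01 * b1 + p11 * b0 + p02 * (b0 * b1 + b0 * b1)) * x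
        + (p20 + p11 * b1 + p02 * (b1 * b1)) * x\<^sup>2)
        + (y - (b0 + b1 * x)) * (p01 + p11 * x + p02 * (y + (b0 + b1 * x)))"
    for p00 p10 p01 p20 p11 p02 x y b0 b1 :: laurent
    by (simp add: algebra_simps power2_eq_square)
  have "G = quad u h0 h1 h2 + (?V - A) * (lconst g01 + lconst g11 * ?U + lconst g02 * (?V + A))"
    unfolding G A_def h0_def h1_def h2_def quad_def
    by (simp only: lconst_hom id[of "lconst g00" "lconst g10" _ "lconst g01" _ "lconst g20" "lconst g11" "lconst g02" "lconst a0" "lconst a1"])
  then have "G = quad u h0 h1 h2 + (k * (lconst g01 + lconst g11 * ?U + lconst g02 * (?V + A))) * F"
    unfolding D by (simp add: mult_ac)
  moreover have "?V - quad u a0 a1 0 = k * F" using D by (simp add: quad_def A_def)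
  ultimately show ?thesis using small_system_graph[OF uv] by blast
qed

lemma det2_commute: "det2 v u = - det2 u v" by (simp add: det2_def)

lemma laurent_eval_lconst: "q \<in> torus \<Longrightarrow> laurent_eval (lconst c) q = c"
  by (simp add: laurent_eval_hom)

text \<open>A linear equation can be solved for one of its variables unless it is constant, when the system has one
  equation or no solution.\<close>

lemma small_system_linear:
  assumes uv: "\<bar>det2 u v\<bar> = 1"
    and F: "F = lconst c0 + lconst c1 * lmono u + lconst c2 * lmono v"
    and G: "G = lconst g00 + lconst g10 * lmono u + lconst g01 * lmono v
      + lconst g20 * (lmono u)\<^sup>2 + lconst g11 * (lmono u * lmono v) + lconst g02 * (lmono v)\<^sup>2"
  shows "small_system F G"
proof (cases "c2 = 0")
  case False
  then show ?thesis using small_system_linear_solved[OF uv _ F G] by blast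
next
  case c2: True
  show ?thesis
  proof (cases "c1 = 0")
    case False
    have "\<bar>det2 v u\<bar> = 1" using uv det2_commute[of v u] by simp
    then show ?thesis
      by (rule small_system_linear_solved[OF _ False, of _ _ _ c0 c2 _ g00 g01 g10 g02 g11 g20])
        (simp_all add: F G add_ac mult.commute)
  next
    case True
    then have F': "F = lconst c0" using c2 by (simp add: F)
    show ?thesis
    proof (cases "c0 = 0")
      case True
      then have "{q \<in> torus. laurent_eval G q = 0} \<subseteq> solutions F G"
        by (auto simp: solutions_def F' laurent_eval_hom)
      then show ?thesis unfolding small_system_def by (auto simp: solutions_def)
    next
      case False
      then have "solutions F G = {}" by (auto simp: solutions_def F' laurent_eval_lconst)
      then show ?thesis unfolding small_system_def by simp
    qed
  qed
qed

text \<open>Eliminating the product term from one of two bilinear equations leaves a linear one, and the other bilinear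
  equation is a special quadratic.\<close>

lemma small_system_bilinear:
  assumes uv: "\<bar>det2 u v\<bar> = 1"
    and F: "F = lconst c0 + lconst c1 * lmono u + lconst c2 * lmono v + lconst c3 * (lmono u * lmono v)"
    and G: "G = lconst d0 + lconst d1 * lmono u + lconst d2 * lmono v + lconst d3 * (lmono u * lmono v)"
  shows "small_system F G"
proof (cases "c3 = 0")
  case True
  then show ?thesis
    by (intro small_system_linear[OF uv, of F c0 c1 c2 G d0 d1 d2 0 d3 0]) (simp_all add: F G)
next
  case False
  (* The product terms cancel in L. *)
  define L where "L = lconst c3 * G - lconst d3 * F"
  have "small_system L F"
  proof (rule small_system_linear[OF uv, of L "c3 * d0 - d3 * c0" "c3 * d1 - d3 * c1" "c3 * d2 - d3 * c2" F c0 c1 c2 0 c3 0])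
    show "L = lconst (c3 * d0 - d3 * c0) + lconst (c3 * d1 - d3 * c1) * lmono u + lconst (c3 * d2 - d3 * c2) * lmono v"
      unfolding L_def F G lconst_hom by (simp add: algebra_simps)
    show "F = lconst c0 + lconst c1 * lmono u + lconst c2 * lmono v + lconst 0 * (lmono u)\<^sup>2
        + lconst c3 * (lmono u * lmono v) + lconst 0 * (lmono v)\<^sup>2" by (simp add: F)
  qed
  moreover have "laurent_ideal L F = laurent_ideal F G"
  proof (rule laurent_ideal_eqI)
    have "lconst c3 * G + (- lconst d3) * F \<in> laurent_ideal F G"
      by (intro laurent_ideal_closed)
    then show "L \<in> laurent_ideal F G" by (simp add: L_def)
    show "F \<in> laurent_ideal F G" "F \<in> laurent_ideal L F" by (intro laurent_ideal_closed)+
    have "lconst (1 / c3) * (L + lconst d3 * F) \<in> laurent_ideal L F" by (intro laurent_ideal_closed)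
    moreover have "lconst (1 / c3) * (L + lconst d3 * F) = (lconst (1 / c3) * lconst c3) * G"
      by (simp add: L_def algebra_simps)
    ultimately show "G \<in> laurent_ideal L F" using lconst_inverse[OF False] by simp
  qed
  ultimately show ?thesis by (rule small_system_ideal[rotated])
qed

lemma small_system_long_solved:
  assumes uv: "\<bar>det2 u v\<bar> = 1" and c: "c \<noteq> 0"
    and F: "F = quad u a0 a1 a2 + lconst c * lmono v" and G: "G = quad u b0 b1 b2 + lconst d * lmono v"
  shows "small_system F G"
proof (rule small_system_graph[OF uv])
  define k where "k = lconst (1 / c)"
  have k: "k * lconst c = 1" unfolding k_def by (rule lconst_inverse[OF c])
  have "k * F = k * quad u a0 a1 a2 + (k * lconst c) * lmono v" by (simp add: F algebra_simps)
  moreover have e1: "lconst (- x / c) = - (k * lconst x)" for x by (simp add: k_def mult_single single_uminus)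
  have "quad u (- a0 / c) (- a1 / c) (- a2 / c) = - (k * quad u a0 a1 a2)"
    unfolding quad_def e1 by (simp add: algebra_simps)
  ultimately show "lmono v - quad u (- a0 / c) (- a1 / c) (- a2 / c) = k * F" by (simp add: k)
  have e: "quad u (b0 - d / c * a0) (b1 - d / c * a1) (b2 - d / c * a2) = quad u b0 b1 b2 - lconst (d / c) * quad u a0 a1 a2"
    unfolding quad_def lconst_hom by (simp add: algebra_simps)
  have "lconst (d / c) * lconst c = lconst d" using c by (simp add: mult_single)
  then have "lconst (d / c) * F = lconst (d / c) * quad u a0 a1 a2 + lconst d * lmono v"
    unfolding F by (simp add: distrib_left mult.assoc[symmetric])
  then show "G = quad u (b0 - d / c * a0) (b1 - d / c * a1) (b2 - d / c * a2) + lconst (d / c) * F"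
    unfolding e G by simp
qed

text \<open>With the monomial at \<open>v\<close> present in one equation it can be solved for. Otherwise both equations
  involve only the monomial at \<open>u\<close>, and through each solution passes a curve on which that
  monomial is constant.\<close>

lemma small_system_long:
  assumes uv: "\<bar>det2 u v\<bar> = 1"
    and F: "F = quad u a0 a1 a2 + lconst c * lmono v" and G: "G = quad u b0 b1 b2 + lconst d * lmono v"
  shows "small_system F G"
proof (cases "c = 0")
  case False
  then show ?thesis using small_system_long_solved[OF uv _ F G] by blast
next
  case c: True
  show ?thesis
  proof (cases "d = 0")
    case False
    then show ?thesis using small_system_long_solved[OF uv _ G F] small_system_commute by blast
  next
    case True
    have "\<exists>e. laurent_eval e p = 0 \<and> {q \<in> torus. laurent_eval e q = 0} \<subseteq> solutions F G" if p: "p \<in> solutions F G" for p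
    (* The curve is the level set of the monomial at u through p. *)
    proof (intro exI conjI)
      have t: "p \<in> torus" using p by (simp add: solutions_def)
      let ?e = "lmono u - lconst (monomial_eval u p)"
      show "laurent_eval ?e p = 0" by (simp add: laurent_eval_hom[OF t])
      show "{q \<in> torus. laurent_eval ?e q = 0} \<subseteq> solutions F G"
      proof
        fix q assume "q \<in> {q \<in> torus. laurent_eval ?e q = 0}"
        then have q: "q \<in> torus" "monomial_eval u q = monomial_eval u p" by (auto simp: laurent_eval_hom)
        then show "q \<in> solutions F G"
          using p c True by (simp add: solutions_def F G quad_eval[OF q(1)] quad_eval[OF t])
      qed
    qed
    then show ?thesis unfolding small_system_def by blast
  qed
qed

lemma lmono_power: "(lmono a) ^ n = lmono (int n * fst a, int n * snd a)"
proof (induction n)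
  case 0
  have "(0, 0) = (0 :: int \<times> int)" by (simp add: zero_prod_def)
  then show ?case by (simp only: power_0 of_nat_0 mult_zero_left single_one)
next
  case (Suc n)
  then show ?case by (simp add: mult_single algebra_simps plus_prod_def)
qed

lemma lmono_lattice:
  assumes "0 \<le> fst c" "0 \<le> snd c"
  shows "lmono (lattice_map b u v c) = lmono b * ((lmono u) ^ nat (fst c) * (lmono v) ^ nat (snd c))"
  using assms by (simp add: lmono_power mult_single lattice_map_def plus_prod_def add.assoc)

lemma laurent_space_lattice:
  assumes uv: "\<bar>det2 u v\<bar> = 1" and f: "f \<in> laurent_space (lattice_map b u v ` C)"
    and C: "finite C" "\<And>c. c \<in> C \<Longrightarrow> 0 \<le> fst c \<and> 0 \<le> snd c"
  obtains \<gamma> where "f = lmono b * (\<Sum>c\<in>C. lconst (\<gamma> c) * ((lmono u) ^ nat (fst c) * (lmono v) ^ nat (snd c)))"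
proof -
  have lm: "coord u v (lattice_map b u v c - b) = c" for c
    using coord_lattice_map[OF uv, of c] lattice_map_translate[of b u v c] by simp
  have inj: "inj_on (lattice_map b u v) C" by (rule inj_onI) (metis lm)
  have "f = (\<Sum>a\<in>Poly_Mapping.keys f. Poly_Mapping.single a (Poly_Mapping.lookup f a))" by (rule laurent_as_sum)
  also have "\<dots> = (\<Sum>a\<in>lattice_map b u v ` C. Poly_Mapping.single a (Poly_Mapping.lookup f a))"
    using f C(1) by (intro sum.mono_neutral_left) (auto simp: laurent_space_def in_keys_iff)
  also have "\<dots> = (\<Sum>c\<in>C. Poly_Mapping.single (lattice_map b u v c) (Poly_Mapping.lookup f (lattice_map b u v c)))"
    by (simp add: sum.reindex[OF inj])
  also have "\<dots> = (\<Sum>c\<in>C. lmono b * (lconst (Poly_Mapping.lookup f (lattice_map b u v c))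
      * ((lmono u) ^ nat (fst c) * (lmono v) ^ nat (snd c))))"
  proof (rule sum.cong[OF refl])
    fix c assume "c \<in> C"
    let ?k = "Poly_Mapping.lookup f (lattice_map b u v c)"
    have "Poly_Mapping.single (lattice_map b u v c) ?k = lconst ?k * lmono (lattice_map b u v c)" by (simp add: mult_single)
    also have "\<dots> = lmono b * (lconst ?k * ((lmono u) ^ nat (fst c) * (lmono v) ^ nat (snd c)))"
      using lmono_lattice[of c b u v] C(2)[OF \<open>c \<in> C\<close>] by (simp only: mult_ac)
    finally show "Poly_Mapping.single (lattice_map b u v c) ?k
      = lmono b * (lconst ?k * ((lmono u) ^ nat (fst c) * (lmono v) ^ nat (snd c)))" .
  qed
  finally show ?thesis using that by (simp add: sum_distrib_left)
qed

text \<open>Monomials are units, so translating the two supports independently does not change the ideal.\<close>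

lemma small_system_unit:
  assumes "small_system F G" shows "small_system (lmono a * F) (lmono b * G)"
proof (rule small_system_ideal[OF _ assms], rule laurent_ideal_eqI)
  have u: "lmono (- a) * lmono a = 1" for a by (simp add: mult_single single_one)
  have "lmono (- a) * (lmono a * F) \<in> laurent_ideal (lmono a * F) (lmono b * G)"
    "lmono (- b) * (lmono b * G) \<in> laurent_ideal (lmono a * F) (lmono b * G)"
    by (intro laurent_ideal_closed)+
  then show "F \<in> laurent_ideal (lmono a * F) (lmono b * G)" "G \<in> laurent_ideal (lmono a * F) (lmono b * G)"
    by (simp_all only: mult.assoc[symmetric] u mult_1)
qed (intro laurent_ideal_closed)+

lemma small_system_triangle:
  assumes uv: "\<bar>det2 u v\<bar> = 1"
    and f: "f \<in> laurent_space (lattice_map a u v ` {(0, 0), (1, 0), (0, 1)})"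
    and g: "g \<in> laurent_space (lattice_map b u v ` {(0, 0), (1, 0), (0, 1), (2, 0), (1, 1), (0, 2)})"
  shows "small_system f g"
proof -
  obtain \<gamma> where \<gamma>: "f = lmono a * (\<Sum>c\<in>{(0, 0), (1, 0), (0, 1)}. lconst (\<gamma> c) * ((lmono u) ^ nat (fst c) * (lmono v) ^ nat (snd c)))"
    by (rule laurent_space_lattice[OF uv f]) auto
  obtain \<delta> where \<delta>: "g = lmono b * (\<Sum>c\<in>{(0, 0), (1, 0), (0, 1), (2, 0), (1, 1), (0, 2)}.
      lconst (\<delta> c) * ((lmono u) ^ nat (fst c) * (lmono v) ^ nat (snd c)))"
    by (rule laurent_space_lattice[OF uv g]) auto
  show ?thesis
    unfolding \<gamma> \<delta>
    by (rule small_system_unit, rule small_system_linear[OF uv, of _ "\<gamma> (0, 0)" "\<gamma> (1, 0)" "\<gamma> (0, 1)" _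
          "\<delta> (0, 0)" "\<delta> (1, 0)" "\<delta> (0, 1)" "\<delta> (2, 0)" "\<delta> (1, 1)" "\<delta> (0, 2)"])
      (simp_all add: algebra_simps)
qed

lemma small_system_square:
  assumes uv: "\<bar>det2 u v\<bar> = 1"
    and f: "f \<in> laurent_space (lattice_map a u v ` {(0, 0), (1, 0), (0, 1), (1, 1)})"
    and g: "g \<in> laurent_space (lattice_map b u v ` {(0, 0), (1, 0), (0, 1), (1, 1)})"
  shows "small_system f g"
proof -
  obtain \<gamma> where \<gamma>: "f = lmono a * (\<Sum>c\<in>{(0, 0), (1, 0), (0, 1), (1, 1)}. lconst (\<gamma> c) * ((lmono u) ^ nat (fst c) * (lmono v) ^ nat (snd c)))"
    by (rule laurent_space_lattice[OF uv f]) auto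
  obtain \<delta> where \<delta>: "g = lmono b * (\<Sum>c\<in>{(0, 0), (1, 0), (0, 1), (1, 1)}. lconst (\<delta> c) * ((lmono u) ^ nat (fst c) * (lmono v) ^ nat (snd c)))"
    by (rule laurent_space_lattice[OF uv g]) auto
  show ?thesis
    unfolding \<gamma> \<delta>
    by (rule small_system_unit, rule small_system_bilinear[OF uv, of _ "\<gamma> (0, 0)" "\<gamma> (1, 0)" "\<gamma> (0, 1)" "\<gamma> (1, 1)" _
          "\<delta> (0, 0)" "\<delta> (1, 0)" "\<delta> (0, 1)" "\<delta> (1, 1)"]) (simp_all add: algebra_simps)
qed

lemma small_system_long_triangle:
  assumes uv: "\<bar>det2 u v\<bar> = 1"
    and f: "f \<in> laurent_space (lattice_map a u v ` {(0, 0), (1, 0), (2, 0), (0, 1)})"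
    and g: "g \<in> laurent_space (lattice_map b u v ` {(0, 0), (1, 0), (2, 0), (0, 1)})"
  shows "small_system f g"
proof -
  obtain \<gamma> where \<gamma>: "f = lmono a * (\<Sum>c\<in>{(0, 0), (1, 0), (2, 0), (0, 1)}. lconst (\<gamma> c) * ((lmono u) ^ nat (fst c) * (lmono v) ^ nat (snd c)))"
    by (rule laurent_space_lattice[OF uv f]) auto
  obtain \<delta> where \<delta>: "g = lmono b * (\<Sum>c\<in>{(0, 0), (1, 0), (2, 0), (0, 1)}. lconst (\<delta> c) * ((lmono u) ^ nat (fst c) * (lmono v) ^ nat (snd c)))"
    by (rule laurent_space_lattice[OF uv g]) auto
  show ?thesis
    unfolding \<gamma> \<delta>
    by (rule small_system_unit, rule small_system_long[OF uv, of _ "\<gamma> (0, 0)" "\<gamma> (1, 0)" "\<gamma> (2, 0)" "\<gamma> (0, 1)" _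
          "\<delta> (0, 0)" "\<delta> (1, 0)" "\<delta> (2, 0)" "\<delta> (0, 1)"]) (simp_all add: quad_def algebra_simps)
qed

section \<open>Lattice-convex sets\<close>

text \<open>A finite set that contains all lattice points of its convex hull and is not contained in a line, stated in
  integer arithmetic: by Caratheodory's theorem triples of points suffice, and clearing denominators makes the
  barycentric weights integral. In this form the notion is visibly invariant under unimodular maps.\<close>

definition lattice_convex :: "(int \<times> int) set \<Rightarrow> bool"
  where "lattice_convex B \<longleftrightarrow> finite B \<and>
    (\<forall>p\<in>B. \<forall>q\<in>B. \<forall>r\<in>B. \<forall>a b c x. 0 \<le> a \<longrightarrow> 0 \<le> b \<longrightarrow> 0 \<le> c \<longrightarrow> 0 < a + b + c \<longrightarrow>
      (a + b + c) * fst x = a * fst p + b * fst q + c * fst r \<longrightarrow>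
      (a + b + c) * snd x = a * snd p + b * snd q + c * snd r \<longrightarrow> x \<in> B) \<and>
    (\<exists>p\<in>B. \<exists>q\<in>B. \<exists>r\<in>B. det2 (q - p) (r - p) \<noteq> 0)"

lemma lattice_convexD:
  assumes "lattice_convex B" "p \<in> B" "q \<in> B" "r \<in> B" "0 \<le> a" "0 \<le> b" "0 \<le> c" "0 < a + b + c"
    "(a + b + c) * fst x = a * fst p + b * fst q + c * fst r"
    "(a + b + c) * snd x = a * snd p + b * snd q + c * snd r"
  shows "x \<in> B"
  using assms unfolding lattice_convex_def by blast

lemma lattice_convexI:
  assumes "finite B"
    and "\<And>p q r a b c x. p \<in> B \<Longrightarrow> q \<in> B \<Longrightarrow> r \<in> B \<Longrightarrow> 0 \<le> a \<Longrightarrow> 0 \<le> b \<Longrightarrow> 0 \<le> c \<Longrightarrow> 0 < a + b + c \<Longrightarrow>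
      (a + b + c) * fst x = a * fst p + b * fst q + c * fst r \<Longrightarrow>
      (a + b + c) * snd x = a * snd p + b * snd q + c * snd r \<Longrightarrow> x \<in> B"
    and "\<exists>p\<in>B. \<exists>q\<in>B. \<exists>r\<in>B. det2 (q - p) (r - p) \<noteq> 0"
  shows "lattice_convex B"
  unfolding lattice_convex_def
  by (intro conjI ballI allI impI assms(1) assms(3)) (rule assms(2))

lemma convex_three:
  fixes S :: "'a::real_vector set"
  assumes "convex S" "x \<in> S" "y \<in> S" "z \<in> S" "0 \<le> a" "0 \<le> b" "0 \<le> c" "a + b + c = 1"
  shows "a *\<^sub>R x + b *\<^sub>R y + c *\<^sub>R z \<in> S"
proof -
  have "a *\<^sub>R x + b *\<^sub>R y + c *\<^sub>R z \<in> convex hull {x, y, z}"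
    unfolding convex_hull_3 using assms by blast
  moreover have "convex hull {x, y, z} \<subseteq> S" using assms by (intro hull_minimal) auto
  ultimately show ?thesis by blast
qed

text \<open>A collinear set has its hull in a line, which has empty interior.\<close>

lemma newton_polygon_lattice_convex:
  assumes "newton_polygon A" shows "lattice_convex A"
proof -
  have fin: "finite A" and sat: "A = {a. real_point a \<in> conv A}" and int: "interior (conv A) \<noteq> {}"
    using assms by (auto simp: newton_polygon_def)
  have comb: "x \<in> A" if "p \<in> A" "q \<in> A" "r \<in> A" and n: "0 \<le> a" "0 \<le> b" "0 \<le> c" "0 < a + b + c"
    and x: "(a + b + c) * fst x = a * fst p + b * fst q + c * fst r"
      "(a + b + c) * snd x = a * snd p + b * snd q + c * snd r" for p q r a b c x
  proof -
    let ?n = "real_of_int (a + b + c)"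
    have n0: "?n > 0" using n by linarith
    have "real_point p \<in> conv A" "real_point q \<in> conv A" "real_point r \<in> conv A"
      using that unfolding conv_def by (auto intro: hull_inc)
    moreover have "convex (conv A)" by (simp add: conv_def)
    moreover have "real_of_int a / ?n + real_of_int b / ?n + real_of_int c / ?n = 1"
      using n0 by (simp add: add_divide_distrib[symmetric])
    ultimately have m: "(real_of_int a / ?n) *\<^sub>R real_point p + (real_of_int b / ?n) *\<^sub>R real_point q
        + (real_of_int c / ?n) *\<^sub>R real_point r \<in> conv A"
      using n n0 by (intro convex_three) auto
    define N where "N = ?n"
    have N: "N > 0" using n0 by (simp add: N_def)
    have "real_of_int ((a + b + c) * fst x) = real_of_int (a * fst p + b * fst q + c * fst r)"
      "real_of_int ((a + b + c) * snd x) = real_of_int (a * snd p + b * snd q + c * snd r)"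
      using x by simp_all
    then have "N * real_of_int (fst x) = real_of_int a * real_of_int (fst p) + real_of_int b * real_of_int (fst q) + real_of_int c * real_of_int (fst r)"
      "N * real_of_int (snd x) = real_of_int a * real_of_int (snd p) + real_of_int b * real_of_int (snd q) + real_of_int c * real_of_int (snd r)"
      by (simp_all add: N_def)
    then have rx: "real_point x = (real_of_int a / N) *\<^sub>R real_point p + (real_of_int b / N) *\<^sub>R real_point q
        + (real_of_int c / N) *\<^sub>R real_point r"
      using N by (simp add: real_point_def field_simps)
    have "real_point x \<in> conv A" unfolding rx using m unfolding N_def .
    then show ?thesis using sat by blast
  qed
  have "\<exists>p\<in>A. \<exists>q\<in>A. \<exists>r\<in>A. det2 (q - p) (r - p) \<noteq> 0"
  proof (rule ccontr)
    assume "\<not> ?thesis"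
    then have col: "det2 (q - p) (r - p) = 0" if "p \<in> A" "q \<in> A" "r \<in> A" for p q r using that by blast
    have "A \<noteq> {}" using int by (auto simp: conv_def)
    then obtain p where p: "p \<in> A" by blast
    have "\<exists>n c. n \<noteq> (0 :: real \<times> real) \<and> conv A \<subseteq> {x. n \<bullet> x = c}"
    proof (cases "\<exists>q\<in>A. q \<noteq> p")
      case True
      then obtain q where q: "q \<in> A" "q \<noteq> p" by blast
      define n :: "real \<times> real" where "n = (- real_of_int (snd (q - p)), real_of_int (fst (q - p)))"
      have "n \<noteq> 0" using q(2) by (auto simp: n_def zero_prod_def prod_eq_iff)
      moreover have "conv A \<subseteq> {x. n \<bullet> x = n \<bullet> real_point p}"
        unfolding conv_def
      proof (rule hull_minimal)
        show "real_point ` A \<subseteq> {x. n \<bullet> x = n \<bullet> real_point p}"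
        proof
          fix y assume "y \<in> real_point ` A"
          then obtain r where r: "r \<in> A" "y = real_point r" by blast
          have "real_of_int (det2 (q - p) (r - p)) = 0" using col[OF p q(1) r(1)] by simp
          then have "n \<bullet> (real_point r - real_point p) = 0"
            by (simp add: n_def real_point_def inner_prod_def det2_def algebra_simps)
          then show "y \<in> {x. n \<bullet> x = n \<bullet> real_point p}" by (simp add: r(2) inner_diff_right)
        qed
      qed (rule convex_hyperplane)
      ultimately show ?thesis by blast
    next
      case False
      then have "A = {p}" using p by blast
      then have "conv A = {real_point p}" by (simp add: conv_def)
      then have "conv A \<subseteq> {x. (1, 0) \<bullet> x = (1, 0) \<bullet> real_point p}" by simp
      moreover have "((1, 0) :: real \<times> real) \<noteq> 0" by (simp add: zero_prod_def)
      ultimately show ?thesis by blast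
    qed
    then obtain n c where n: "n \<noteq> (0 :: real \<times> real)" "conv A \<subseteq> {x. n \<bullet> x = c}" by blast
    have "interior (conv A) \<subseteq> interior {x. n \<bullet> x = c}" using n(2) by (rule interior_mono)
    then show False using int interior_hyperplane[OF n(1)] by auto
  qed
  then show ?thesis using fin comb by (intro lattice_convexI)
qed

lemma det2_lattice_map:
  "det2 (lattice_map b u v q - lattice_map b u v p) (lattice_map b u v r - lattice_map b u v p)
    = det2 u v * det2 (q - p) (r - p)"
  by (simp add: det2_def lattice_map_def algebra_simps)

lemma lattice_map_surj:
  assumes "\<bar>det2 u v\<bar> = 1" shows "\<exists>c. x = lattice_map b u v c"
proof -
  have "x = b + lattice_map 0 u v (coord u v (x - b))"
    using lattice_map_coord[OF assms, of "x - b"] by simp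
  then show ?thesis
    by (intro exI[of _ "coord u v (x - b)"]) (simp only: lattice_map_translate[of b u v "coord u v (x - b)"])
qed

lemma lattice_map_inj:
  assumes "\<bar>det2 u v\<bar> = 1" shows "inj (lattice_map b u v)"
proof (rule injI)
  fix x y assume "lattice_map b u v x = lattice_map b u v y"
  then have "lattice_map 0 u v x = lattice_map 0 u v y"
    unfolding lattice_map_translate[of b u v x] lattice_map_translate[of b u v y] by simp
  from arg_cong[OF this, of "coord u v"] show "x = y" by (simp add: coord_lattice_map[OF assms])
qed

lemma lattice_convex_vimage:
  assumes uv: "\<bar>det2 u v\<bar> = 1" and B: "lattice_convex B"
  shows "lattice_convex (lattice_map b u v -` B)"
proof -
  let ?C = "lattice_map b u v -` B"
  have "finite ?C" using B finite_vimageI[OF _ lattice_map_inj[OF uv]] by (auto simp: lattice_convex_def)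
  moreover have "x \<in> ?C" if pqr: "p \<in> ?C" "q \<in> ?C" "r \<in> ?C" and n: "0 \<le> k" "0 \<le> l" "0 \<le> m" "0 < k + l + m"
    and x: "(k + l + m) * fst x = k * fst p + l * fst q + m * fst r"
      "(k + l + m) * snd x = k * snd p + l * snd q + m * snd r" for p q r k l m x
  proof -
    have e: "(k + l + m) * (z0 + fst x * z1 + snd x * z2) =
        k * (z0 + fst p * z1 + snd p * z2) + l * (z0 + fst q * z1 + snd q * z2) + m * (z0 + fst r * z1 + snd r * z2)"
      for z0 z1 z2 :: int
    proof -
      have "(k + l + m) * (z0 + fst x * z1 + snd x * z2)
          = (k + l + m) * z0 + ((k + l + m) * fst x) * z1 + ((k + l + m) * snd x) * z2"
        by (simp only: distrib_left mult.assoc)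
      also have "\<dots> = k * (z0 + fst p * z1 + snd p * z2) + l * (z0 + fst q * z1 + snd q * z2) + m * (z0 + fst r * z1 + snd r * z2)"
        unfolding x by (simp add: algebra_simps)
      finally show ?thesis .
    qed
    have "lattice_map b u v x \<in> B"
    proof (rule lattice_convexD[OF B _ _ _ n])
      show "lattice_map b u v p \<in> B" "lattice_map b u v q \<in> B" "lattice_map b u v r \<in> B" using pqr by simp_all
      show "(k + l + m) * fst (lattice_map b u v x) = k * fst (lattice_map b u v p)
          + l * fst (lattice_map b u v q) + m * fst (lattice_map b u v r)"
        unfolding lattice_map_def fst_conv by (rule e)
      show "(k + l + m) * snd (lattice_map b u v x) = k * snd (lattice_map b u v p)
          + l * snd (lattice_map b u v q) + m * snd (lattice_map b u v r)"
        unfolding lattice_map_def snd_conv by (rule e)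
    qed
    then show ?thesis by simp
  qed
  moreover have "\<exists>p\<in>?C. \<exists>q\<in>?C. \<exists>r\<in>?C. det2 (q - p) (r - p) \<noteq> 0"
  proof -
    obtain p q r where pqr: "p \<in> B" "q \<in> B" "r \<in> B" "det2 (q - p) (r - p) \<noteq> 0"
      using B by (auto simp: lattice_convex_def)
    obtain p' where p': "p = lattice_map b u v p'" using lattice_map_surj[OF uv] by blast
    obtain q' where q': "q = lattice_map b u v q'" using lattice_map_surj[OF uv] by blast
    obtain r' where r': "r = lattice_map b u v r'" using lattice_map_surj[OF uv] by blast
    note e = p' q' r'
    have "det2 (q' - p') (r' - p') \<noteq> 0" using pqr(4) unfolding e det2_lattice_map by auto
    then show ?thesis using pqr e by auto
  qed
  ultimately show ?thesis by (rule lattice_convexI)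
qed

lemma det2_parallel:
  assumes "det2 d x = 0" "det2 d y = 0" "d \<noteq> 0" shows "det2 x y = 0"
proof -
  have "fst d * det2 x y = fst x * det2 d y - fst y * det2 d x" "snd d * det2 x y = snd x * det2 d y - snd y * det2 d x"
    by (simp_all add: det2_def algebra_simps)
  then have "fst d * det2 x y = 0" "snd d * det2 x y = 0" using assms by simp_all
  then show ?thesis using assms(3) by (auto simp: prod_eq_iff zero_prod_def)
qed

text \<open>Some lattice point of the triangle over the edge lies at height one. Write a point \<open>r\<close> off the
  line as \<open>p + k d + D w\<close> with \<open>w\<close> at height one and \<open>D\<close> the height of
  \<open>r\<close>. The point \<open>p + m d + w\<close>, where \<open>m\<close> is \<open>k / D\<close>
  rounded up, is a nonnegative combination of \<open>p\<close>, \<open>q\<close> and \<open>r\<close>.\<close>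

proposition primitive_edge_extends:
  assumes B: "lattice_convex B" and pq: "p \<in> B" "q \<in> B" and cop: "coprime (fst (q - p)) (snd (q - p))"
  shows "\<exists>r\<in>B. \<bar>det2 (q - p) (r - p)\<bar> = 1"
proof -
  define d where "d = q - p"
  have d0: "d \<noteq> 0" using cop by (auto simp: d_def zero_prod_def prod_eq_iff)
  have "\<exists>r\<in>B. det2 d (r - p) \<noteq> 0"
  proof (rule ccontr)
    assume "\<not> ?thesis"
    then have z: "det2 d (r - p) = 0" if "r \<in> B" for r using that by blast
    obtain x y w where xyw: "x \<in> B" "y \<in> B" "w \<in> B" "det2 (y - x) (w - x) \<noteq> 0"
      using B by (auto simp: lattice_convex_def)
    have "det2 d (y - x) = det2 d (y - p) - det2 d (x - p)" "det2 d (w - x) = det2 d (w - p) - det2 d (x - p)"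
      by (simp_all add: det2_def algebra_simps)
    then have "det2 d (y - x) = 0" "det2 d (w - x) = 0" using z xyw by simp_all
    then show False using det2_parallel d0 xyw(4) by blast
  qed
  then obtain r where r: "r \<in> B" "det2 d (r - p) \<noteq> 0" by blast
  obtain s t where st: "s * fst d + t * snd d = 1" using cop bezout_int[of "fst d" "snd d"] unfolding d_def[symmetric] by auto
  define \<sigma> where "\<sigma> = sgn (det2 d (r - p))"
  define D where "D = \<bar>det2 d (r - p)\<bar>"
  define w where "w = (- \<sigma> * t, \<sigma> * s)"
  have \<sigma>: "\<sigma> * D = det2 d (r - p)" "\<sigma> * \<sigma> = 1" "\<bar>\<sigma>\<bar> = 1" using r(2) by (auto simp: \<sigma>_def D_def sgn_if)
  have D: "D \<ge> 1" using r(2) by (simp add: D_def)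
  have dw: "det2 d w = \<sigma>"
  proof -
    have "det2 d w = \<sigma> * (s * fst d + t * snd d)" by (simp add: det2_def w_def algebra_simps)
    then show ?thesis using st by simp
  qed
  define k where "k = s * fst (r - p) + t * snd (r - p)"
  have rk: "fst r = fst p + k * fst d + D * fst w" "snd r = snd p + k * snd d + D * snd w"
  proof -
    have "D * fst w = - t * det2 d (r - p)" "D * snd w = s * det2 d (r - p)"
      using \<sigma>(1) by (simp_all add: w_def mult_ac)
    then have "k * fst d + D * fst w = (s * fst d + t * snd d) * fst (r - p)"
      "k * snd d + D * snd w = (s * fst d + t * snd d) * snd (r - p)"
      by (simp_all add: k_def det2_def algebra_simps)
    then show "fst r = fst p + k * fst d + D * fst w" "snd r = snd p + k * snd d + D * snd w" using st by simp_all
  qed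
  (* Division of the negated number rounds up; e is the excess. *)
  define m where "m = - ((- k) div D)"
  define e where "e = (- k) mod D"
  have "m * D = - ((- k) div D * D)" by (simp add: m_def)
  moreover have "(- k) div D * D + (- k) mod D = - k" by (rule div_mult_mod_eq)
  ultimately have mk: "m * D = e + k" unfolding e_def by linarith
  have e: "0 \<le> e" "e \<le> D - 1" using D pos_mod_bound[of D "- k"] by (auto simp: e_def)
  define x where "x = (fst p + m * fst d + fst w, snd p + m * snd d + snd w)"
  have "x \<in> B"
  proof (rule lattice_convexD[OF B pq r(1), of "D - 1 - e" e 1])
    have "D * (z0 + m * z1 + z2) = (D - 1 - e) * z0 + e * (z0 + z1) + (z0 + k * z1 + D * z2)" for z0 z1 z2
    proof -
      have "D * (z0 + m * z1 + z2) = D * z0 + (m * D) * z1 + D * z2" by (simp add: algebra_simps)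
      then show ?thesis unfolding mk by (simp add: algebra_simps)
    qed
    from this[of "fst p" "fst d" "fst w"] this[of "snd p" "snd d" "snd w"]
    show "(D - 1 - e + e + 1) * fst x = (D - 1 - e) * fst p + e * fst q + 1 * fst r"
      "(D - 1 - e + e + 1) * snd x = (D - 1 - e) * snd p + e * snd q + 1 * snd r"
      unfolding x_def using rk by (simp_all add: d_def)
  qed (use e D in auto)
  moreover have "det2 d (x - p) = det2 d w" by (simp add: x_def det2_def algebra_simps)
  ultimately show ?thesis using dw \<sigma>(3) unfolding d_def[symmetric] by auto
qed

text \<open>Divide the difference by the gcd of its entries; convexity puts the intermediate lattice points into the set.\<close>

lemma primitive_step:
  assumes B: "lattice_convex B" and pq: "p \<in> B" "q \<in> B" "p \<noteq> q"
  obtains d g where "0 < g" "coprime (fst d) (snd d)" "fst q = fst p + g * fst d" "snd q = snd p + g * snd d"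
    "\<And>j. 0 \<le> j \<Longrightarrow> j \<le> g \<Longrightarrow> (fst p + j * fst d, snd p + j * snd d) \<in> B"
proof -
  define g where "g = gcd (fst (q - p)) (snd (q - p))"
  have g: "g > 0" using pq(3) by (auto simp: g_def prod_eq_iff)
  define d where "d = (fst (q - p) div g, snd (q - p) div g)"
  have gd: "fst (q - p) = g * fst d" "snd (q - p) = g * snd d" by (simp_all add: d_def g_def)
  have "coprime (fst d) (snd d)"
    unfolding d_def g_def fst_conv snd_conv using pq(3) by (intro div_gcd_coprime) (auto simp: prod_eq_iff)
  moreover have "(fst p + j * fst d, snd p + j * snd d) \<in> B" if j: "0 \<le> j" "j \<le> g" for j
    using gd g j by (intro lattice_convexD[OF B pq(1,2,1), of "g - j" j 0]) (auto simp: algebra_simps)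
  ultimately show ?thesis using that[of g d] g gd by (simp add: algebra_simps)
qed

text \<open>Start from a primitive segment and extend it.\<close>

lemma contains_unimodular:
  assumes "lattice_convex B"
  obtains a u v where "\<bar>det2 u v\<bar> = 1" "{a, a + u, a + v} \<subseteq> B"
proof -
  obtain p q r where pqr: "p \<in> B" "q \<in> B" "r \<in> B" "det2 (q - p) (r - p) \<noteq> 0"
    using assms by (auto simp: lattice_convex_def)
  then have "p \<noteq> q" by (auto simp: det2_def)
  obtain d g where d: "0 < g" "coprime (fst d) (snd d)"
    "\<And>j. 0 \<le> j \<Longrightarrow> j \<le> g \<Longrightarrow> (fst p + j * fst d, snd p + j * snd d) \<in> B"
    by (rule primitive_step[OF assms pqr(1,2) \<open>p \<noteq> q\<close>]) blast
  have "p + d \<in> B" using d(3)[of 1] d(1) by (simp add: plus_prod_def)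
  moreover obtain x where x: "x \<in> B" "\<bar>det2 (p + d - p) (x - p)\<bar> = 1"
    using primitive_edge_extends[OF assms pqr(1) \<open>p + d \<in> B\<close>] d(2) by auto
  ultimately show ?thesis using that[of d "x - p" p] pqr(1) by simp
qed

section \<open>Order-three contact in a polygon\<close>

text \<open>The hypotheses of the contact criterion for a line with support \<open>a\<close>, \<open>a + u\<close>,
  \<open>a + v\<close> and for a curve with coefficients \<open>\<beta>\<close>. The exponents are a family
  rather than a set, so that coincidences between them need no case distinction.\<close>

definition tangent_at where
  "tangent_at A B a b u v s (I :: nat set) c \<beta> \<longleftrightarrow> \<bar>det2 u v\<bar> = 1 \<and> {a, a + u, a + v} \<subseteq> A \<and> finite I \<and>
    (\<forall>i\<in>I. lattice_map b u v (c i) \<in> B) \<and> contact3 (\<Sum>i\<in>I. fps_const (\<beta> i) * line_monomial s (c i))"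

definition tangent_pair :: "(int \<times> int) set \<Rightarrow> (int \<times> int) set \<Rightarrow> bool"
  where "tangent_pair A B \<longleftrightarrow> (\<exists>a b u v s I c \<beta>. tangent_at A B a b u v s I c \<beta>)"

text \<open>Coefficients at equal exponents are added up before the criterion is applied.\<close>

lemma tangent_pair_root:
  assumes "tangent_pair A B" shows "can_have_root_of_multiplicity A B 3"
proof -
  obtain a b u v s I c \<beta> where "tangent_at A B a b u v s I c \<beta>"
    using assms unfolding tangent_pair_def by blast
  then have t: "\<bar>det2 u v\<bar> = 1" "{a, a + u, a + v} \<subseteq> A" "finite I"
    "\<forall>i\<in>I. lattice_map b u v (c i) \<in> B" "contact3 (\<Sum>i\<in>I. fps_const (\<beta> i) * line_monomial s (c i))"
    by (simp_all add: tangent_at_def)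
  have fsum: "fps_const (\<Sum>i\<in>J. \<beta> i) = (\<Sum>i\<in>J. fps_const (\<beta> i))" for J :: "nat set"
    by (induction J rule: infinite_finite_induct) (auto simp: fps_const_add[symmetric] simp del: fps_const_add)
  have "(\<Sum>i\<in>I. fps_const (\<beta> i) * line_monomial s (c i))
      = (\<Sum>x\<in>c ` I. \<Sum>i\<in>{i \<in> I. c i = x}. fps_const (\<beta> i) * line_monomial s (c i))"
    using t(3) by (rule sum.image_gen)
  also have "\<dots> = (\<Sum>x\<in>c ` I. fps_const (\<Sum>i\<in>{i \<in> I. c i = x}. \<beta> i) * line_monomial s x)"
    by (intro sum.cong refl) (simp add: fsum sum_distrib_right)
  finally have "contact3 (\<Sum>x\<in>c ` I. fps_const (\<Sum>i\<in>{i \<in> I. c i = x}. \<beta> i) * line_monomial s x)"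
    using t(5) by simp
  then show ?thesis
    using t(3,4) by (intro contact_root_coord[OF t(1,2), of "c ` I" b]) auto
qed

lemma lattice_map_add: "lattice_map a u v (p + q) = lattice_map a u v p + lattice_map 0 u v q"
  by (simp add: lattice_map_def algebra_simps)

lemma lattice_map_compose:
  "lattice_map a u v (lattice_map b x y c) = lattice_map (lattice_map a u v b) (lattice_map 0 u v x) (lattice_map 0 u v y) c"
  by (simp add: lattice_map_def algebra_simps)

lemma det2_compose: "det2 (lattice_map 0 u v x) (lattice_map 0 u v y) = det2 u v * det2 x y"
  by (simp add: lattice_map_def det2_def algebra_simps)

text \<open>The frame of the smaller pair is composed with the ambient one.\<close>

lemma tangent_pair_lattice_map:
  assumes t: "tangent_pair A0 B0" and uv: "\<bar>det2 u v\<bar> = 1"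
    and A: "lattice_map a u v ` A0 \<subseteq> A" and B: "lattice_map b u v ` B0 \<subseteq> B"
  shows "tangent_pair A B"
proof -
  obtain a' b' x y s I c \<beta> where "tangent_at A0 B0 a' b' x y s I c \<beta>"
    using t unfolding tangent_pair_def by blast
  then have t: "\<bar>det2 x y\<bar> = 1" "{a', a' + x, a' + y} \<subseteq> A0" "finite I"
    "\<forall>i\<in>I. lattice_map b' x y (c i) \<in> B0" "contact3 (\<Sum>i\<in>I. fps_const (\<beta> i) * line_monomial s (c i))"
    by (simp_all add: tangent_at_def)
  have 1: "\<bar>det2 (lattice_map 0 u v x) (lattice_map 0 u v y)\<bar> = 1"
    using uv t(1) by (simp add: det2_compose abs_mult)
  have 2: "{lattice_map a u v a', lattice_map a u v a' + lattice_map 0 u v x, lattice_map a u v a' + lattice_map 0 u v y} \<subseteq> A"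
    using t(2) A by (auto simp: lattice_map_add[symmetric])
  have 3: "\<forall>i\<in>I. lattice_map (lattice_map b u v b') (lattice_map 0 u v x) (lattice_map 0 u v y) (c i) \<in> B"
    using t(4) B by (auto simp: lattice_map_compose[symmetric])
  have "tangent_at A B (lattice_map a u v a') (lattice_map b u v b') (lattice_map 0 u v x) (lattice_map 0 u v y) s I c \<beta>"
    unfolding tangent_at_def using 1 2 3 t(3,5) by (intro conjI)
  then show ?thesis unfolding tangent_pair_def by blast
qed

lemma tangent_pair_mono:
  assumes "tangent_pair A B" "A \<subseteq> A'" "B \<subseteq> B'" shows "tangent_pair A' B'"
  using tangent_pair_lattice_map[OF assms(1), of "(1, 0)" "(0, 1)" 0 A' 0 B'] assms(2,3)
  by (auto simp: det2_def lattice_map_def image_def)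

text \<open>Some curve supported in \<open>B\<close> meets some line, supported in the standard triangle, to order exactly
  three at the unit point.\<close>

definition triple_contact :: "(int \<times> int) set \<Rightarrow> bool"
  where "triple_contact B \<longleftrightarrow> tangent_pair {(0, 0), (1, 0), (0, 1)} B"

text \<open>The expression is \<open>X + Y\<close> at one point minus the values of \<open>X\<close> and \<open>Y\<close>
  at two others. Its maximum is the size of the smallest translated multiple of the standard triangle
  containing \<open>S\<close>, which also is the mixed volume of \<open>S\<close> with that triangle.\<close>

definition wide :: "(int \<times> int) set \<Rightarrow> bool"
  where "wide S \<longleftrightarrow> (\<exists>q1\<in>S. \<exists>q2\<in>S. \<exists>q3\<in>S. 3 \<le> fst q3 + snd q3 - fst q1 - snd q2)"

lemma triple_contact_mono: "triple_contact B \<Longrightarrow> B \<subseteq> B' \<Longrightarrow> triple_contact B'"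
  unfolding triple_contact_def by (rule tangent_pair_mono) auto

lemma wide_mono: "wide S \<Longrightarrow> S \<subseteq> S' \<Longrightarrow> wide S'"
  unfolding wide_def by blast

text \<open>Together with \<open>turn\<close> it generates the affine symmetries of the standard triangle, which permute
  the three functions \<open>X\<close>, \<open>Y\<close> and \<open>1 - X - Y\<close>.\<close>

definition flip :: "int \<times> int \<Rightarrow> int \<times> int" where "flip = lattice_map (0, 0) (0, 1) (1, 0)"
definition turn :: "int \<times> int \<Rightarrow> int \<times> int" where "turn = lattice_map (1, 0) (-1, 0) (-1, 1)"

lemma flip_simp [simp]: "fst (flip p) = snd p" "snd (flip p) = fst p"
  by (simp_all add: flip_def lattice_map_def)

lemma turn_simp [simp]: "fst (turn p) = 1 - fst p - snd p" "snd (turn p) = snd p"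
  by (simp_all add: turn_def lattice_map_def)

lemma flip_flip: "flip (flip p) = p" and turn_turn: "turn (turn p) = p"
  by (simp_all add: prod_eq_iff)

lemma triple_contact_flip:
  assumes "triple_contact (flip ` B)" shows "triple_contact B"
  unfolding triple_contact_def
proof (rule tangent_pair_lattice_map[OF assms[unfolded triple_contact_def], of "(0, 1)" "(1, 0)" "(0, 0)" _ "(0, 0)"])
  show "lattice_map (0, 0) (0, 1) (1, 0) ` flip ` B \<subseteq> B"
    unfolding flip_def[symmetric] by (auto simp: flip_flip)
qed (auto simp: det2_def lattice_map_def)

lemma triple_contact_turn:
  assumes "triple_contact (turn ` B)" shows "triple_contact B"
  unfolding triple_contact_def
proof (rule tangent_pair_lattice_map[OF assms[unfolded triple_contact_def], of "(-1, 0)" "(-1, 1)" "(1, 0)" _ "(1, 0)"])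
  show "lattice_map (1, 0) (-1, 0) (-1, 1) ` turn ` B \<subseteq> B"
    unfolding turn_def[symmetric] by (auto simp: turn_turn)
qed (auto simp: det2_def lattice_map_def)

lemma wide_flip: "wide S \<Longrightarrow> wide (flip ` S)"
proof -
  assume "wide S"
  then obtain q1 q2 q3 where "q1 \<in> S" "q2 \<in> S" "q3 \<in> S" "3 \<le> fst q3 + snd q3 - fst q1 - snd q2"
    unfolding wide_def by blast
  then show ?thesis unfolding wide_def
    by (intro bexI[of _ "flip q2"] bexI[of _ "flip q1"] bexI[of _ "flip q3"]) auto
qed

lemma wide_turn: "wide S \<Longrightarrow> wide (turn ` S)"
proof -
  assume "wide S"
  then obtain q1 q2 q3 where "q1 \<in> S" "q2 \<in> S" "q3 \<in> S" "3 \<le> fst q3 + snd q3 - fst q1 - snd q2"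
    unfolding wide_def by blast
  then show ?thesis unfolding wide_def
    by (intro bexI[of _ "turn q3"] bexI[of _ "turn q2"] bexI[of _ "turn q1"]) auto
qed

lemma wide_flip_iff: "wide (flip ` S) \<longleftrightarrow> wide S"
  using wide_flip[of S] wide_flip[of "flip ` S"] by (auto simp: image_image flip_flip)

lemma wide_turn_iff: "wide (turn ` S) \<longleftrightarrow> wide S"
  using wide_turn[of S] wide_turn[of "turn ` S"] by (auto simp: image_image turn_turn)

text \<open>These are the coefficients of the logarithmic expansion of a monomial along the line, the quantities in which
  its low Taylor coefficients are polynomials.\<close>

definition moment :: "complex \<Rightarrow> nat \<Rightarrow> int \<times> int \<Rightarrow> complex"
  where "moment s j c = of_int (fst c) + of_int (snd c) * s ^ j"

text \<open>The three equations and the inequality are the Taylor conditions of order zero to three for a four-term curve,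
  multiplied by \<open>1\<close>, \<open>1\<close>, \<open>2\<close> and \<open>6\<close>.\<close>

proposition triple_contact_four_terms:
  assumes B: "b + c0 \<in> B" "b + c1 \<in> B" "b + c2 \<in> B" "b + c3 \<in> B"
    and m0: "\<beta>0 + \<beta>1 + \<beta>2 + \<beta>3 = 0"
    and m1: "\<beta>0 * moment s 1 c0 + \<beta>1 * moment s 1 c1 + \<beta>2 * moment s 1 c2 + \<beta>3 * moment s 1 c3 = 0"
    and m2: "\<beta>0 * ((moment s 1 c0)\<^sup>2 - moment s 2 c0) + \<beta>1 * ((moment s 1 c1)\<^sup>2 - moment s 2 c1)
      + \<beta>2 * ((moment s 1 c2)\<^sup>2 - moment s 2 c2) + \<beta>3 * ((moment s 1 c3)\<^sup>2 - moment s 2 c3) = 0"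
    and m3: "\<beta>0 * (moment s 1 c0 ^ 3 - 3 * moment s 1 c0 * moment s 2 c0 + 2 * moment s 3 c0)
      + \<beta>1 * (moment s 1 c1 ^ 3 - 3 * moment s 1 c1 * moment s 2 c1 + 2 * moment s 3 c1)
      + \<beta>2 * (moment s 1 c2 ^ 3 - 3 * moment s 1 c2 * moment s 2 c2 + 2 * moment s 3 c2)
      + \<beta>3 * (moment s 1 c3 ^ 3 - 3 * moment s 1 c3 * moment s 2 c3 + 2 * moment s 3 c3) \<noteq> 0"
  shows "triple_contact B"
proof -
  define c :: "nat \<Rightarrow> int \<times> int" where "c i = [c0, c1, c2, c3] ! i" for i
  define \<beta> :: "nat \<Rightarrow> complex" where "\<beta> i = [\<beta>0, \<beta>1, \<beta>2, \<beta>3] ! i" for i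
  let ?\<phi> = "\<Sum>i\<in>{..<4}. fps_const (\<beta> i) * line_monomial s (c i)"
  have nth: "fps_nth ?\<phi> k = \<beta>0 * fps_nth (line_monomial s c0) k + \<beta>1 * fps_nth (line_monomial s c1) k
      + \<beta>2 * fps_nth (line_monomial s c2) k + \<beta>3 * fps_nth (line_monomial s c3) k" for k
    by (simp add: fps_sum_nth c_def \<beta>_def eval_nat_numeral lessThan_Suc add_ac)
  have l1: "fps_nth (line_monomial s x) 1 = moment s 1 x"
    and l2: "2 * fps_nth (line_monomial s x) 2 = (moment s 1 x)\<^sup>2 - moment s 2 x"
    and l3: "6 * fps_nth (line_monomial s x) 3 = moment s 1 x ^ 3 - 3 * moment s 1 x * moment s 2 x + 2 * moment s 3 x" for x
    using line_monomial_low(2-4)[of s x] by (simp_all add: moment_def)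
  have "fps_nth ?\<phi> 0 = 0" unfolding nth line_monomial_low(1) using m0 by simp
  moreover have "fps_nth ?\<phi> 1 = 0" unfolding nth l1 using m1 by simp
  moreover have "2 * fps_nth ?\<phi> 2 = 0"
    unfolding nth using m2[folded l2] by (simp add: algebra_simps)
  moreover have "6 * fps_nth ?\<phi> 3 \<noteq> 0"
    unfolding nth using m3[folded l3] by (simp add: algebra_simps)
  ultimately have "contact3 ?\<phi>" unfolding contact3_def by simp
  moreover have "\<forall>i\<in>{..<4}. lattice_map b (1, 0) (0, 1) (c i) \<in> B"
    using B by (auto simp: c_def eval_nat_numeral less_Suc_eq lattice_map_def plus_prod_def)
  moreover have "\<bar>det2 (1, 0) (0, 1)\<bar> = 1" by (simp add: det2_def)
  moreover have "{(0, 0), (0, 0) + (1, 0), (0, 0) + (0, 1)} \<subseteq> {(0, 0), (1, 0), (0, 1) :: int \<times> int}" by simp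
  ultimately have "tangent_at {(0, 0), (1, 0), (0, 1)} B (0, 0) b (1, 0) (0, 1) s {..<4} c \<beta>"
    unfolding tangent_at_def by (intro conjI finite_lessThan)
  then show ?thesis unfolding triple_contact_def tangent_pair_def by blast
qed

text \<open>For slope zero the restriction to the line is a combination of four powers of \<open>1 + t\<close> with
  distinct exponents. The cofactors of the Vandermonde matrix annihilate the orders below three, and the
  order-three term is a nonzero multiple of the Vandermonde determinant.\<close>

lemma triple_contact_four_columns:
  assumes B: "p0 \<in> B" "p1 \<in> B" "p2 \<in> B" "p3 \<in> B"
    and d: "fst p0 \<noteq> fst p1" "fst p0 \<noteq> fst p2" "fst p0 \<noteq> fst p3" "fst p1 \<noteq> fst p2" "fst p1 \<noteq> fst p3" "fst p2 \<noteq> fst p3"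
  shows "triple_contact B"
proof -
  define x0 x1 x2 x3 :: complex where x: "x0 = of_int (fst p0)" "x1 = of_int (fst p1)" "x2 = of_int (fst p2)" "x3 = of_int (fst p3)"
  define b0 b1 b2 b3 where b: "b0 = (x1 - x2) * (x1 - x3) * (x2 - x3)" "b1 = - ((x0 - x2) * (x0 - x3) * (x2 - x3))"
    "b2 = (x0 - x1) * (x0 - x3) * (x1 - x3)" "b3 = - ((x0 - x1) * (x0 - x2) * (x1 - x2))"
  have mom: "moment 0 (Suc j) p = of_int (fst p)" for j p by (simp add: moment_def)
  have mom': "moment 0 1 p = of_int (fst p)" "moment 0 2 p = of_int (fst p)" "moment 0 3 p = of_int (fst p)" for p
    using mom[of 0 p] mom[of 1 p] mom[of 2 p] by (simp_all add: eval_nat_numeral)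
  have s0: "b0 + b1 + b2 + b3 = 0" unfolding b by (simp add: algebra_simps)
  have s1: "b0 * x0 + b1 * x1 + b2 * x2 + b3 * x3 = 0" unfolding b by (simp add: algebra_simps)
  have s2: "b0 * x0\<^sup>2 + b1 * x1\<^sup>2 + b2 * x2\<^sup>2 + b3 * x3\<^sup>2 = 0" unfolding b by (simp add: algebra_simps power2_eq_square)
  have s3: "b0 * x0 ^ 3 + b1 * x1 ^ 3 + b2 * x2 ^ 3 + b3 * x3 ^ 3
      = (x0 - x1) * (x0 - x2) * (x0 - x3) * (x1 - x2) * (x1 - x3) * (x2 - x3)"
    unfolding b by (simp add: algebra_simps power3_eq_cube)
  have nz: "(x0 - x1) * (x0 - x2) * (x0 - x3) * (x1 - x2) * (x1 - x3) * (x2 - x3) \<noteq> 0"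
    using d unfolding x by simp
  show ?thesis
  proof (rule triple_contact_four_terms[of 0 p0 B p1 p2 p3 b0 b1 b2 b3 0])
    show "b0 * moment 0 1 p0 + b1 * moment 0 1 p1 + b2 * moment 0 1 p2 + b3 * moment 0 1 p3 = 0"
      unfolding mom' x[symmetric] by (rule s1)
    have "b0 * (x0\<^sup>2 - x0) + b1 * (x1\<^sup>2 - x1) + b2 * (x2\<^sup>2 - x2) + b3 * (x3\<^sup>2 - x3)
      = (b0 * x0\<^sup>2 + b1 * x1\<^sup>2 + b2 * x2\<^sup>2 + b3 * x3\<^sup>2) - (b0 * x0 + b1 * x1 + b2 * x2 + b3 * x3)"
      by (simp add: algebra_simps)
    then show "b0 * ((moment 0 1 p0)\<^sup>2 - moment 0 2 p0) + b1 * ((moment 0 1 p1)\<^sup>2 - moment 0 2 p1)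
      + b2 * ((moment 0 1 p2)\<^sup>2 - moment 0 2 p2) + b3 * ((moment 0 1 p3)\<^sup>2 - moment 0 2 p3) = 0"
      unfolding mom' x[symmetric] s1 s2 by simp
    have "b0 * (x0 ^ 3 - 3 * x0 * x0 + 2 * x0) + b1 * (x1 ^ 3 - 3 * x1 * x1 + 2 * x1)
        + b2 * (x2 ^ 3 - 3 * x2 * x2 + 2 * x2) + b3 * (x3 ^ 3 - 3 * x3 * x3 + 2 * x3)
      = (b0 * x0 ^ 3 + b1 * x1 ^ 3 + b2 * x2 ^ 3 + b3 * x3 ^ 3)
        - 3 * (b0 * x0\<^sup>2 + b1 * x1\<^sup>2 + b2 * x2\<^sup>2 + b3 * x3\<^sup>2) + 2 * (b0 * x0 + b1 * x1 + b2 * x2 + b3 * x3)"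
      by (simp add: algebra_simps power2_eq_square)
    then show "b0 * (moment 0 1 p0 ^ 3 - 3 * moment 0 1 p0 * moment 0 2 p0 + 2 * moment 0 3 p0)
      + b1 * (moment 0 1 p1 ^ 3 - 3 * moment 0 1 p1 * moment 0 2 p1 + 2 * moment 0 3 p1)
      + b2 * (moment 0 1 p2 ^ 3 - 3 * moment 0 1 p2 * moment 0 2 p2 + 2 * moment 0 3 p2)
      + b3 * (moment 0 1 p3 ^ 3 - 3 * moment 0 1 p3 * moment 0 2 p3 + 2 * moment 0 3 p3) \<noteq> 0"
      unfolding mom' x[symmetric] s1 s2 s3 using nz by simp
  qed (use B s0 in simp_all)
qed

text \<open>For slope \<open>-1\<close> all eight cases come from one identity. With \<open>x = y = z = 1\<close> the
  combination is \<open>2 (1 + t) - 2 (1 - t) + 4 (1 + t) (1 - t)^2 - 4 (1 - t^2)\<close>, that is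
  \<open>4 t^3\<close>. Replacing \<open>1 + t\<close> by its square halves its weight and shifts only the
  coefficient of \<open>1 - t^2\<close>, the monomial at \<open>(1, 1)\<close>; the other two sides behave
  alike.\<close>

lemma triple_contact_inscribed:
  assumes B: "b + (1, 1) \<in> B" "b + (x, 0) \<in> B" "b + (0, y) \<in> B" "b + (z, 3 - z) \<in> B"
    and xyz: "x = 1 \<or> x = 2" "y = 1 \<or> y = 2" "z = 1 \<or> z = 2"
  shows "triple_contact B"
proof -
  define \<beta>1 \<beta>2 \<beta>3 :: complex where "\<beta>1 = (if x = 1 then 2 else 1)" and "\<beta>2 = (if y = 1 then -2 else -1)"
    and "\<beta>3 = (if z = 1 then 4 else -4)"
  show ?thesis
    by (rule triple_contact_four_terms[OF B, of "- \<beta>1 - \<beta>2 - \<beta>3" \<beta>1 \<beta>2 \<beta>3 "-1"])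
      (use xyz in \<open>auto simp: \<beta>1_def \<beta>2_def \<beta>3_def moment_def\<close>)
qed

text \<open>The order-three term of the trinomial is \<open>s (1 - s)\<close> times the derivative of the order-two
  condition, plus a multiple of that condition itself. Here \<open>u\<close> and \<open>w\<close> are affine
  in \<open>s\<close> with slopes \<open>n\<close> and \<open>l\<close>.\<close>

lemma trinomial_contact_identity:
  fixes u w n l s :: complex
  defines "D \<equiv> u * l - n * w"
  shows "w * (u ^ 3 - 3 * u * (u - n * s + n * s\<^sup>2) + 2 * (u - n * s + n * s ^ 3))
      - u * (w ^ 3 - 3 * w * (w - l * s + l * s\<^sup>2) + 2 * (w - l * s + l * s ^ 3))
    = s * (1 - s) * (n * w * (u - w) + u * l * (u - w) + u * w * (n - l) - D * (1 - 2 * s))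
      + (u + w - 3) * (u * w * (u - w) - D * s * (1 - s))"
  unfolding D_def by (simp add: algebra_simps power2_eq_square power3_eq_cube)

text \<open>For a trinomial the orders zero and one determine the coefficients \<open>u - w\<close>, \<open>w\<close>,
  \<open>-u\<close>. The order-two condition is then a cubic equation for the slope \<open>s\<close>, and
  order exactly three amounts to \<open>s\<close> being a simple root other than \<open>0\<close> and
  \<open>1\<close>.\<close>

proposition triple_contact_trinomial:
  fixes m n k l :: int and s :: complex
  defines "u \<equiv> of_int m + of_int n * s" and "w \<equiv> of_int k + of_int l * s" and "D \<equiv> of_int (m * l - n * k)"
  assumes B: "b \<in> B" "b + (m, n) \<in> B" "b + (k, l) \<in> B"
    and root: "u * w * (u - w) = D * s * (1 - s)"
    and simple: "of_int n * w * (u - w) + u * of_int l * (u - w) + u * w * (of_int n - of_int l) - D * (1 - 2 * s) \<noteq> 0"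
    and s: "s \<noteq> 0" "s \<noteq> 1"
  shows "triple_contact B"
proof (rule triple_contact_four_terms[of b 0 B "(m, n)" "(k, l)" 0 "u - w" w "- u" 0 s])
  have mu: "moment s 1 (m, n) = u" "moment s 2 (m, n) = u - of_int n * s + of_int n * s\<^sup>2"
    "moment s 3 (m, n) = u - of_int n * s + of_int n * s ^ 3" by (simp_all add: moment_def u_def)
  have mw: "moment s 1 (k, l) = w" "moment s 2 (k, l) = w - of_int l * s + of_int l * s\<^sup>2"
    "moment s 3 (k, l) = w - of_int l * s + of_int l * s ^ 3" by (simp_all add: moment_def w_def)
  have m0: "moment s j 0 = 0" for j by (simp add: moment_def)
  have D: "D = u * of_int l - of_int n * w" by (simp add: D_def u_def w_def algebra_simps)
  show "(u - w) * moment s 1 0 + w * moment s 1 (m, n) + - u * moment s 1 (k, l) + 0 * moment s 1 0 = 0"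
    unfolding mu mw m0 by simp
  have "w * (u\<^sup>2 - (u - of_int n * s + of_int n * s\<^sup>2)) + - u * (w\<^sup>2 - (w - of_int l * s + of_int l * s\<^sup>2))
      = u * w * (u - w) - D * s * (1 - s)" unfolding D by (simp add: algebra_simps power2_eq_square)
  then show "(u - w) * ((moment s 1 0)\<^sup>2 - moment s 2 0) + w * ((moment s 1 (m, n))\<^sup>2 - moment s 2 (m, n))
      + - u * ((moment s 1 (k, l))\<^sup>2 - moment s 2 (k, l)) + 0 * ((moment s 1 0)\<^sup>2 - moment s 2 0) = 0"
    unfolding mu mw m0 using root by simp
  have "w * (u ^ 3 - 3 * u * (u - of_int n * s + of_int n * s\<^sup>2) + 2 * (u - of_int n * s + of_int n * s ^ 3))
      - u * (w ^ 3 - 3 * w * (w - of_int l * s + of_int l * s\<^sup>2) + 2 * (w - of_int l * s + of_int l * s ^ 3))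
    = s * (1 - s) * (of_int n * w * (u - w) + u * of_int l * (u - w) + u * w * (of_int n - of_int l) - D * (1 - 2 * s))"
    using trinomial_contact_identity[of w u "of_int n" s "of_int l"] root unfolding D by simp
  moreover have "s * (1 - s) * (of_int n * w * (u - w) + u * of_int l * (u - w) + u * w * (of_int n - of_int l) - D * (1 - 2 * s)) \<noteq> 0"
    using simple s by simp
  ultimately show "(u - w) * (moment s 1 0 ^ 3 - 3 * moment s 1 0 * moment s 2 0 + 2 * moment s 3 0)
      + w * (moment s 1 (m, n) ^ 3 - 3 * moment s 1 (m, n) * moment s 2 (m, n) + 2 * moment s 3 (m, n))
      + - u * (moment s 1 (k, l) ^ 3 - 3 * moment s 1 (k, l) * moment s 2 (k, l) + 2 * moment s 3 (k, l))
      + 0 * (moment s 1 0 ^ 3 - 3 * moment s 1 0 * moment s 2 0 + 2 * moment s 3 0) \<noteq> 0"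
    unfolding mu mw m0 by simp
qed (use B in simp_all)

section \<open>Contact by trinomials\<close>

text \<open>A complex cubic has a simple root unless it is the cube of a linear polynomial.\<close>

lemma cubic_simple_root:
  fixes a b c d :: complex
  assumes a: "a \<noteq> 0"
  shows "(\<exists>s. a * s ^ 3 + b * s\<^sup>2 + c * s + d = 0 \<and> 3 * a * s\<^sup>2 + 2 * b * s + c \<noteq> 0) \<or>
    (\<exists>r. b = - 3 * a * r \<and> c = 3 * a * r\<^sup>2 \<and> d = - a * r ^ 3)"
proof -
  have "degree [:d, c, b, a:] > 0" using a by simp
  from alg_closed_imp_poly_has_root[OF this] obtain r where "poly [:d, c, b, a:] r = 0" by blast
  then have r: "a * r ^ 3 + b * r\<^sup>2 + c * r + d = 0" by (simp add: algebra_simps power2_eq_square power3_eq_cube)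
  show ?thesis
  proof (cases "3 * a * r\<^sup>2 + 2 * b * r + c = 0")
    case False
    then show ?thesis using r by blast
  next
    case True
    (* The remaining root, once r is a double root. *)
    define t where "t = - (b + 2 * a * r) / a"
    have b: "b = - a * t - 2 * a * r" using a by (simp add: t_def field_simps)
    have c: "c = - 3 * a * r\<^sup>2 - 2 * b * r" using True by (simp add: eq_neg_iff_add_eq_0 algebra_simps)
    have d: "d = - (a * r ^ 3 + b * r\<^sup>2 + c * r)" using r by (simp add: eq_neg_iff_add_eq_0 algebra_simps)
    show ?thesis
    proof (cases "t = r")
      case True
      then have "b = - 3 * a * r" using b by simp
      moreover from this have "c = 3 * a * r\<^sup>2" unfolding c by (simp add: power2_eq_square)
      ultimately show ?thesis using d by (intro disjI2 exI[of _ r]) (simp add: power2_eq_square power3_eq_cube)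
    next
      case False
      have "a * t ^ 3 + b * t\<^sup>2 + c * t + d = 0"
        unfolding d c b by (simp add: algebra_simps power2_eq_square power3_eq_cube)
      moreover have "3 * a * t\<^sup>2 + 2 * b * t + c = a * (t - r)\<^sup>2"
        unfolding c b by (simp add: algebra_simps power2_eq_square)
      ultimately show ?thesis using a False by (intro disjI1 exI[of _ t]) simp
    qed
  qed
qed

text \<open>The discriminant of a product of three linear forms is the product of their squared pairwise determinants; for
  \<open>u\<close>, \<open>w\<close> and \<open>u - w\<close> all three determinants equal
  \<open>m l - n k\<close> up to sign.\<close>

lemma discriminant_product_of_lines:
  fixes m n k l :: int
  defines "A \<equiv> n * l * (n - l)" and "B \<equiv> n * l * (m - k) + (m * l + n * k) * (n - l)"
    and "C \<equiv> m * k * (n - l) + (m * l + n * k) * (m - k)" and "E \<equiv> m * k * (m - k)"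
  shows "B\<^sup>2 * C\<^sup>2 - 4 * A * C ^ 3 - 4 * B ^ 3 * E - 27 * A\<^sup>2 * E\<^sup>2 + 18 * A * B * C * E = (m * l - n * k) ^ 6"
  unfolding A_def B_def C_def E_def by (simp add: algebra_simps eval_nat_numeral)

text \<open>The discriminant of \<open>\<kappa> (q s - p)^3 + D s (1 - s)\<close>, to be compared with that of a product
  of lines.\<close>

lemma discriminant_near_cube:
  fixes \<kappa> p q D :: int
  defines "a \<equiv> \<kappa> * q ^ 3" and "b \<equiv> - 3 * \<kappa> * p * q\<^sup>2" and "c \<equiv> 3 * \<kappa> * p\<^sup>2 * q" and "d \<equiv> - \<kappa> * p ^ 3"
  shows "(b - D)\<^sup>2 * (c + D)\<^sup>2 - 4 * a * (c + D) ^ 3 - 4 * (b - D) ^ 3 * d - 27 * a\<^sup>2 * d\<^sup>2 + 18 * a * (b - D) * (c + D) * d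
    = D ^ 4 + D ^ 3 * \<kappa> * (6 * p * q\<^sup>2 + 6 * p\<^sup>2 * q - 4 * q ^ 3 - 4 * p ^ 3) - 27 * D\<^sup>2 * \<kappa>\<^sup>2 * (p * q * (q - p))\<^sup>2"
  unfolding a_def b_def c_def d_def
  by (simp add: algebra_simps power2_eq_square power3_eq_cube power4_eq_xxxx)

lemma divisors_of_four:
  fixes p :: int assumes "p dvd 4" shows "p \<in> {-4, -2, -1, 1, 2, 4}"
proof -
  have "\<bar>p\<bar> \<le> 4" using dvd_imp_le_int[of 4 p] assms by simp
  then have "p \<in> {-4..4}" by auto
  moreover have "{-4..4::int} = {-4, -3, -2, -1, 0, 1, 2, 3, 4}" by auto
  ultimately show ?thesis using assms by auto
qed

text \<open>Coprimality forces \<open>p\<close> and \<open>q\<close> to divide \<open>4\<close>, and for these few values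
  the right-hand side is too large.\<close>

lemma no_near_cube:
  fixes \<kappa> p q D :: int
  assumes cop: "coprime p q" and D: "D = 1 \<or> D = -1" and nz: "\<kappa> \<noteq> 0" "p \<noteq> 0" "q \<noteq> 0" "p \<noteq> q"
    and eq: "D * (6 * p * q\<^sup>2 + 6 * p\<^sup>2 * q - 4 * q ^ 3 - 4 * p ^ 3) = 27 * \<kappa> * (p * q * (q - p))\<^sup>2"
  shows False
proof -
  let ?E = "6 * p * q\<^sup>2 + 6 * p\<^sup>2 * q - 4 * q ^ 3 - 4 * p ^ 3"
  have E: "?E = D * (27 * \<kappa> * (p * q * (q - p))\<^sup>2)" using D eq by auto
  have "4 * q ^ 3 = p * (6 * q\<^sup>2 + 6 * p * q - 4 * p\<^sup>2 - D * 27 * \<kappa> * p * (q * (q - p))\<^sup>2)"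
    using E by (simp add: algebra_simps power2_eq_square power3_eq_cube)
  then have "p dvd q ^ 3 * 4" by (metis dvd_triv_left mult.commute)
  moreover have "coprime p (q ^ 3)" using cop by simp
  ultimately have p4: "p dvd 4" by (metis coprime_dvd_mult_right_iff)
  have "4 * p ^ 3 = q * (6 * p * q + 6 * p\<^sup>2 - 4 * q\<^sup>2 - D * 27 * \<kappa> * q * (p * (q - p))\<^sup>2)"
    using E by (simp add: algebra_simps power2_eq_square power3_eq_cube)
  then have "q dvd p ^ 3 * 4" by (metis dvd_triv_left mult.commute)
  moreover have "coprime q (p ^ 3)" using cop by (simp add: coprime_commute)
  ultimately have q4: "q dvd 4" by (metis coprime_dvd_mult_right_iff)
  have pc: "p = -4 \<or> p = -2 \<or> p = -1 \<or> p = 1 \<or> p = 2 \<or> p = 4" using divisors_of_four[OF p4] by simp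
  have qc: "q = -4 \<or> q = -2 \<or> q = -1 \<or> q = 1 \<or> q = 2 \<or> q = 4" using divisors_of_four[OF q4] by simp
  have "\<bar>?E\<bar> < 27 * (p * q * (q - p))\<^sup>2"
    using pc qc nz(4) by (elim disjE) simp_all
  also have "\<dots> = 1 * (27 * (p * q * (q - p))\<^sup>2)" by simp
  also have "\<dots> \<le> \<bar>\<kappa>\<bar> * (27 * (p * q * (q - p))\<^sup>2)"
    using nz(1) by (intro mult_right_mono) auto
  also have "\<dots> = \<bar>27 * \<kappa> * (p * q * (q - p))\<^sup>2\<bar>" by (simp add: abs_mult)
  also have "\<dots> = \<bar>?E\<bar>" unfolding eq[symmetric] using D by auto
  finally show False by simp
qed

text \<open>If the contact cubic were a cube, it would be \<open>\<kappa> (q s - p)^3\<close> with integral data by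
  clearing denominators. Adding \<open>D s (1 - s)\<close> gives the product of the three lines, so two
  formulas for one discriminant must agree; they do not.\<close>

lemma no_triple_root:
  fixes m n k l :: int
  defines "D \<equiv> m * l - n * k"
  defines "a \<equiv> n * l * (n - l)" and "b \<equiv> n * l * (m - k) + (m * l + n * k) * (n - l) + D"
    and "c \<equiv> m * k * (n - l) + (m * l + n * k) * (m - k) - D" and "d \<equiv> m * k * (m - k)"
  assumes D1: "\<bar>D\<bar> = 1" and nz: "a \<noteq> 0" "d \<noteq> 0" "a + b + c + d \<noteq> 0"
    and r: "of_int b = - 3 * of_int a * r" "of_int c = 3 * of_int a * r\<^sup>2" "of_int d = - of_int a * (r :: complex) ^ 3"
  shows False
proof -
  (* The triple root is - b / (3 a), and dividing by g reduces this fraction. *)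
  define g where "g = gcd b (3 * a)"
  have g: "g \<noteq> 0" using nz by (simp add: g_def)
  define p q where "p = - (b div g)" and "q = (3 * a) div g"
  have bp: "b = - g * p" "3 * a = g * q" by (simp_all add: p_def q_def g_def)
  have cop: "coprime p q"
    unfolding p_def q_def g_def using nz by (simp add: div_gcd_coprime)
  have q0: "q \<noteq> 0" using bp(2) nz by auto
  have rq: "of_int q * r = of_int p"
  proof -
    have "of_int (3 * a) * r = of_int (- b)" using r(1) by simp
    then have "of_int g * (of_int q * r) = of_int g * of_int p" unfolding bp by (simp add: mult.assoc)
    then show ?thesis using g by simp
  qed
  have "of_int (d * q ^ 3) = (of_int (- a * p ^ 3) :: complex)"
  proof -
    have "of_int (d * q ^ 3) = - of_int a * (of_int q * r) ^ 3" using r(3) by (simp add: power_mult_distrib mult_ac)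
    then show ?thesis unfolding rq by simp
  qed
  then have dq: "d * q ^ 3 = - a * p ^ 3" by (simp only: of_int_eq_iff)
  have "of_int (c * q\<^sup>2) = (of_int (3 * a * p\<^sup>2) :: complex)"
  proof -
    have "of_int (c * q\<^sup>2) = 3 * of_int a * (of_int q * r)\<^sup>2" using r(2) by (simp add: power_mult_distrib mult_ac)
    then show ?thesis unfolding rq by simp
  qed
  then have cq: "c * q\<^sup>2 = 3 * a * p\<^sup>2" by (simp only: of_int_eq_iff)
  have "of_int (b * q) = (of_int (- 3 * a * p) :: complex)"
  proof -
    have "of_int (b * q) = - 3 * of_int a * (of_int q * r)" using r(1) by (simp add: mult_ac)
    then show ?thesis unfolding rq by simp
  qed
  then have bq: "b * q = - 3 * a * p" by (simp only: of_int_eq_iff)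
  have "q ^ 3 dvd a * p ^ 3" using dq by (metis dvd_minus_iff dvd_triv_right mult_minus_left)
  moreover have "coprime (q ^ 3) (p ^ 3)" using cop by (simp add: coprime_commute)
  ultimately have "q ^ 3 dvd a" by (simp add: coprime_dvd_mult_left_iff)
  then obtain \<kappa> where \<kappa>: "a = \<kappa> * q ^ 3" by (metis dvdE mult.commute)
  have q3: "q ^ 3 \<noteq> 0" "q\<^sup>2 \<noteq> 0" using q0 by auto
  have "d * q ^ 3 = (- \<kappa> * p ^ 3) * q ^ 3" using dq unfolding \<kappa> by (simp add: mult_ac)
  then have d': "d = - \<kappa> * p ^ 3" using q3(1) by (simp only: mult_cancel_right) simp
  have "c * q\<^sup>2 = (3 * \<kappa> * p\<^sup>2 * q) * q\<^sup>2" using cq unfolding \<kappa> by (simp add: power2_eq_square power3_eq_cube mult_ac)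
  then have c': "c = 3 * \<kappa> * p\<^sup>2 * q" using q3(2) by (simp only: mult_cancel_right) simp
  have "b * q = (- 3 * \<kappa> * p * q\<^sup>2) * q" using bq unfolding \<kappa> by (simp add: power2_eq_square power3_eq_cube mult_ac)
  then have b': "b = - 3 * \<kappa> * p * q\<^sup>2" using q0 by (simp only: mult_cancel_right) simp
  have DD: "D = 1 \<or> D = -1" using D1 by linarith
  have "\<kappa> \<noteq> 0" "p \<noteq> 0" using nz \<kappa> d' by auto
  moreover have "p \<noteq> q"
  proof
    assume "p = q"
    then have "a + b + c + d = 0" unfolding \<kappa> b' c' d' by (simp add: power2_eq_square power3_eq_cube)
    then show False using nz by simp
  qed
  moreover have "D * (6 * p * q\<^sup>2 + 6 * p\<^sup>2 * q - 4 * q ^ 3 - 4 * p ^ 3) = 27 * \<kappa> * (p * q * (q - p))\<^sup>2"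
  proof -
    let ?E = "6 * p * q\<^sup>2 + 6 * p\<^sup>2 * q - 4 * q ^ 3 - 4 * p ^ 3"
    have BC: "n * l * (m - k) + (m * l + n * k) * (n - l) = b - D" "m * k * (n - l) + (m * l + n * k) * (m - k) = c + D"
      by (simp_all add: b_def c_def)
    have "(b - D)\<^sup>2 * (c + D)\<^sup>2 - 4 * a * (c + D) ^ 3 - 4 * (b - D) ^ 3 * d - 27 * a\<^sup>2 * d\<^sup>2 + 18 * a * (b - D) * (c + D) * d = D ^ 6"
      using discriminant_product_of_lines[of n l m k] unfolding BC a_def[symmetric] d_def[symmetric] D_def[symmetric] .
    then have "D ^ 4 + D ^ 3 * \<kappa> * ?E - 27 * D\<^sup>2 * \<kappa>\<^sup>2 * (p * q * (q - p))\<^sup>2 = D ^ 6"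
      unfolding \<kappa> b' c' d' discriminant_near_cube .
    moreover have cancel: "D * x = 27 * \<kappa> * y"
      if "D ^ 4 + D ^ 3 * \<kappa> * x - 27 * D\<^sup>2 * \<kappa>\<^sup>2 * y = D ^ 6" for x y
    proof -
      have "\<kappa> * (D * x) = \<kappa> * (27 * \<kappa> * y)"
        using DD that by (elim disjE) (simp_all add: power2_eq_square algebra_simps)
      then show ?thesis using \<open>\<kappa> \<noteq> 0\<close> by (simp only: mult_cancel_left) blast
    qed
    ultimately show ?thesis by blast
  qed
  ultimately show False using no_near_cube[OF cop DD] q0 by blast
qed

text \<open>When the triangle has no edge parallel to an edge of the standard triangle, the values of the contact cubic at
  \<open>0\<close> and \<open>1\<close> and its leading coefficient are nonzero, so a simple root is all that
  is needed.\<close>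

proposition triple_contact_no_common_edge:
  fixes m n k l :: int
  assumes B: "b \<in> B" "b + (m, n) \<in> B" "b + (k, l) \<in> B" and D: "\<bar>m * l - n * k\<bar> = 1"
    and h: "n \<noteq> 0" "l \<noteq> 0" "n \<noteq> l" and v: "m \<noteq> 0" "k \<noteq> 0" "m \<noteq> k"
    and e: "m + n \<noteq> 0" "k + l \<noteq> 0" "m + n \<noteq> k + l"
  shows "triple_contact B"
proof -
  define D' where "D' = m * l - n * k"
  define a where "a = n * l * (n - l)"
  define b' where "b' = n * l * (m - k) + (m * l + n * k) * (n - l) + D'"
  define c where "c = m * k * (n - l) + (m * l + n * k) * (m - k) - D'"
  define d where "d = m * k * (m - k)"
  have e1: "a + b' + c + d = (m + n) * (k + l) * (m + n - k - l)"
    unfolding a_def b'_def c_def d_def by (simp add: algebra_simps)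
  have nz: "a \<noteq> 0" "d \<noteq> 0" "a + b' + c + d \<noteq> 0" unfolding e1 unfolding a_def d_def using h v e by auto
  let ?u = "\<lambda>s. of_int m + of_int n * s :: complex" and ?w = "\<lambda>s. of_int k + of_int l * s :: complex"
  have P: "of_int a * s ^ 3 + of_int b' * s\<^sup>2 + of_int c * s + of_int d
      = ?u s * ?w s * (?u s - ?w s) - of_int D' * s * (1 - s)" for s
    unfolding a_def b'_def c_def d_def by (simp add: algebra_simps power2_eq_square power3_eq_cube)
  have P': "3 * of_int a * s\<^sup>2 + 2 * of_int b' * s + of_int c
      = of_int n * ?w s * (?u s - ?w s) + ?u s * of_int l * (?u s - ?w s) + ?u s * ?w s * (of_int n - of_int l) - of_int D' * (1 - 2 * s)" for s
    unfolding a_def b'_def c_def d_def by (simp add: algebra_simps power2_eq_square)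
  have "\<not> (\<exists>r :: complex. of_int b' = - 3 * of_int a * r \<and> of_int c = 3 * of_int a * r\<^sup>2 \<and> of_int d = - of_int a * r ^ 3)"
    using no_triple_root[of m l n k] D nz unfolding D'_def[symmetric] a_def[symmetric] b'_def[symmetric] c_def[symmetric] d_def[symmetric] by blast
  then obtain s :: complex where s: "of_int a * s ^ 3 + of_int b' * s\<^sup>2 + of_int c * s + of_int d = 0"
    "3 * of_int a * s\<^sup>2 + 2 * of_int b' * s + of_int c \<noteq> 0"
    using cubic_simple_root[of "of_int a" "of_int b'" "of_int c" "of_int d"] nz(1) by auto
  have "s \<noteq> 0" using s(1) nz(2) by auto
  moreover have "s \<noteq> 1"
  proof
    assume "s = 1"
    then have "of_int (a + b' + c + d) = (0 :: complex)" using s(1) by simp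
    then show False using nz(3) by (simp only: of_int_eq_0_iff)
  qed
  ultimately show ?thesis
    using s unfolding P P' D'_def by (intro triple_contact_trinomial[OF B, of s]) auto
qed

lemma wide_horizontal:
  assumes "wide {p, p + (1, 0), p + (k, \<epsilon>)}" "\<epsilon> = 1 \<or> \<epsilon> = -1"
  shows "(\<epsilon> = 1 \<and> (k \<ge> 2 \<or> k \<le> -2)) \<or> (\<epsilon> = -1 \<and> (k \<ge> 3 \<or> k \<le> -1))"
  using assms unfolding wide_def by auto

text \<open>With a common horizontal edge the contact condition degenerates to a quadratic equation, which is solved
  explicitly.\<close>

lemma triple_contact_horizontal:
  assumes B: "p \<in> B" "p + (1, 0) \<in> B" "p + (k, \<epsilon>) \<in> B" and \<epsilon>: "\<epsilon> = 1 \<or> \<epsilon> = -1"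
    and wide: "wide {p, p + (1, 0), p + (k, \<epsilon>)}"
  shows "triple_contact B"
proof -
  consider (up) "\<epsilon> = 1" "k \<ge> 2 \<or> k \<le> -2" | (down) "\<epsilon> = -1" "k \<ge> 3 \<or> k \<le> -1"
    using wide_horizontal[OF wide \<epsilon>] by blast
  then show ?thesis
  proof cases
  case up
  note e = up(1) and k = up(2)
  (* The contact condition is w (1 - w) = s (1 - s) for w = k + s, with the solution w = 1 - s. *)
  define s :: complex where "s = (1 - of_int k) / 2"
  have k2: "of_int k = 1 - 2 * s" by (simp add: s_def field_simps)
  have "s \<noteq> 0" "s \<noteq> 1"
  proof -
    have "of_int k \<noteq> (1 :: complex)" "of_int k \<noteq> (of_int (-1) :: complex)" using k by (auto simp only: of_int_eq_iff of_int_eq_1_iff)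
    then show "s \<noteq> 0" "s \<noteq> 1" unfolding k2 by auto
  qed
  have kn: "of_int k \<noteq> (0 :: complex)" using k by auto
  show "triple_contact B"
  proof (rule triple_contact_trinomial[OF B, of s])
    show "(of_int 1 + of_int 0 * s) * (of_int k + of_int \<epsilon> * s) * (of_int 1 + of_int 0 * s - (of_int k + of_int \<epsilon> * s))
        = of_int (1 * \<epsilon> - 0 * k) * s * (1 - s)" unfolding k2 e by (simp add: algebra_simps)
    have "of_int 0 * (of_int k + of_int \<epsilon> * s) * (of_int 1 + of_int 0 * s - (of_int k + of_int \<epsilon> * s)) +
      (of_int 1 + of_int 0 * s) * of_int \<epsilon> * (of_int 1 + of_int 0 * s - (of_int k + of_int \<epsilon> * s)) +
      (of_int 1 + of_int 0 * s) * (of_int k + of_int \<epsilon> * s) * (of_int 0 - of_int \<epsilon>) - of_int (1 * \<epsilon> - 0 * k) * (1 - 2 * s)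
      = - 2 * of_int k" unfolding e by (simp add: algebra_simps)
    then show "of_int 0 * (of_int k + of_int \<epsilon> * s) * (of_int 1 + of_int 0 * s - (of_int k + of_int \<epsilon> * s)) +
      (of_int 1 + of_int 0 * s) * of_int \<epsilon> * (of_int 1 + of_int 0 * s - (of_int k + of_int \<epsilon> * s)) +
      (of_int 1 + of_int 0 * s) * (of_int k + of_int \<epsilon> * s) * (of_int 0 - of_int \<epsilon>) - of_int (1 * \<epsilon> - 0 * k) * (1 - 2 * s)
      \<noteq> 0" using kn by simp
  qed fact+
next
  case down
  note e = down(1) and k = down(2)
  (* For w = k - s the condition is 2 s^2 - 2 k s + k^2 - k = 0, of discriminant 4 z^2. *)
  define z where "z = csqrt (of_int (k * (2 - k)))"
  have zz: "z * z = 2 * of_int k - of_int k * of_int k"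
    using power2_csqrt[of "of_int (k * (2 - k))"] by (simp add: z_def power2_eq_square algebra_simps)
  define s where "s = (of_int k + z) / 2"
  have z: "z = 2 * s - of_int k" by (simp add: s_def field_simps)
  have ss: "2 * (s * s) = 2 * of_int k * s + of_int k - of_int k * of_int k"
  proof -
    have "2 * (2 * (s * s)) = 2 * (2 * of_int k * s + of_int k - of_int k * of_int k)"
      using zz unfolding z by (simp add: algebra_simps)
    moreover have "(2 :: complex) \<noteq> 0" by simp
    ultimately show ?thesis using mult_left_cancel by blast
  qed
  have "k * (2 - k) \<noteq> 0" using k by auto
  then have "z \<noteq> 0" unfolding z_def by (simp only: csqrt_eq_0 of_int_eq_0_iff) simp
  have "s \<noteq> 0"
  proof
    assume "s = 0"
    then have "of_int (k * (1 - k)) = (0 :: complex)" using ss by (simp add: algebra_simps)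
    then have "k * (1 - k) = 0" by (simp only: of_int_eq_0_iff)
    then show False using k by auto
  qed
  have "s \<noteq> 1"
  proof
    assume "s = 1"
    then have "of_int ((k - 1) * (k - 2)) = (0 :: complex)" using ss by (simp add: algebra_simps)
    then have "(k - 1) * (k - 2) = 0" by (simp only: of_int_eq_0_iff)
    then show False using k by auto
  qed
  show "triple_contact B"
  proof (rule triple_contact_trinomial[OF B, of s])
    have "(of_int k - s) * (1 - (of_int k - s)) = - (s * (1 - s)) + (2 * of_int k * s + of_int k - of_int k * of_int k - 2 * (s * s))"
      by (simp add: algebra_simps)
    then show "(of_int 1 + of_int 0 * s) * (of_int k + of_int \<epsilon> * s) * (of_int 1 + of_int 0 * s - (of_int k + of_int \<epsilon> * s))
        = of_int (1 * \<epsilon> - 0 * k) * s * (1 - s)" unfolding ss e by simp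
    have "of_int 0 * (of_int k + of_int \<epsilon> * s) * (of_int 1 + of_int 0 * s - (of_int k + of_int \<epsilon> * s)) +
      (of_int 1 + of_int 0 * s) * of_int \<epsilon> * (of_int 1 + of_int 0 * s - (of_int k + of_int \<epsilon> * s)) +
      (of_int 1 + of_int 0 * s) * (of_int k + of_int \<epsilon> * s) * (of_int 0 - of_int \<epsilon>) - of_int (1 * \<epsilon> - 0 * k) * (1 - 2 * s)
      = - 2 * z" unfolding e z by (simp add: algebra_simps)
    then show "of_int 0 * (of_int k + of_int \<epsilon> * s) * (of_int 1 + of_int 0 * s - (of_int k + of_int \<epsilon> * s)) +
      (of_int 1 + of_int 0 * s) * of_int \<epsilon> * (of_int 1 + of_int 0 * s - (of_int k + of_int \<epsilon> * s)) +
      (of_int 1 + of_int 0 * s) * (of_int k + of_int \<epsilon> * s) * (of_int 0 - of_int \<epsilon>) - of_int (1 * \<epsilon> - 0 * k) * (1 - 2 * s)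
      \<noteq> 0" using \<open>z \<noteq> 0\<close> by simp
  qed fact+
  qed
qed

section \<open>Wide polygons admit order-three contact\<close>

text \<open>Symmetric in its arguments, unlike a vertex with a basis.\<close>

definition unimodular_triple :: "int \<times> int \<Rightarrow> int \<times> int \<Rightarrow> int \<times> int \<Rightarrow> bool"
  where "unimodular_triple p q r \<longleftrightarrow> \<bar>det2 (q - p) (r - p)\<bar> = 1"

lemma unimodular_triple_perm:
  assumes "unimodular_triple p q r"
  shows "unimodular_triple q p r" "unimodular_triple p r q" "unimodular_triple r q p"
proof -
  have "det2 (p - q) (r - q) = - det2 (q - p) (r - p)" "det2 (r - p) (q - p) = - det2 (q - p) (r - p)"
    "det2 (q - r) (p - r) = - det2 (q - p) (r - p)"
    by (simp_all add: det2_def algebra_simps)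
  then show "unimodular_triple q p r" "unimodular_triple p r q" "unimodular_triple r q p"
    using assms unfolding unimodular_triple_def by simp_all
qed

lemma unimodular_triple_flip: "unimodular_triple (flip p) (flip q) (flip r) \<longleftrightarrow> unimodular_triple p q r"
proof -
  have "det2 (flip q - flip p) (flip r - flip p) = - det2 (q - p) (r - p)"
    by (simp add: det2_def algebra_simps)
  then show ?thesis by (simp add: unimodular_triple_def)
qed

lemma unimodular_triple_turn: "unimodular_triple (turn p) (turn q) (turn r) \<longleftrightarrow> unimodular_triple p q r"
proof -
  have "det2 (turn q - turn p) (turn r - turn p) = - det2 (q - p) (r - p)"
    by (simp add: det2_def algebra_simps)
  then show ?thesis by (simp add: unimodular_triple_def)
qed

lemma triple_contact_triple_horizontal:
  assumes t: "unimodular_triple p q r" and w: "wide {p, q, r}" and h: "snd p = snd q"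
  shows "triple_contact {p, q, r}"
proof -
  have main: "triple_contact {p, q, r}" if t: "unimodular_triple p q r" and w: "wide {p, q, r}" and h: "snd p = snd q"
    and f: "fst q - fst p = 1" for p q r
  proof -
    have "det2 (q - p) (r - p) = snd r - snd p" using h f by (simp add: det2_def)
    then have "snd r - snd p = 1 \<or> snd r - snd p = -1" using t by (auto simp: unimodular_triple_def)
    moreover have q: "q = p + (1, 0)" using h f by (simp add: prod_eq_iff)
    moreover have r: "r = p + (fst r - fst p, snd r - snd p)" by (simp add: prod_eq_iff)
    ultimately show ?thesis
      using triple_contact_horizontal[of p "{p, q, r}" "fst r - fst p" "snd r - snd p"] w by simp
  qed
  have "det2 (q - p) (r - p) = (fst q - fst p) * (snd r - snd p)" using h by (simp add: det2_def)
  then have "\<bar>fst q - fst p\<bar> * \<bar>snd r - snd p\<bar> = 1" using t by (simp add: unimodular_triple_def abs_mult)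
  then have "\<bar>fst q - fst p\<bar> = 1" unfolding zmult_eq_1_iff by linarith
  then consider "fst q - fst p = 1" | "fst p - fst q = 1" by linarith
  then show ?thesis
  proof cases
    case 1
    then show ?thesis using main t w h by blast
  next
    case 2
    have "{q, p, r} = {p, q, r}" by blast
    then show ?thesis using main[OF unimodular_triple_perm(1)[OF t]] w h 2 by simp
  qed
qed

lemma triple_contact_triple_some_horizontal:
  assumes t: "unimodular_triple p q r" and w: "wide {p, q, r}" and h: "snd p = snd q \<or> snd p = snd r \<or> snd q = snd r"
  shows "triple_contact {p, q, r}"
proof -
  have s: "{p, r, q} = {p, q, r}" "{r, q, p} = {p, q, r}" by blast+
  show ?thesis
    using triple_contact_triple_horizontal[OF t w] triple_contact_triple_horizontal[OF unimodular_triple_perm(2)[OF t]]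
      triple_contact_triple_horizontal[OF unimodular_triple_perm(3)[OF t]] h w unfolding s by auto
qed

lemma triple_contact_triple_some_vertical:
  assumes t: "unimodular_triple p q r" and w: "wide {p, q, r}" and h: "fst p = fst q \<or> fst p = fst r \<or> fst q = fst r"
  shows "triple_contact {p, q, r}"
proof (rule triple_contact_flip)
  have "wide {flip p, flip q, flip r}" using wide_flip[OF w] by simp
  then have "triple_contact {flip p, flip q, flip r}"
    using t h by (intro triple_contact_triple_some_horizontal) (auto simp: unimodular_triple_flip)
  then show "triple_contact (flip ` {p, q, r})" by simp
qed

lemma triple_contact_triple_some_diagonal:
  assumes t: "unimodular_triple p q r" and w: "wide {p, q, r}"
    and h: "fst p + snd p = fst q + snd q \<or> fst p + snd p = fst r + snd r \<or> fst q + snd q = fst r + snd r"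
  shows "triple_contact {p, q, r}"
proof (rule triple_contact_turn)
  have "wide {turn p, turn q, turn r}" using wide_turn[OF w] by simp
  then have "triple_contact {turn p, turn q, turn r}"
    using t h by (intro triple_contact_triple_some_vertical) (auto simp: unimodular_triple_turn)
  then show "triple_contact (turn ` {p, q, r})" by simp
qed

text \<open>The symmetries of the standard triangle move any common edge direction to the horizontal one.\<close>

proposition triple_contact_wide_triple:
  assumes t: "unimodular_triple p q r" and w: "wide {p, q, r}"
  shows "triple_contact {p, q, r}"
proof -
  consider "snd p = snd q \<or> snd p = snd r \<or> snd q = snd r" | "fst p = fst q \<or> fst p = fst r \<or> fst q = fst r"
    | "fst p + snd p = fst q + snd q \<or> fst p + snd p = fst r + snd r \<or> fst q + snd q = fst r + snd r"
    | "snd p \<noteq> snd q" "snd p \<noteq> snd r" "snd q \<noteq> snd r" "fst p \<noteq> fst q" "fst p \<noteq> fst r" "fst q \<noteq> fst r"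
      "fst p + snd p \<noteq> fst q + snd q" "fst p + snd p \<noteq> fst r + snd r" "fst q + snd q \<noteq> fst r + snd r" by blast
  then show ?thesis
  proof cases
    case 4
    have "p + (fst q - fst p, snd q - snd p) = q" "p + (fst r - fst p, snd r - snd p) = r"
      by (simp_all add: prod_eq_iff)
    moreover have "\<bar>(fst q - fst p) * (snd r - snd p) - (snd q - snd p) * (fst r - fst p)\<bar> = 1"
      using t by (simp add: unimodular_triple_def det2_def)
    ultimately show ?thesis
      using 4 by (intro triple_contact_no_common_edge[of p _ "fst q - fst p" "snd q - snd p" "fst r - fst p" "snd r - snd p"]) auto
  qed (use t w triple_contact_triple_some_horizontal triple_contact_triple_some_vertical triple_contact_triple_some_diagonal in blast)+
qed

definition narrow_triples :: "(int \<times> int) set \<Rightarrow> bool"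
  where "narrow_triples B \<longleftrightarrow> (\<forall>p\<in>B. \<forall>q\<in>B. \<forall>r\<in>B. unimodular_triple p q r \<longrightarrow> \<not> wide {p, q, r})"

lemma narrow_triples_flip:
  assumes "narrow_triples B" shows "narrow_triples (flip ` B)"
  unfolding narrow_triples_def
proof (intro ballI impI)
  fix p' q' r' assume "p' \<in> flip ` B" "q' \<in> flip ` B" "r' \<in> flip ` B" and t: "unimodular_triple p' q' r'"
  then obtain p q r where e: "p \<in> B" "q \<in> B" "r \<in> B" "p' = flip p" "q' = flip q" "r' = flip r" by blast
  have "unimodular_triple p q r" using t unfolding e(4-6) unimodular_triple_flip .
  then have "\<not> wide {p, q, r}" using assms e(1-3) unfolding narrow_triples_def by blast
  then have "\<not> wide (flip ` {p, q, r})" unfolding wide_flip_iff .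
  then show "\<not> wide {p', q', r'}" unfolding e(4-6) by simp
qed

lemma narrow_triples_turn:
  assumes "narrow_triples B" shows "narrow_triples (turn ` B)"
  unfolding narrow_triples_def
proof (intro ballI impI)
  fix p' q' r' assume "p' \<in> turn ` B" "q' \<in> turn ` B" "r' \<in> turn ` B" and t: "unimodular_triple p' q' r'"
  then obtain p q r where e: "p \<in> B" "q \<in> B" "r \<in> B" "p' = turn p" "q' = turn q" "r' = turn r" by blast
  have "unimodular_triple p q r" using t unfolding e(4-6) unimodular_triple_turn .
  then have "\<not> wide {p, q, r}" using assms e(1-3) unfolding narrow_triples_def by blast
  then have "\<not> wide (turn ` {p, q, r})" unfolding wide_turn_iff .
  then show "\<not> wide {p', q', r'}" unfolding e(4-6) by simp
qed

lemma vimage_flip: "flip -` B = flip ` B"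
proof
  show "flip -` B \<subseteq> flip ` B" using flip_flip by (metis image_iff subsetI vimageE)
  show "flip ` B \<subseteq> flip -` B" using flip_flip by auto
qed

lemma vimage_turn: "turn -` B = turn ` B"
proof
  show "turn -` B \<subseteq> turn ` B" using turn_turn by (metis image_iff subsetI vimageE)
  show "turn ` B \<subseteq> turn -` B" using turn_turn by auto
qed

lemma lattice_convex_flip: "lattice_convex B \<Longrightarrow> lattice_convex (flip ` B)"
  using lattice_convex_vimage[of "(0, 1)" "(1, 0)" B "(0, 0)"]
  unfolding flip_def[symmetric] vimage_flip by (simp add: det2_def)

lemma lattice_convex_turn: "lattice_convex B \<Longrightarrow> lattice_convex (turn ` B)"
  using lattice_convex_vimage[of "(-1, 0)" "(-1, 1)" B "(1, 0)"]
  unfolding turn_def[symmetric] vimage_turn by (simp add: det2_def)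

text \<open>A primitive segment is an edge of a unimodular triangle in the set, which is not wide.\<close>

lemma narrow_primitive_difference:
  assumes B: "lattice_convex B" "narrow_triples B" and pq: "p \<in> B" "q \<in> B" and cop: "coprime (fst (q - p)) (snd (q - p))"
  shows "\<not> wide {p, q}" "\<exists>r\<in>B. \<bar>det2 (q - p) (r - p)\<bar> = 1"
proof -
  show ex: "\<exists>r\<in>B. \<bar>det2 (q - p) (r - p)\<bar> = 1" by (rule primitive_edge_extends[OF B(1) pq cop])
  then obtain r where "r \<in> B" "unimodular_triple p q r" by (auto simp: unimodular_triple_def)
  then have "\<not> wide {p, q, r}" using B(2) pq by (auto simp: narrow_triples_def)
  then show "\<not> wide {p, q}" using wide_mono[of "{p, q}" "{p, q, r}"] by auto
qed

text \<open>Four equally spaced points on a line have distinct columns, possibly after exchanging the coordinates.\<close>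

lemma triple_contact_four_collinear:
  assumes d: "d \<noteq> 0" and B: "\<And>j. 0 \<le> j \<Longrightarrow> j \<le> 3 \<Longrightarrow> (fst p + j * fst d, snd p + j * snd d) \<in> B"
  shows "triple_contact B"
proof -
  have main: "triple_contact B" if "fst d \<noteq> 0" and B: "\<And>j. 0 \<le> j \<Longrightarrow> j \<le> 3 \<Longrightarrow> (fst p + j * fst d, snd p + j * snd d) \<in> B"
    for B p d
    by (rule triple_contact_four_columns[OF B[of 0] B[of 1] B[of 2] B[of 3]]) (use that in auto)
  show ?thesis
  proof (cases "fst d = 0")
    case False
    then show ?thesis using main[of d p B] B by blast
  next
    case True
    then have "snd d \<noteq> 0" using d by (auto simp: prod_eq_iff zero_prod_def)
    have "triple_contact (flip ` B)"
    proof (rule main[of "flip d" "flip p"])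
      fix j :: int assume "0 \<le> j" "j \<le> 3"
      then have "flip (fst p + j * fst d, snd p + j * snd d) \<in> flip ` B" using B by blast
      moreover have "flip (fst p + j * fst d, snd p + j * snd d) = (fst (flip p) + j * fst (flip d), snd (flip p) + j * snd (flip d))"
        by (simp add: prod_eq_iff)
      ultimately show "(fst (flip p) + j * fst (flip d), snd (flip p) + j * snd (flip d)) \<in> flip ` B" by simp
    qed (use \<open>snd d \<noteq> 0\<close> in simp)
    then show ?thesis by (rule triple_contact_flip)
  qed
qed

text \<open>If two points are three columns apart, then the segment between them consists of two primitive steps of width
  two, for shorter steps lie too close and three steps give four points in a row. A point next to this segment
  lies in an odd column, so four columns are occupied.\<close>

lemma narrow_columns:
  assumes B: "lattice_convex B" "narrow_triples B" "\<not> triple_contact B" and pq: "p \<in> B" "q \<in> B"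
  shows "fst q - fst p \<le> 2"
proof (rule ccontr)
  assume far: "\<not> fst q - fst p \<le> 2"
  then have "p \<noteq> q" by auto
  obtain d g where d: "0 < g" "coprime (fst d) (snd d)" "fst q = fst p + g * fst d" "snd q = snd p + g * snd d"
    "\<And>j. 0 \<le> j \<Longrightarrow> j \<le> g \<Longrightarrow> (fst p + j * fst d, snd p + j * snd d) \<in> B"
    by (rule primitive_step[OF B(1) pq \<open>p \<noteq> q\<close>]) blast
  have d0: "d \<noteq> 0" using d(2) by (auto simp: zero_prod_def prod_eq_iff)
  have g: "g \<le> 2"
  proof (rule ccontr)
    assume "\<not> g \<le> 2"
    then have "triple_contact B" using d(5) by (intro triple_contact_four_collinear[OF d0, of p]) auto
    then show False using B(3) by blast
  qed
  define m where "m = p + d"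
  have mB: "m \<in> B" using d(5)[of 1] d(1) by (simp add: m_def plus_prod_def)
  have cop: "coprime (fst (m - p)) (snd (m - p))" using d(2) by (simp add: m_def)
  note nd = narrow_primitive_difference[OF B(1,2) pq(1) mB cop]
  have bound: "fst d + snd d \<le> 2" "fst d \<le> 2" "fst d - (fst d + snd d) \<le> 2" "snd d \<ge> -2" "- snd d \<le> 2"
    "fst d + snd d - fst d \<le> 2"
  proof -
    have "3 > fst q3 + snd q3 - fst q1 - snd q2" if "q1 \<in> {p, m}" "q2 \<in> {p, m}" "q3 \<in> {p, m}" for q1 q2 q3
      using nd(1) that unfolding wide_def by force
    from this[of p p m] this[of m p m] this[of p m m] this[of p m p] this[of m p p]
    show "fst d + snd d \<le> 2" "fst d \<le> 2" "fst d - (fst d + snd d) \<le> 2" "snd d \<ge> -2" "- snd d \<le> 2"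
      "fst d + snd d - fst d \<le> 2"
      by (auto simp: m_def)
  qed
  have "g = 1 \<or> g = 2" using d(1) g by linarith
  moreover have "g \<noteq> 1" using far d(3) bound(2) by auto
  ultimately have g2: "g = 2" by blast
  then have fd: "fst d = 2" using far d(3) bound(2) by auto
  obtain r where r: "r \<in> B" "\<bar>det2 d (r - p)\<bar> = 1" using nd(2) by (auto simp: m_def)
  (* A step of width two makes the determinant even unless r lies in an odd column. *)
  have odd: "odd (fst r - fst p)"
  proof
    assume "even (fst r - fst p)"
    then have "even (det2 d (r - p))" using fd by (simp add: det2_def)
    moreover have "det2 d (r - p) = 1 \<or> det2 d (r - p) = -1" using r(2) by linarith
    ultimately show False by auto
  qed
  have "triple_contact B"
  proof (rule triple_contact_four_columns[OF pq(1) mB pq(2) r(1)])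
    show "fst p \<noteq> fst m" "fst p \<noteq> fst q" "fst m \<noteq> fst q" using fd g2 d(3) by (auto simp: m_def)
    show "fst p \<noteq> fst r" using odd by auto
    show "fst m \<noteq> fst r"
    proof
      assume "fst m = fst r"
      then have "fst r - fst p = 2" using fd by (simp add: m_def)
      then show False using odd by simp
    qed
    show "fst q \<noteq> fst r"
    proof
      assume "fst q = fst r"
      then have "fst r - fst p = 4" using fd g2 d(3) by simp
      then show False using odd by simp
    qed
  qed
  then show False using B(3) by blast
qed

text \<open>The set spans at most three consecutive columns, rows and diagonals, but is wide. Hence the smallest triangle
  around it has size three or four and the contacts with its sides are not at vertices. Convexity then yields
  the inscribed configuration; for size four it is found in the corner triangle of size three at
  \<open>b\<close>.\<close>

proposition triple_contact_of_narrow_triples: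
  assumes B: "lattice_convex B" "narrow_triples B" "wide B"
  shows "triple_contact B"
proof (rule ccontr)
  assume ng: "\<not> triple_contact B"
  have X: "fst q - fst p \<le> 2" if "p \<in> B" "q \<in> B" for p q
    by (rule narrow_columns[OF B(1,2) ng that])
  have Y: "snd q - snd p \<le> 2" if "p \<in> B" "q \<in> B" for p q
    using narrow_columns[of "flip ` B" "flip p" "flip q"] that B ng triple_contact_flip[of B]
    by (auto simp: lattice_convex_flip narrow_triples_flip)
  have S: "(fst q + snd q) - (fst p + snd p) \<le> 2" if "p \<in> B" "q \<in> B" for p q
  proof -
    have "fst (turn p) - fst (turn q) \<le> 2"
      using that ng triple_contact_turn[of B]
      by (intro narrow_columns[OF lattice_convex_turn[OF B(1)] narrow_triples_turn[OF B(2)]]) auto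
    then show ?thesis by simp
  qed
  define mx where "mx = Min (fst ` B)"
  define my where "my = Min (snd ` B)"
  define ms where "ms = Max ((\<lambda>p. fst p + snd p) ` B)"
  have fin: "finite B" and ne: "B \<noteq> {}" using B(1) by (auto simp: lattice_convex_def)
  have in1: "mx \<in> fst ` B" "my \<in> snd ` B" and in2: "ms \<in> (\<lambda>p. fst p + snd p) ` B"
    unfolding mx_def my_def ms_def using fin ne
    by (simp_all only: Min_in Max_in finite_imageI image_is_empty not_False_eq_True)
  obtain p1 where p1: "p1 \<in> B" "fst p1 = mx" using in1(1) by blast
  obtain p2 where p2: "p2 \<in> B" "snd p2 = my" using in1(2) by blast
  obtain p3 where p3: "p3 \<in> B" "fst p3 + snd p3 = ms" using in2 by blast
  have le: "mx \<le> fst b" "my \<le> snd b" "fst b + snd b \<le> ms" if "b \<in> B" for b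
  proof -
    have "fst b \<in> fst ` B" "snd b \<in> snd ` B" "fst b + snd b \<in> (\<lambda>p. fst p + snd p) ` B"
      using that by blast+
    then show "mx \<le> fst b" "my \<le> snd b" "fst b + snd b \<le> ms"
      unfolding mx_def my_def ms_def using fin by (simp_all only: Min_le Max_ge finite_imageI)
  qed
  obtain q1 q2 q3 where q: "q1 \<in> B" "q2 \<in> B" "q3 \<in> B" "3 \<le> fst q3 + snd q3 - fst q1 - snd q2"
    using B(3) unfolding wide_def by blast
  have c3: "3 \<le> ms - mx - my" using le[OF q(1)] le[OF q(2)] le[OF q(3)] q(4) by linarith
  define b where "b = (mx, my)"
  have mid: "x \<in> B" if "p \<in> B" "q \<in> B" "2 * fst x = fst p + fst q" "2 * snd x = snd p + snd q" for p q x
    using that by (intro lattice_convexD[OF B(1) that(1,2,1), of 1 1 0]) auto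
  have third: "x \<in> B" if "p \<in> B" "q \<in> B" "r \<in> B" "3 * fst x = fst p + fst q + fst r" "3 * snd x = snd p + snd q + snd r" for p q r x
    using that by (intro lattice_convexD[OF B(1) that(1,2,3), of 1 1 1]) auto
  (* The positions of contact points on the three sides of the surrounding triangle. *)
  define y where "y = snd p1 - my"
  define x where "x = fst p2 - mx"
  define z where "z = fst p3 - mx"
  have y: "0 \<le> y" "y \<le> 2" using le(2)[OF p1(1)] Y[OF p2(1) p1(1)] p2(2) by (auto simp: y_def)
  have x: "0 \<le> x" "x \<le> 2" using le(1)[OF p2(1)] X[OF p1(1) p2(1)] p1(2) by (auto simp: x_def)
  have z: "0 \<le> z" "z \<le> 2" using le(1)[OF p3(1)] X[OF p1(1) p3(1)] p1(2) by (auto simp: z_def)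
  have z': "ms - mx - my - z \<le> 2" using Y[OF p2(1) p3(1)] p2(2) p3(2) by (simp add: z_def)
  have ys: "ms - mx - my - y \<le> 2" using S[OF p1(1) p3(1)] p1(2) p3(2) by (simp add: y_def)
  have xs: "ms - mx - my - x \<le> 2" using S[OF p2(1) p3(1)] p2(2) p3(2) by (simp add: x_def)
  have P1: "b + (0, y) \<in> B" using p1 by (simp add: b_def y_def plus_prod_def) (metis prod.collapse)
  have P2: "b + (x, 0) \<in> B" using p2 by (simp add: b_def x_def plus_prod_def) (metis prod.collapse)
  have P3: "b + (z, ms - mx - my - z) \<in> B"
  proof -
    have "b + (z, ms - mx - my - z) = p3" using p3(2) by (simp add: b_def z_def prod_eq_iff)
    then show ?thesis using p3(1) by simp
  qed
  have "ms - mx - my = 3 \<or> ms - mx - my = 4" using c3 z z' by linarith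
  then show False
  proof
    assume m: "ms - mx - my = 3"
    have xyz: "x = 1 \<or> x = 2" "y = 1 \<or> y = 2" "z = 1 \<or> z = 2" using m x y z z' xs ys by auto
    have P3': "b + (z, 3 - z) \<in> B" using P3 m by simp
    (* The centre of the triangle of size three is a midpoint or the barycentre of the contact points. *)
    have "b + (1, 1) \<in> B"
    proof -
      consider "x = 2" "y = 2" | "x = 1" "z = 1" | "y = 1" "z = 2" | "x = 2" "y = 1" "z = 1" | "x = 1" "y = 2" "z = 2"
        using xyz by blast
      then show ?thesis
      proof cases
        case 1 then show ?thesis using mid[OF P1 P2, of "b + (1, 1)"] by simp
      next
        case 2 then show ?thesis using mid[OF P2 P3', of "b + (1, 1)"] by simp
      next
        case 3 then show ?thesis using mid[OF P1 P3', of "b + (1, 1)"] by simp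
      next
        case 4 then show ?thesis using third[OF P1 P2 P3', of "b + (1, 1)"] by simp
      next
        case 5 then show ?thesis using third[OF P1 P2 P3', of "b + (1, 1)"] by simp
      qed
    qed
    then show False using triple_contact_inscribed[OF _ P2 P1 P3' xyz] ng by blast
  next
    assume m: "ms - mx - my = 4"
    have xyz: "x = 2" "y = 2" "z = 2" using m x y z z' xs ys by auto
    have P3': "b + (2, 2) \<in> B" using P3 m xyz by simp
    have 11: "b + (1, 1) \<in> B" using mid[OF P1 P2, of "b + (1, 1)"] xyz by simp
    have 12: "b + (1, 3 - 1) \<in> B" using mid[OF P1 P3', of "b + (1, 2)"] xyz by simp
    show False using triple_contact_inscribed[OF 11 _ _ 12, of 2 2] P1 P2 xyz ng by simp
  qed
qed

text \<open>Either a unimodular triangle of the set is itself wide and carries a trinomial, or all of them are narrow and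
  the shape of the set is restricted.\<close>

theorem triple_contact_of_wide:
  assumes "lattice_convex B" "wide B" shows "triple_contact B"
proof (cases "narrow_triples B")
  case True
  then show ?thesis using triple_contact_of_narrow_triples assms by blast
next
  case False
  then obtain p q r where "p \<in> B" "q \<in> B" "r \<in> B" "unimodular_triple p q r" "wide {p, q, r}"
    unfolding narrow_triples_def by blast
  then show ?thesis using triple_contact_mono[OF triple_contact_wide_triple, of p q r B] by blast
qed

section \<open>Rigidity of narrow pairs\<close>

definition unit_square :: "(int \<times> int) set" where "unit_square = {(0, 0), (1, 0), (0, 1), (1, 1)}"
definition long_triangle :: "(int \<times> int) set" where "long_triangle = {(0, 0), (1, 0), (2, 0), (0, 1)}"
definition double_triangle :: "(int \<times> int) set"
  where "double_triangle = {(0, 0), (1, 0), (0, 1), (2, 0), (1, 1), (0, 2)}"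

lemma eq_of_card_four: "B \<subseteq> X \<Longrightarrow> finite X \<Longrightarrow> card X \<le> 4 \<Longrightarrow> 4 \<le> card B \<Longrightarrow> B = X"
  by (rule card_seteq) linarith+

text \<open>Measured in the frame of any unimodular triangle of \<open>A\<close>, the polygon \<open>B\<close> has size at
  most two. The failure of this property is the case in which triple roots exist.\<close>

definition narrow :: "(int \<times> int) set \<Rightarrow> (int \<times> int) set \<Rightarrow> bool"
  where "narrow A B \<longleftrightarrow> (\<forall>a u v. \<bar>det2 u v\<bar> = 1 \<longrightarrow> {a, a + u, a + v} \<subseteq> A \<longrightarrow> \<not> wide (lattice_map 0 u v -` B))"

lemma narrowD:
  assumes "narrow A B" "\<bar>det2 u v\<bar> = 1" "{a, a + u, a + v} \<subseteq> A" "p1 \<in> B" "p2 \<in> B" "p3 \<in> B"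
  shows "fst (coord u v p3) + snd (coord u v p3) - fst (coord u v p1) - snd (coord u v p2) \<le> 2"
proof -
  have m: "coord u v p \<in> lattice_map 0 u v -` B" if "p \<in> B" for p
    using that lattice_map_coord[OF assms(2), of p] by simp
  have "\<not> wide (lattice_map 0 u v -` B)" using assms unfolding narrow_def by blast
  then show ?thesis using m[OF assms(4)] m[OF assms(5)] m[OF assms(6)] unfolding wide_def by force
qed

lemma lattice_map_image_vimage:
  assumes "\<bar>det2 u v\<bar> = 1" shows "lattice_map b u v ` (lattice_map b u v -` B) = B"
proof -
  have "x \<in> range (lattice_map b u v)" for x using lattice_map_surj[OF assms, of x b] by blast
  then show ?thesis by (auto simp: image_vimage_eq)
qed

lemma wide_translate:
  assumes "wide S" shows "wide ((+) t ` S)"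
proof -
  obtain q1 q2 q3 where q: "q1 \<in> S" "q2 \<in> S" "q3 \<in> S" "3 \<le> fst q3 + snd q3 - fst q1 - snd q2"
    using assms unfolding wide_def by blast
  have "3 \<le> fst (t + q3) + snd (t + q3) - fst (t + q1) - snd (t + q2)" using q(4) by simp
  then show ?thesis unfolding wide_def using q(1-3) by blast
qed

text \<open>The frames of triangles in the preimage are preimages of frames, up to a translation that does not affect
  widths.\<close>

lemma narrow_vimage:
  assumes n: "narrow A B" and xy: "\<bar>det2 x y\<bar> = 1"
  shows "narrow (lattice_map a x y -` A) (lattice_map b x y -` B)"
  unfolding narrow_def
proof (intro allI impI notI)
  fix c u v assume uv: "\<bar>det2 u v\<bar> = 1" and c: "{c, c + u, c + v} \<subseteq> lattice_map a x y -` A"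
    and w: "wide (lattice_map 0 u v -` (lattice_map b x y -` B))"
  let ?u = "lattice_map 0 x y u" and ?v = "lattice_map 0 x y v"
  have d: "\<bar>det2 ?u ?v\<bar> = 1" using uv xy by (simp add: det2_compose abs_mult)
  have "{lattice_map a x y c, lattice_map a x y c + ?u, lattice_map a x y c + ?v} \<subseteq> A"
    using c by (auto simp: lattice_map_add[symmetric])
  then have "\<not> wide (lattice_map 0 ?u ?v -` B)" using n d unfolding narrow_def by blast
  moreover have "(+) (coord ?u ?v b) ` (lattice_map 0 u v -` (lattice_map b x y -` B)) \<subseteq> lattice_map 0 ?u ?v -` B"
  proof
    fix z assume "z \<in> (+) (coord ?u ?v b) ` (lattice_map 0 u v -` (lattice_map b x y -` B))"
    then obtain q where q: "lattice_map b x y (lattice_map 0 u v q) \<in> B" "z = coord ?u ?v b + q" by blast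
    have "lattice_map 0 ?u ?v z = b + lattice_map 0 ?u ?v q"
      unfolding q(2) lattice_map_add lattice_map_coord[OF d] by simp
    also have "\<dots> = lattice_map b x y (lattice_map 0 u v q)"
      unfolding lattice_map_compose by (simp add: lattice_map_def prod_eq_iff algebra_simps)
    finally show "z \<in> lattice_map 0 ?u ?v -` B" using q(1) by simp
  qed
  moreover have "wide ((+) (coord ?u ?v b) ` (lattice_map 0 u v -` (lattice_map b x y -` B)))"
    using w by (rule wide_translate)
  ultimately show False using wide_mono[of "(+) (coord ?u ?v b) ` (lattice_map 0 u v -` (lattice_map b x y -` B))"] by simp
qed

definition twins :: "(int \<times> int) set \<Rightarrow> (int \<times> int) set \<Rightarrow> (int \<times> int) set \<Rightarrow> bool"
  where "twins S A B \<longleftrightarrow> (\<exists>a b x y. \<bar>det2 x y\<bar> = 1 \<and> A = lattice_map a x y ` S \<and> B = lattice_map b x y ` S)"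

lemma twins_commute: "twins S A B \<Longrightarrow> twins S B A"
  unfolding twins_def by blast

lemma twins_vimage:
  assumes t: "twins S (lattice_map a x y -` A) (lattice_map b x y -` B)" and xy: "\<bar>det2 x y\<bar> = 1"
  shows "twins S A B"
proof -
  obtain c d u v where uv: "\<bar>det2 u v\<bar> = 1" and e: "lattice_map a x y -` A = lattice_map c u v ` S"
    "lattice_map b x y -` B = lattice_map d u v ` S" using t unfolding twins_def by (elim exE conjE)
  have "A = lattice_map (lattice_map a x y c) (lattice_map 0 x y u) (lattice_map 0 x y v) ` S"
    by (rule lattice_map_image_vimage[OF xy, of a A, unfolded e image_image lattice_map_compose, symmetric])
  moreover have "B = lattice_map (lattice_map b x y d) (lattice_map 0 x y u) (lattice_map 0 x y v) ` S"
    by (rule lattice_map_image_vimage[OF xy, of b B, unfolded e image_image lattice_map_compose, symmetric])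
  moreover have "\<bar>det2 (lattice_map 0 x y u) (lattice_map 0 x y v)\<bar> = 1" using uv xy by (simp add: det2_compose abs_mult)
  ultimately show ?thesis unfolding twins_def by (intro exI conjI)
qed

lemma lattice_convex_not_collinear:
  assumes B: "lattice_convex B" and d: "d \<noteq> 0" and z: "\<And>p q. p \<in> B \<Longrightarrow> q \<in> B \<Longrightarrow> det2 d (q - p) = 0"
  shows False
proof -
  obtain p q r where "p \<in> B" "q \<in> B" "r \<in> B" "det2 (q - p) (r - p) \<noteq> 0"
    using B by (auto simp: lattice_convex_def)
  then show False using det2_parallel[of d "q - p" "r - p"] z d by blast
qed

lemma lattice_map_std: "lattice_map a (1, 0) (0, 1) c = a + c"
  by (simp add: lattice_map_def prod_eq_iff)

text \<open>The unit square contains four unimodular triangles, one per corner. Narrowness with respect to each of them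
  confines \<open>B\<close> to a translated unit square, and four points fill it.\<close>

lemma square_forces_square:
  assumes n: "narrow A B" and A: "(+) a ` unit_square \<subseteq> A" and B: "lattice_convex B" and card: "4 \<le> card B"
  shows "\<exists>b. B = (+) b ` unit_square"
proof -
  have c1: "fst r + snd r - fst p - snd q \<le> 2" and c2: "- fst r - snd r + fst p + snd q \<le> 2"
    and c3: "- fst r + snd r + fst p - snd q \<le> 2" and c4: "fst r - snd r - fst p + snd q \<le> 2"
    if "p \<in> B" "q \<in> B" "r \<in> B" for p q r
  proof -
    have "a + (0, 0) = a" by (simp add: prod_eq_iff)
    then show "fst r + snd r - fst p - snd q \<le> 2"
      using narrowD[OF n _ _ that, of "(1, 0)" "(0, 1)" a] A by (simp add: coord_def det2_def unit_square_def)
    show "- fst r - snd r + fst p + snd q \<le> 2"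
      using narrowD[OF n _ _ that, of "(-1, 0)" "(0, -1)" "a + (1, 1)"] A
      by (simp add: coord_def det2_def unit_square_def plus_prod_def)
    show "- fst r + snd r + fst p - snd q \<le> 2"
      using narrowD[OF n _ _ that, of "(-1, 0)" "(0, 1)" "a + (1, 0)"] A
      by (simp add: coord_def det2_def unit_square_def plus_prod_def)
    show "fst r - snd r - fst p + snd q \<le> 2"
      using narrowD[OF n _ _ that, of "(1, 0)" "(0, -1)" "a + (0, 1)"] A
      by (simp add: coord_def det2_def unit_square_def plus_prod_def)
  qed
  have wx: "fst q - fst p \<le> 1" if pq: "p \<in> B" "q \<in> B" for p q
  proof (rule ccontr)
    assume "\<not> fst q - fst p \<le> 1"
    then have "snd r = snd q" if "r \<in> B" for r
      using c1[OF pq(1) that pq(2)] c4[OF pq(1) that pq(2)] by linarith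
    then show False by (intro lattice_convex_not_collinear[OF B, of "(1, 0)"]) (auto simp: det2_def zero_prod_def)
  qed
  have wy: "snd q - snd p \<le> 1" if pq: "p \<in> B" "q \<in> B" for p q
  proof (rule ccontr)
    assume "\<not> snd q - snd p \<le> 1"
    then have "fst r = fst q" if "r \<in> B" for r
      using c1[OF that pq(1) pq(2)] c3[OF that pq(1) pq(2)] by linarith
    then show False by (intro lattice_convex_not_collinear[OF B, of "(0, 1)"]) (auto simp: det2_def zero_prod_def)
  qed
  have fin: "finite B" and ne: "B \<noteq> {}" using B by (auto simp: lattice_convex_def)
  define mx where "mx = Min (fst ` B)"
  define my where "my = Min (snd ` B)"
  have in1: "mx \<in> fst ` B" "my \<in> snd ` B"
    unfolding mx_def my_def using fin ne
    by (simp_all only: Min_in finite_imageI image_is_empty not_False_eq_True)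
  obtain p1 where p1: "p1 \<in> B" "fst p1 = mx" using in1(1) by blast
  obtain p2 where p2: "p2 \<in> B" "snd p2 = my" using in1(2) by blast
  have le: "mx \<le> fst b" "my \<le> snd b" if "b \<in> B" for b
  proof -
    have "fst b \<in> fst ` B" "snd b \<in> snd ` B" using that by blast+
    then show "mx \<le> fst b" "my \<le> snd b" unfolding mx_def my_def using fin by (simp_all only: Min_le finite_imageI)
  qed
  have sub: "B \<subseteq> (+) (mx, my) ` unit_square"
  proof
    fix b assume b: "b \<in> B"
    have "fst b - mx = 0 \<or> fst b - mx = 1" "snd b - my = 0 \<or> snd b - my = 1"
      using le[OF b] wx[OF p1(1) b] wy[OF p2(1) b] p1(2) p2(2) by linarith+
    then have "(fst b - mx, snd b - my) \<in> unit_square" by (auto simp: unit_square_def)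
    then show "b \<in> (+) (mx, my) ` unit_square" by (rule image_eqI[rotated]) (simp add: prod_eq_iff)
  qed
  have fin4: "finite unit_square" by (simp add: unit_square_def)
  have "card ((+) (mx, my) ` unit_square) \<le> card unit_square" by (rule card_image_le[OF fin4])
  also have "\<dots> \<le> 4" by (simp add: unit_square_def)
  finally have "B = (+) (mx, my) ` unit_square" by (rule eq_of_card_four[OF sub finite_imageI[OF fin4] _ card])
  then show ?thesis by blast
qed

text \<open>By symmetry the other polygon also contains a square in the same frame, so each determines the other.\<close>

lemma twins_square_std:
  assumes n: "narrow A B" "narrow B A" and A: "(+) a ` unit_square \<subseteq> A"
    and LC: "lattice_convex A" "lattice_convex B" and card: "4 \<le> card A" "4 \<le> card B"
  shows "twins unit_square A B"
proof -
  obtain b where b: "B = (+) b ` unit_square" using square_forces_square[OF n(1) A LC(2) card(2)] by blast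
  obtain a' where a': "A = (+) a' ` unit_square" using square_forces_square[OF n(2) _ LC(1) card(1), of b] b by blast
  have "\<bar>det2 (1, 0) (0, 1)\<bar> = 1" by (simp add: det2_def)
  moreover have "lattice_map c (1, 0) (0, 1) = (+) c" for c by (rule ext) (rule lattice_map_std)
  ultimately show ?thesis unfolding twins_def a' b
    by (intro exI[of _ a'] exI[of _ b] exI[of _ "(1, 0)"] exI[of _ "(0, 1)"]) simp
qed

lemma card_vimage_lattice_map:
  assumes "\<bar>det2 x y\<bar> = 1" shows "card (lattice_map a x y -` A) = card A"
proof -
  have "card (lattice_map a x y ` (lattice_map a x y -` A)) = card (lattice_map a x y -` A)"
    by (intro card_image inj_on_subset[OF lattice_map_inj[OF assms]]) auto
  then show ?thesis unfolding lattice_map_image_vimage[OF assms] by simp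
qed

lemma twins_square:
  assumes n: "narrow A B" "narrow B A" and xy: "\<bar>det2 x y\<bar> = 1" and A: "lattice_map a x y ` unit_square \<subseteq> A"
    and LC: "lattice_convex A" "lattice_convex B" and card: "4 \<le> card A" "4 \<le> card B"
  shows "twins unit_square A B"
proof (rule twins_vimage[OF _ xy, of _ a _ 0])
  show "twins unit_square (lattice_map a x y -` A) (lattice_map 0 x y -` B)"
  proof (rule twins_square_std[of _ _ 0])
    show "(+) 0 ` unit_square \<subseteq> lattice_map a x y -` A" using A by auto
  qed (use n xy LC card in \<open>simp_all add: narrow_vimage lattice_convex_vimage card_vimage_lattice_map\<close>)
qed

text \<open>The bounding lines on the two legs fix the position of the triangle.\<close>

lemma not_wide_in_double_triangle:
  assumes "\<not> wide B" "finite B" "B \<noteq> {}"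
  obtains b where "B \<subseteq> (+) b ` double_triangle" "\<exists>p\<in>B. fst p = fst b" "\<exists>p\<in>B. snd p = snd b"
proof -
  define mx where "mx = Min (fst ` B)"
  define my where "my = Min (snd ` B)"
  have in1: "mx \<in> fst ` B" "my \<in> snd ` B"
    unfolding mx_def my_def using assms(2,3)
    by (simp_all only: Min_in finite_imageI image_is_empty not_False_eq_True)
  obtain p1 where p1: "p1 \<in> B" "fst p1 = mx" using in1(1) by blast
  obtain p2 where p2: "p2 \<in> B" "snd p2 = my" using in1(2) by blast
  have le: "mx \<le> fst b" "my \<le> snd b" "fst b + snd b \<le> mx + my + 2" if "b \<in> B" for b
  proof -
    have "fst b \<in> fst ` B" "snd b \<in> snd ` B" using that by blast+
    then show "mx \<le> fst b" "my \<le> snd b" unfolding mx_def my_def using assms(2) by (simp_all only: Min_le finite_imageI)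
    have "\<not> 3 \<le> fst b + snd b - fst p1 - snd p2" using assms(1) p1 p2 that unfolding wide_def by blast
    then show "fst b + snd b \<le> mx + my + 2" using p1(2) p2(2) by linarith
  qed
  have "B \<subseteq> (+) (mx, my) ` double_triangle"
  proof
    fix b assume b: "b \<in> B"
    have "(fst b - mx = 0 \<or> fst b - mx = 1 \<or> fst b - mx = 2)" "(snd b - my = 0 \<or> snd b - my = 1 \<or> snd b - my = 2)"
      "(fst b - mx) + (snd b - my) \<le> 2"
      using le[OF b] by linarith+
    then have "(fst b - mx, snd b - my) \<in> double_triangle" by (auto simp: double_triangle_def)
    then show "b \<in> (+) (mx, my) ` double_triangle" by (rule image_eqI[rotated]) (simp add: prod_eq_iff)
  qed
  then show ?thesis using that[of "(mx, my)"] p1 p2 by auto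
qed

text \<open>The two unimodular triangles on the long edge exclude the apex of the double triangle and leave five points.
  The point \<open>b + (1, 1)\<close> excludes \<open>b\<close>, so that four points remain in each case.\<close>

lemma long_triangle_forces:
  assumes n: "narrow A B" and A: "(+) a ` long_triangle \<subseteq> A" and B: "lattice_convex B" and card: "4 \<le> card B"
  shows "(\<exists>b. B = (+) b ` long_triangle) \<or> (\<exists>b. lattice_map b (1, 0) (-1, 1) ` unit_square \<subseteq> B)"
proof -
  have c1: "fst r + snd r - fst p - snd q \<le> 2" and c2: "fst r + 2 * snd r - fst p - snd p - snd q \<le> 2"
    if "p \<in> B" "q \<in> B" "r \<in> B" for p q r
  proof -
    have "a + (0, 0) = a" by (simp add: prod_eq_iff)
    then show "fst r + snd r - fst p - snd q \<le> 2"
      using narrowD[OF n _ _ that, of "(1, 0)" "(0, 1)" a] A by (simp add: coord_def det2_def long_triangle_def)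
    have e: "a + (1, 0) + (1, 0) = a + (2, 0)" "a + (1, 0) + (-1, 1) = a + (0, 1)" by (simp_all add: prod_eq_iff)
    have "{a + (1, 0), a + (1, 0) + (1, 0), a + (1, 0) + (-1, 1)} \<subseteq> A"
      using A unfolding e long_triangle_def by blast
    from narrowD[OF n _ this that] show "fst r + 2 * snd r - fst p - snd p - snd q \<le> 2"
      by (simp add: coord_def det2_def)
  qed
  have "\<not> wide B" using c1 unfolding wide_def by force
  moreover have fin: "finite B" "B \<noteq> {}" using B by (auto simp: lattice_convex_def)
  ultimately obtain b where b: "B \<subseteq> (+) b ` double_triangle" "\<exists>p\<in>B. fst p = fst b" "\<exists>p\<in>B. snd p = snd b"
    using not_wide_in_double_triangle by blast
  obtain p2 where p2: "p2 \<in> B" "snd p2 = snd b" using b(3) by blast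
  have sum: "fst q + snd q \<le> fst b + snd b + 2" if "q \<in> B" for q
    using b(1) that by (auto simp: double_triangle_def)
  have no02: "b + (0, 2) \<notin> B"
  proof
    assume m: "b + (0, 2) \<in> B"
    have "fst p + snd p = fst b + snd b + 2" if "p \<in> B" for p
      using c2[OF that p2(1) m] p2(2) sum[OF that] by simp
    then have "fst p + snd p = fst q + snd q" if "p \<in> B" "q \<in> B" for p q using that by simp
    then show False
      by (intro lattice_convex_not_collinear[OF B, of "(1, -1)"]) (fastforce simp: det2_def zero_prod_def)+
  qed
  have mem: "q = b \<or> q = b + (1, 0) \<or> q = b + (0, 1) \<or> q = b + (2, 0) \<or> q = b + (1, 1)" if "q \<in> B" for q
    using b(1) that no02 by (auto simp: double_triangle_def plus_prod_def)
  show ?thesis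
  proof (cases "b + (1, 1) \<in> B")
    case True
    have "fst b + snd b + 1 \<le> fst p + snd p" if "p \<in> B" for p
      using c2[OF that p2(1) True] p2(2) by simp
    then have "b \<notin> B" by fastforce
    then have sub: "B \<subseteq> {b + (1, 0), b + (0, 1), b + (2, 0), b + (1, 1)}" using mem by blast
    have "card {b + (1, 0), b + (0, 1), b + (2, 0), b + (1, 1)} \<le> 4" by (simp add: card_insert_if)
    then have "B = {b + (1, 0), b + (0, 1), b + (2, 0), b + (1, 1)}"
      by (intro eq_of_card_four[OF sub _ _ card]) simp_all
    moreover have "lattice_map (b + (1, 0)) (1, 0) (-1, 1) ` unit_square = {b + (1, 0), b + (0, 1), b + (2, 0), b + (1, 1)}"
      by (auto simp: unit_square_def lattice_map_def plus_prod_def add_ac)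
    ultimately show ?thesis by blast
  next
    case False
    then have "B \<subseteq> {b, b + (1, 0), b + (0, 1), b + (2, 0)}" using mem by blast
    also have e: "{b, b + (1, 0), b + (0, 1), b + (2, 0)} = (+) b ` long_triangle"
      by (auto simp: long_triangle_def plus_prod_def)
    finally have sub: "B \<subseteq> (+) b ` long_triangle" .
    have fin4: "finite long_triangle" by (simp add: long_triangle_def)
    have "card ((+) b ` long_triangle) \<le> card long_triangle" by (rule card_image_le[OF fin4])
    also have "\<dots> \<le> 4" by (simp add: long_triangle_def)
    finally have "B = (+) b ` long_triangle" by (rule eq_of_card_four[OF sub finite_imageI[OF fin4] _ card])
    then show ?thesis by blast
  qed
qed

text \<open>If neither polygon contains the sheared unit square, each is determined by the other.\<close>

lemma twins_long_std:
  assumes n: "narrow A B" "narrow B A" and A: "(+) a ` long_triangle \<subseteq> A"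
    and LC: "lattice_convex A" "lattice_convex B" and card: "4 \<le> card A" "4 \<le> card B"
  shows "twins unit_square A B \<or> twins long_triangle A B"
proof -
  have d: "\<bar>det2 (1, 0) (-1, 1)\<bar> = 1" "\<bar>det2 (1, 0) (0, 1)\<bar> = 1" by (simp_all add: det2_def)
  show ?thesis
  proof (cases "\<exists>b. lattice_map b (1, 0) (-1, 1) ` unit_square \<subseteq> B")
    case True
    then show ?thesis using twins_commute[OF twins_square[OF n(2,1) d(1) _ LC(2,1) card(2,1)]] by blast
  next
    case False
    then obtain b where b: "B = (+) b ` long_triangle" using long_triangle_forces[OF n(1) A LC(2) card(2)] by blast
    show ?thesis
    proof (cases "\<exists>b. lattice_map b (1, 0) (-1, 1) ` unit_square \<subseteq> A")
      case True
      then show ?thesis using twins_square[OF n d(1) _ LC card] by blast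
    next
      case False
      then obtain a' where a': "A = (+) a' ` long_triangle"
        using long_triangle_forces[OF n(2) _ LC(1) card(1), of b] b by blast
      have "lattice_map c (1, 0) (0, 1) = (+) c" for c by (rule ext) (rule lattice_map_std)
      then have "twins long_triangle A B" unfolding twins_def a' b using d(2)
        by (intro exI[of _ a'] exI[of _ b] exI[of _ "(1, 0)"] exI[of _ "(0, 1)"]) simp
      then show ?thesis ..
    qed
  qed
qed

lemma twins_long:
  assumes n: "narrow A B" "narrow B A" and xy: "\<bar>det2 x y\<bar> = 1" and A: "lattice_map a x y ` long_triangle \<subseteq> A"
    and LC: "lattice_convex A" "lattice_convex B" and card: "4 \<le> card A" "4 \<le> card B"
  shows "twins unit_square A B \<or> twins long_triangle A B"
proof -
  have "twins unit_square (lattice_map a x y -` A) (lattice_map 0 x y -` B) \<or>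
      twins long_triangle (lattice_map a x y -` A) (lattice_map 0 x y -` B)"
  proof (rule twins_long_std[of _ _ 0])
    show "(+) 0 ` long_triangle \<subseteq> lattice_map a x y -` A" using A by auto
  qed (use n xy LC card in \<open>simp_all add: narrow_vimage lattice_convex_vimage card_vimage_lattice_map\<close>)
  then show ?thesis using twins_vimage[OF _ xy] by blast
qed

section \<open>The two cases for a pair of polygons\<close>

text \<open>At most two of the six points are missing, and convexity supplies the midpoint of any two vertices present.
  Two vertices with their midpoint and another midpoint form a long triangle, while one vertex with the three
  midpoints forms a parallelogram.\<close>

lemma four_points_of_double_triangle:
  assumes S: "lattice_convex S" "S \<subseteq> double_triangle" and card: "4 \<le> card S"
  shows "\<exists>a x y. \<bar>det2 x y\<bar> = 1 \<and> (lattice_map a x y ` unit_square \<subseteq> S \<or> lattice_map a x y ` long_triangle \<subseteq> S)"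
proof -
  have mid: "(i, j) \<in> S" if "p \<in> S" "q \<in> S" "2 * i = fst p + fst q" "2 * j = snd p + snd q" for p q i j
    using lattice_convexD[OF S(1) that(1,2,2), of 1 1 0 "(i, j)"] that(3,4) by simp
  have nm: "p \<in> S \<or> q \<in> S \<or> r \<in> S" if "card (double_triangle - {p, q, r}) \<le> 3" for p q r
  proof (rule ccontr)
    assume "\<not> (p \<in> S \<or> q \<in> S \<or> r \<in> S)"
    then have "S \<subseteq> double_triangle - {p, q, r}" using S(2) by blast
    then have "card S \<le> card (double_triangle - {p, q, r})" by (rule card_mono[rotated]) (simp add: double_triangle_def)
    then show False using that card by linarith
  qed
  have edges: "(0, 0) \<in> S \<Longrightarrow> (2, 0) \<in> S \<Longrightarrow> (1, 0) \<in> S" "(0, 0) \<in> S \<Longrightarrow> (0, 2) \<in> S \<Longrightarrow> (0, 1) \<in> S"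
    "(2, 0) \<in> S \<Longrightarrow> (0, 2) \<in> S \<Longrightarrow> (1, 1) \<in> S"
    using mid[of "(0, 0)" "(2, 0)" 1 0] mid[of "(0, 0)" "(0, 2)" 0 1] mid[of "(2, 0)" "(0, 2)" 1 1] by simp_all
  have present: "(0, 1) \<in> S \<or> (1, 1) \<in> S \<or> (0, 2) \<in> S" "(1, 0) \<in> S \<or> (1, 1) \<in> S \<or> (2, 0) \<in> S"
    "(1, 0) \<in> S \<or> (0, 1) \<in> S \<or> (0, 0) \<in> S" "(0, 0) \<in> S \<or> (2, 0) \<in> S \<or> (0, 2) \<in> S"
    "(2, 0) \<in> S \<or> (0, 2) \<in> S \<or> (1, 0) \<in> S" "(2, 0) \<in> S \<or> (0, 2) \<in> S \<or> (0, 1) \<in> S"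
    "(2, 0) \<in> S \<or> (0, 2) \<in> S \<or> (1, 1) \<in> S" "(0, 0) \<in> S \<or> (0, 2) \<in> S \<or> (1, 0) \<in> S"
    "(0, 0) \<in> S \<or> (0, 2) \<in> S \<or> (0, 1) \<in> S" "(0, 0) \<in> S \<or> (0, 2) \<in> S \<or> (1, 1) \<in> S"
    "(0, 0) \<in> S \<or> (2, 0) \<in> S \<or> (1, 0) \<in> S" "(0, 0) \<in> S \<or> (2, 0) \<in> S \<or> (0, 1) \<in> S"
    "(0, 0) \<in> S \<or> (2, 0) \<in> S \<or> (1, 1) \<in> S"
    by (rule nm, simp add: double_triangle_def insert_Diff_if)+
  consider (square0) "(0, 0) \<in> S" "(1, 0) \<in> S" "(0, 1) \<in> S" "(1, 1) \<in> S"
    | (square1) "(1, 0) \<in> S" "(2, 0) \<in> S" "(0, 1) \<in> S" "(1, 1) \<in> S"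
    | (square2) "(0, 1) \<in> S" "(0, 2) \<in> S" "(1, 0) \<in> S" "(1, 1) \<in> S"
    | (long1) "(0, 0) \<in> S" "(1, 0) \<in> S" "(2, 0) \<in> S" "(0, 1) \<in> S"
    | (long2) "(2, 0) \<in> S" "(1, 0) \<in> S" "(0, 0) \<in> S" "(1, 1) \<in> S"
    | (long3) "(0, 0) \<in> S" "(0, 1) \<in> S" "(0, 2) \<in> S" "(1, 0) \<in> S"
    | (long4) "(0, 2) \<in> S" "(0, 1) \<in> S" "(0, 0) \<in> S" "(1, 1) \<in> S"
    | (long5) "(2, 0) \<in> S" "(1, 1) \<in> S" "(0, 2) \<in> S" "(1, 0) \<in> S"
    | (long6) "(0, 2) \<in> S" "(1, 1) \<in> S" "(2, 0) \<in> S" "(0, 1) \<in> S"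
    using edges present by argo
  then show ?thesis
  proof cases
    case square0
    then show ?thesis by (intro exI[of _ "(0, 0)"] exI[of _ "(1, 0)"] exI[of _ "(0, 1)"])
      (simp add: det2_def lattice_map_def unit_square_def)
  next
    case square1
    then show ?thesis by (intro exI[of _ "(1, 0)"] exI[of _ "(1, 0)"] exI[of _ "(-1, 1)"])
      (simp add: det2_def lattice_map_def unit_square_def)
  next
    case square2
    then show ?thesis by (intro exI[of _ "(0, 1)"] exI[of _ "(0, 1)"] exI[of _ "(1, -1)"])
      (simp add: det2_def lattice_map_def unit_square_def)
  next
    case long1
    then show ?thesis by (intro exI[of _ "(0, 0)"] exI[of _ "(1, 0)"] exI[of _ "(0, 1)"])
      (simp add: det2_def lattice_map_def long_triangle_def)
  next
    case long2
    then show ?thesis by (intro exI[of _ "(2, 0)"] exI[of _ "(-1, 0)"] exI[of _ "(-1, 1)"])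
      (simp add: det2_def lattice_map_def long_triangle_def)
  next
    case long3
    then show ?thesis by (intro exI[of _ "(0, 0)"] exI[of _ "(0, 1)"] exI[of _ "(1, 0)"])
      (simp add: det2_def lattice_map_def long_triangle_def)
  next
    case long4
    then show ?thesis by (intro exI[of _ "(0, 2)"] exI[of _ "(0, -1)"] exI[of _ "(1, -1)"])
      (simp add: det2_def lattice_map_def long_triangle_def)
  next
    case long5
    then show ?thesis by (intro exI[of _ "(2, 0)"] exI[of _ "(-1, 1)"] exI[of _ "(-1, 0)"])
      (simp add: det2_def lattice_map_def long_triangle_def)
  next
    case long6
    then show ?thesis by (intro exI[of _ "(0, 2)"] exI[of _ "(1, -1)"] exI[of _ "(0, -1)"])
      (simp add: det2_def lattice_map_def long_triangle_def)
  qed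
qed

lemma vimage_in_double_triangle:
  assumes w: "\<not> wide (lattice_map 0 u v -` B)" and uv: "\<bar>det2 u v\<bar> = 1" and B: "lattice_convex B"
  obtains b where "lattice_map b u v -` B \<subseteq> double_triangle"
proof -
  have C: "lattice_convex (lattice_map 0 u v -` B)" by (rule lattice_convex_vimage[OF uv B])
  then have fin: "finite (lattice_map 0 u v -` B)" "lattice_map 0 u v -` B \<noteq> {}"
    unfolding lattice_convex_def by blast+
  obtain b where b: "lattice_map 0 u v -` B \<subseteq> (+) b ` double_triangle"
    using not_wide_in_double_triangle[OF w fin] by blast
  have "lattice_map (lattice_map 0 u v b) u v -` B \<subseteq> double_triangle"
  proof
    fix q assume "q \<in> lattice_map (lattice_map 0 u v b) u v -` B"
    then have "lattice_map 0 u v (b + q) \<in> B"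
      by (simp add: lattice_map_def distrib_right distrib_left add_ac)
    then have "b + q \<in> (+) b ` double_triangle" using b by blast
    then show "q \<in> double_triangle" by auto
  qed
  then show ?thesis by (rule that)
qed

text \<open>What narrowness yields on both sides of the equivalence.\<close>

definition at_most_double :: "(int \<times> int) set \<Rightarrow> (int \<times> int) set \<Rightarrow> bool"
  where "at_most_double A B \<longleftrightarrow> MV A B \<le> 2 \<and> (\<forall>f\<in>laurent_space A. \<forall>g\<in>laurent_space B. small_system f g)"

lemma at_most_double_commute: "at_most_double A B \<Longrightarrow> at_most_double B A"
  unfolding at_most_double_def using MV_commute[of A B] small_system_commute by auto

lemma at_most_double_twins:
  assumes "twins unit_square A B \<or> twins long_triangle A B" shows "at_most_double A B"
  using assms
proof
  assume "twins unit_square A B"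
  then obtain a b x y where xy: "\<bar>det2 x y\<bar> = 1" and e: "A = lattice_map a x y ` unit_square" "B = lattice_map b x y ` unit_square"
    unfolding twins_def by (elim exE conjE)
  have "MV A B = MV unit_square unit_square"
    unfolding e by (rule MV_lattice_map[OF _ _ xy]) (simp_all add: unit_square_def)
  then have "MV A B \<le> 2" using MV_square_square by (simp add: unit_square_def)
  then show ?thesis unfolding at_most_double_def e unit_square_def using small_system_square[OF xy] by blast
next
  assume "twins long_triangle A B"
  then obtain a b x y where xy: "\<bar>det2 x y\<bar> = 1" and e: "A = lattice_map a x y ` long_triangle" "B = lattice_map b x y ` long_triangle"
    unfolding twins_def by (elim exE conjE)
  have "MV A B = MV long_triangle long_triangle"
    unfolding e by (rule MV_lattice_map[OF _ _ xy]) (simp_all add: long_triangle_def)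
  then have "MV A B \<le> 2" using MV_long_triangle_self by (simp add: long_triangle_def)
  then show ?thesis unfolding at_most_double_def e long_triangle_def using small_system_long_triangle[OF xy] by blast
qed

lemma unimodular_triangle_image: "lattice_map a u v ` {(0, 0), (1, 0), (0, 1)} = {a, a + u, a + v}"
  by (auto simp: lattice_map_def prod_eq_iff)

lemma card_unimodular_triangle:
  assumes "\<bar>det2 u v\<bar> = 1" shows "card {a, a + u, a + v} = 3"
proof -
  have "card (lattice_map a u v ` {(0, 0), (1, 0), (0, 1)}) = card {(0, 0), (1, 0), (0 :: int, 1 :: int)}"
    by (intro card_image inj_on_subset[OF lattice_map_inj[OF assms]]) simp
  then show ?thesis unfolding unimodular_triangle_image by simp
qed

text \<open>A polygon with three lattice points is a unimodular triangle, so in its frame the other polygon lies in a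
  double triangle.\<close>

lemma at_most_double_triangle:
  assumes n: "narrow A B" and A: "lattice_convex A" "card A \<le> 3" and B: "lattice_convex B"
  shows "at_most_double A B"
proof -
  obtain a u v where uv: "\<bar>det2 u v\<bar> = 1" and sub: "{a, a + u, a + v} \<subseteq> A" by (rule contains_unimodular[OF A(1)])
  have finA: "finite A" using A(1) by (simp add: lattice_convex_def)
  have eA: "A = lattice_map a u v ` {(0, 0), (1, 0), (0, 1)}"
    unfolding unimodular_triangle_image
    by (rule card_seteq[OF finA sub, symmetric]) (use A(2) card_unimodular_triangle[OF uv, of a] in linarith)
  have "\<not> wide (lattice_map 0 u v -` B)" using n uv sub unfolding narrow_def by blast
  then obtain b where b: "lattice_map b u v -` B \<subseteq> double_triangle" by (rule vimage_in_double_triangle[OF _ uv B])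
  let ?B = "lattice_map b u v -` B"
  have eB: "B = lattice_map b u v ` ?B" by (rule lattice_map_image_vimage[OF uv, symmetric])
  have LC: "lattice_convex ?B" by (rule lattice_convex_vimage[OF uv B])
  have fin: "finite ?B" "?B \<noteq> {}" using LC unfolding lattice_convex_def by blast+
  have "MV A B = MV {(0, 0), (1, 0), (0, 1)} ?B"
    by (subst eA, subst eB) (rule MV_lattice_map[OF _ fin(1) uv], simp)
  also have "\<dots> \<le> 2"
  proof (rule MV_triangle_double_triangle[OF fin(2)])
    fix c assume "c \<in> ?B"
    then have "c \<in> double_triangle" using b by blast
    then show "0 \<le> fst c \<and> 0 \<le> snd c \<and> fst c + snd c \<le> 2" by (auto simp: double_triangle_def)
  qed
  finally have "MV A B \<le> 2" .
  moreover have "small_system f g" if "f \<in> laurent_space A" "g \<in> laurent_space B" for f g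
  proof (rule small_system_triangle[OF uv])
    show "f \<in> laurent_space (lattice_map a u v ` {(0, 0), (1, 0), (0, 1)})" using that(1) eA by simp
    have "B \<subseteq> lattice_map b u v ` double_triangle" by (subst eB) (rule image_mono[OF b])
    then show "g \<in> laurent_space (lattice_map b u v ` {(0, 0), (1, 0), (0, 1), (2, 0), (1, 1), (0, 2)})"
      using that(2) unfolding laurent_space_def double_triangle_def[symmetric] by blast
  qed
  ultimately show ?thesis unfolding at_most_double_def by blast
qed

text \<open>Two polygons with at least four points each are twins: a frame from \<open>B\<close> puts \<open>A\<close>
  into the double triangle, where it contains a square or a long triangle, and either one forces both shapes.\<close>

lemma at_most_double_of_narrow:
  assumes n: "narrow A B" "narrow B A" and LC: "lattice_convex A" "lattice_convex B"
  shows "at_most_double A B"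
proof -
  consider "card A \<le> 3" | "card B \<le> 3" | "4 \<le> card A" "4 \<le> card B" by linarith
  then show ?thesis
  proof cases
    case 1
    then show ?thesis by (rule at_most_double_triangle[OF n(1) LC(1) _ LC(2)])
  next
    case 2
    then show ?thesis by (rule at_most_double_commute[OF at_most_double_triangle[OF n(2) LC(2) _ LC(1)]])
  next
    case 3
    obtain b u v where uv: "\<bar>det2 u v\<bar> = 1" and sub: "{b, b + u, b + v} \<subseteq> B" by (rule contains_unimodular[OF LC(2)])
    have "\<not> wide (lattice_map 0 u v -` A)" using n(2) uv sub unfolding narrow_def by blast
    then obtain a where a: "lattice_map a u v -` A \<subseteq> double_triangle" by (rule vimage_in_double_triangle[OF _ uv LC(1)])
    let ?A = "lattice_map a u v -` A" and ?B = "lattice_map 0 u v -` B"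
    have card: "4 \<le> card ?A" "4 \<le> card ?B" using 3 by (simp_all add: card_vimage_lattice_map[OF uv])
    have LC': "lattice_convex ?A" "lattice_convex ?B" by (rule lattice_convex_vimage[OF uv], rule LC)+
    have n': "narrow ?A ?B" "narrow ?B ?A" by (rule narrow_vimage[OF _ uv], rule n)+
    obtain c x y where xy: "\<bar>det2 x y\<bar> = 1"
      and cases: "lattice_map c x y ` unit_square \<subseteq> ?A \<or> lattice_map c x y ` long_triangle \<subseteq> ?A"
      using four_points_of_double_triangle[OF LC'(1) a card(1)] by (elim exE conjE)
    have "twins unit_square ?A ?B \<or> twins long_triangle ?A ?B"
      using cases
    proof
      assume "lattice_map c x y ` unit_square \<subseteq> ?A"
      then show ?thesis using twins_square[OF n' xy _ LC' card] by blast
    next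
      assume "lattice_map c x y ` long_triangle \<subseteq> ?A"
      then show ?thesis by (rule twins_long[OF n' xy _ LC' card])
    qed
    then have "twins unit_square A B \<or> twins long_triangle A B" using twins_vimage[OF _ uv] by blast
    then show ?thesis by (rule at_most_double_twins)
  qed
qed

text \<open>In the frame of the offending triangle the contact theorem gives the root, while the size of \<open>B\<close>
  bounds the mixed volume from below.\<close>

lemma triple_root_of_not_narrow:
  assumes n: "\<not> narrow A B" and A: "finite A" and B: "lattice_convex B"
  shows "can_have_root_of_multiplicity A B 3 \<and> 3 \<le> MV A B"
proof -
  obtain a u v where uv: "\<bar>det2 u v\<bar> = 1" and sub: "{a, a + u, a + v} \<subseteq> A" and w: "wide (lattice_map 0 u v -` B)"
    using n unfolding narrow_def by auto
  let ?A = "lattice_map a u v -` A" and ?B = "lattice_map 0 u v -` B"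
  have LC: "lattice_convex ?B" by (rule lattice_convex_vimage[OF uv B])
  have "triple_contact ?B" by (rule triple_contact_of_wide[OF LC w])
  then have "tangent_pair A B"
    unfolding triple_contact_def
  proof (rule tangent_pair_lattice_map[OF _ uv])
    show "lattice_map a u v ` {(0, 0), (1, 0), (0, 1)} \<subseteq> A" unfolding unimodular_triangle_image by (rule sub)
  qed (rule image_vimage_subset)
  then have "can_have_root_of_multiplicity A B 3" by (rule tangent_pair_root)
  moreover have "3 \<le> MV A B"
  proof -
    have fin: "finite ?A" "finite ?B"
      using A B finite_vimageI[OF _ lattice_map_inj[OF uv]] by (auto simp: lattice_convex_def)
    have std: "{(0, 0), (1, 0), (0, 1)} \<subseteq> ?A"
      using sub unfolding unimodular_triangle_image[symmetric, of a u v] by blast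
    obtain q1 q2 q3 where q: "q1 \<in> ?B" "q2 \<in> ?B" "q3 \<in> ?B" "3 \<le> fst q3 + snd q3 - fst q1 - snd q2"
      using w unfolding wide_def by blast
    have "3 \<le> MV ?A ?B" using MV_ge_spread[OF fin(1) std fin(2) q(1-3)] q(4) by linarith
    also have "\<dots> = MV (lattice_map a u v ` ?A) (lattice_map 0 u v ` ?B)" by (rule MV_lattice_map[OF fin uv, symmetric])
    also have "\<dots> = MV A B" unfolding lattice_map_image_vimage[OF uv] ..
    finally show ?thesis .
  qed
  ultimately show ?thesis ..
qed

text \<open>The ideal and the solution set depend on the unordered pair.\<close>

lemma can_have_root_commute:
  assumes "can_have_root_of_multiplicity A B n" shows "can_have_root_of_multiplicity B A n"
proof -
  obtain f g p where fg: "f \<in> laurent_space A" "g \<in> laurent_space B" and r: "root_of_multiplicity f g p n"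
    using assms unfolding can_have_root_of_multiplicity_def by blast
  have "solutions g f = solutions f g" unfolding solutions_def by blast
  moreover have "system_ideal p g f = system_ideal p f g" unfolding system_ideal_def by (simp only: insert_commute)
  ultimately have "root_of_multiplicity g f p n"
    using r unfolding root_of_multiplicity_def roots_def intersection_multiplicity_def quotient_ring_def quotient_constants_def
    by simp
  then show ?thesis using fg unfolding can_have_root_of_multiplicity_def by blast
qed

theorem theorem1p3:
  fixes A B :: "(int \<times> int) set"
  assumes "newton_polygon A" and "newton_polygon B"
  shows "(\<not> can_have_root_of_multiplicity A B 3 \<longleftrightarrow> MV A B \<le> 2) \<and>
         (can_have_at_least_roots A B 3 \<longrightarrow> can_have_root_of_multiplicity A B 3)"
proof -
  have LC: "lattice_convex A" "lattice_convex B" using assms by (simp_all add: newton_polygon_lattice_convex)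
  have fin: "finite A" "finite B" using LC unfolding lattice_convex_def by blast+
  show ?thesis
  proof (cases "narrow A B \<and> narrow B A")
    case True
    then have d: "at_most_double A B" using at_most_double_of_narrow[OF _ _ LC] by blast
    then have "\<not> can_have_root_of_multiplicity A B 3" "\<not> can_have_at_least_roots A B 3"
      using small_system_roots
      unfolding at_most_double_def can_have_root_of_multiplicity_def can_have_at_least_roots_def by blast+
    then show ?thesis using d unfolding at_most_double_def by blast
  next
    case False
    then have "can_have_root_of_multiplicity A B 3 \<and> 3 \<le> MV A B"
    proof (cases "narrow A B")
      case True
      then have "can_have_root_of_multiplicity B A 3 \<and> 3 \<le> MV B A"
        using False triple_root_of_not_narrow[OF _ fin(2) LC(1)] by blast
      then show ?thesis using can_have_root_commute[of B A 3] MV_commute[of A B] by simp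
    next
      case False
      then show ?thesis by (rule triple_root_of_not_narrow[OF _ fin(1) LC(2)])
    qed
    then show ?thesis by linarith
  qed
qed

end
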